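(* Let $\Omega\subset\mathbb{R}^d$ be an interior $(\varepsilon,\delta)$-corkscrew domain, let $1\le p<\infty$, $1\le q\le\infty$ and $0<s<1$. Then the operator $$\Lambda_0f=f\chi_\Omega+\sum_{Q\in\mathcal{W}_3}\psi_Q\,f_{Q^*}$$ is bounded $$\Lambda_0:F^{s,C\ell_0}_{p,q,1}(\Omega)\to F^{s,1}_{p,q,1}(\mathbb{R}^d),$$ where $C$ depends only on $d$ and $\varepsilon$, while $\ell_0$ depends also on $\delta$.
   Context: Function spaces: for an open set $U\subset\mathbb{R}^d$, $1\le p<\infty$, $1\le q\le\infty$, $0<s<1$ and $\rho>0$, $F^{s,\rho}_{p,q,1}(U)$ is the space of $f\in L^p(U)$ with finite norm $\|f\|_{F^{s,\rho}_{p,q,1}(U)}=\|f\|_{L^p(U)}+\|f\|_{\dot F^{s,\rho}_{p,q,1}(U)}$, where $$\|f\|_{\dot F^{s,\rho}_{p,q,1}(U)}=\left(\int_U\left(\int_0^\rho\frac{\left(\int_{B(x,t)\cap U}|f(x)-f(y)|\,dy\right)^q}{t^{sq+dq}}\frac{dt}{t}\right)^{\frac pq}dx\right)^{\frac1p}$$ (usual modification for $q=\infty$). Dyadic cubes are the open cubes $2^{-j}(m+(0,1)^d)$, $j\in\mathbb{Z}$, $m\in\mathbb{Z}^d$. For a cube $Q$, $\ell(Q)$ is its side-length and $rQ$ the concentric dilate by $r$. Long distance: $\mathrm{D}(A,B)=\mathrm{diam}(A)+\mathrm{diam}(B)+\mathrm{dist}(A,B)$. A Whitney covering of an open set $\Omega$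 is a collection $\mathcal{W}$ of pairwise disjoint open dyadic cubes such that the union of the cubes and their boundaries is $\Omega$, $C_{\mathcal{W}}\ell(Q)\le\mathrm{dist}(Q,\partial\Omega)\le4C_{\mathcal{W}}\ell(Q)$ for a constant $C_{\mathcal{W}}$, $\{50Q\}_{Q\in\mathcal{W}}$ has finite superposition, and $S\subset5Q$ implies $\ell(S)\ge\frac12\ell(Q)$ for $S,Q\in\mathcal{W}$. A domain $\Omega$ is an interior $(\varepsilon,\delta)$-corkscrew domain if it has a Whitney covering such that for every ball $B(x,r)$ with $x\in\partial\Omega$ and $0<r\le\delta$ there is a Whitney cube $Q\subset B(x,r)$ with $\ell(Q)\ge\varepsilon r$. Construction of $\Lambda_0$: let $\mathcal{W}_0$ be a Whitney covering of $\Omega$ (as in the corkscrew condition) and $\mathcal{W}_2$ a Whitney covering of $\overline\Omega^c$. Let $c_0$ be a fixed, sufficiently large constant. If $\Omega$ is unbounded and $\delta=\infty$, take $\ell_0=1$; otherwise fix $\ell_0>0$ depending on the corkscrew parameters so that $c_0\ell_0$ is much smaller than $\min\{\delta,1\}$. Let $\mathcal{W}_3$ be the cubes of $\mathcal{W}_2$ with side-length smaller than $10\ell_0$ and $\mathcal{W}_1$ the cubes of $\mathcal{W}_0$ with side-length smaller than $c_0\ell_0$; $\ell_0$ is chosen so that for every $Q\in\mathcal{W}_3$ there is $S\in\mathcal{W}_1$ with $\mathrm{D}(Q,S)\le C\ell(Q)$ and $\ell(S)=\ell(Q)$. For each $Q\in\mathcal{W}_3$ the symmetrized cube $Q^*\in\mathcal{W}_1$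 is one such cube $S$. The functions $\{\psi_Q\}_{Q\in\mathcal{W}_2}$ form a partition of unity on $\overline\Omega^c$: $\sum_Q\psi_Q\equiv1$, $0\le\psi_Q\le\chi_{\frac{11}{10}Q}$, $\|\nabla\psi_Q\|_\infty\lesssim1/\ell(Q)$. $f_{Q^*}$ denotes the mean of $f$ on $Q^*$; $\Lambda_0 f$ is defined almost everywhere for $f\in L^1_{\rm loc}(\Omega)$. *)

theory Defs
  imports "HOL-Analysis.Analysis"
begin

text \<open>Real powers on $[0,\infty]$; only used with exponent $a > 0$.\<close>

definition epowr :: "ennreal \<Rightarrow> real \<Rightarrow> ennreal" where
  "epowr x a = (if x = \<infinity> then \<infinity> else ennreal (enn2real x powr a))"

section \<open>The spaces $F^{s,\rho}_{p,q,1}(U)$\<close>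

text \<open>Functions are complex valued, which contains the real-valued case. A function on $U$ is a
  total function of which only the values on $U$ matter; as $F^{s,\rho}_{p,q,1}(U) \subset L^p(U)$
  consists of functions up to null sets, every definition below is insensitive to changing $f$ on
  a null subset of $U$.\<close>

definition Lp_norm :: "real \<Rightarrow> (real^'d) set \<Rightarrow> (real^'d \<Rightarrow> complex) \<Rightarrow> ennreal" where
  "Lp_norm p U f = epowr (\<integral>\<^sup>+x\<in>U. ennreal (norm (f x) powr p) \<partial>lebesgue) (1 / p)"

definition osc :: "(real^'d) set \<Rightarrow> (real^'d \<Rightarrow> complex) \<Rightarrow> real^'d \<Rightarrow> real \<Rightarrow> ennreal" where
  "osc U f x t = (\<integral>\<^sup>+y\<in>ball x t \<inter> U. ennreal (norm (f x - f y)) \<partial>lebesgue)"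

text \<open>For $q = \infty$ the essential supremum over $t$ is a supremum, because
  \<open>\<lambda>t. osc U f x t / t powr (s + d)\<close> is left-continuous (the balls are open).\<close>

definition F_seminorm ::
  "real \<Rightarrow> real \<Rightarrow> real \<Rightarrow> ennreal \<Rightarrow> (real^'d) set \<Rightarrow> (real^'d \<Rightarrow> complex) \<Rightarrow> ennreal" where
  "F_seminorm s \<rho> p q U f =
     epowr (\<integral>\<^sup>+x\<in>U.
        (if q = \<infinity>
         then epowr (SUP t\<in>{0<..<\<rho>}. osc U f x t / ennreal (t powr (s + real CARD('d)))) p
         else epowr (\<integral>\<^sup>+t\<in>{0<..<\<rho>}.
                       epowr (osc U f x t) (enn2real q)
                         / ennreal (t powr (s * enn2real q + real CARD('d) * enn2real q))
                         / ennreal t \<partial>lebesgue) (p / enn2real q))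
      \<partial>lebesgue) (1 / p)"

definition F_norm ::
  "real \<Rightarrow> real \<Rightarrow> real \<Rightarrow> ennreal \<Rightarrow> (real^'d) set \<Rightarrow> (real^'d \<Rightarrow> complex) \<Rightarrow> ennreal" where
  "F_norm s \<rho> p q U f = Lp_norm p U f + F_seminorm s \<rho> p q U f"

definition F_space ::
  "real \<Rightarrow> real \<Rightarrow> real \<Rightarrow> ennreal \<Rightarrow> (real^'d) set \<Rightarrow> (real^'d \<Rightarrow> complex) set" where
  "F_space s \<rho> p q U = {f \<in> borel_measurable (lebesgue_on U). F_norm s \<rho> p q U f < \<infinity>}"

section \<open>Dyadic cubes and Whitney coverings\<close>

text \<open>The pair $(j,m)$ stands for the open dyadic cube $2^{-j}(m + (0,1)^d)$; distinct pairs are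
  distinct cubes.\<close>

type_synonym 'd dyadic = "int \<times> (int^'d)"

definition side :: "'d dyadic \<Rightarrow> real" where
  "side Q = 2 powi (- fst Q)"

definition cube :: "'d dyadic \<Rightarrow> (real^'d) set" where
  "cube Q = {x. \<forall>i. side Q * of_int (snd Q $ i) < x $ i \<and> x $ i < side Q * (of_int (snd Q $ i) + 1)}"

definition center :: "'d dyadic \<Rightarrow> real^'d" where
  "center Q = (\<chi> i. side Q * (of_int (snd Q $ i) + 1 / 2))"

definition dilate :: "real \<Rightarrow> 'd dyadic \<Rightarrow> (real^'d) set" where
  "dilate r Q = {x. \<forall>i. \<bar>x $ i - center Q $ i\<bar> < r * side Q / 2}"

lemma dilate_1: "dilate 1 Q = cube Q"
proof -
  have "\<bar>u - t * (k + 1 / 2)\<bar> < 1 * t / 2 \<longleftrightarrow> t * k < u \<and> u < t * (k + 1)" for u t k :: real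
    unfolding abs_less_iff by (auto simp: field_simps)
  then show ?thesis
    by (simp add: dilate_def cube_def center_def)
qed

definition long_dist :: "(real^'d) set \<Rightarrow> (real^'d) set \<Rightarrow> real" where
  "long_dist A B = diameter A + diameter B + setdist A B"

text \<open>The library's convention \<open>setdist A {} = 0\<close> does no harm: it leaves $\mathbb{R}^d$ (the only
  nonempty open set without boundary) without a Whitney covering, as the convention
  $\mathrm{dist}(Q,\emptyset) = \infty$ would.\<close>

definition whitney_covering_const :: "real \<Rightarrow> (real^'d) set \<Rightarrow> 'd dyadic set \<Rightarrow> bool" where
  "whitney_covering_const C\<^sub>W \<Omega> W \<longleftrightarrow>
     0 < C\<^sub>W \<and>
     disjoint_family_on cube W \<and>
     (\<Union>Q\<in>W. closure (cube Q)) = \<Omega> \<and>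
     (\<forall>Q\<in>W. C\<^sub>W * side Q \<le> setdist (cube Q) (frontier \<Omega>) \<and>
             setdist (cube Q) (frontier \<Omega>) \<le> 4 * C\<^sub>W * side Q) \<and>
     (\<exists>N. \<forall>x. finite {Q \<in> W. x \<in> dilate 50 Q} \<and> card {Q \<in> W. x \<in> dilate 50 Q} \<le> N) \<and>
     (\<forall>S\<in>W. \<forall>Q\<in>W. cube S \<subseteq> dilate 5 Q \<longrightarrow> side S \<ge> side Q / 2)"

definition whitney_covering :: "(real^'d) set \<Rightarrow> 'd dyadic set \<Rightarrow> bool" where
  "whitney_covering \<Omega> W \<longleftrightarrow> (\<exists>C\<^sub>W. whitney_covering_const C\<^sub>W \<Omega> W)"

definition corkscrew_covering :: "real \<Rightarrow> ereal \<Rightarrow> (real^'d) set \<Rightarrow> 'd dyadic set \<Rightarrow> bool" where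
  "corkscrew_covering \<epsilon> \<delta> \<Omega> W \<longleftrightarrow>
     whitney_covering \<Omega> W \<and>
     (\<forall>x\<in>frontier \<Omega>. \<forall>r>0. ereal r \<le> \<delta> \<longrightarrow> (\<exists>Q\<in>W. cube Q \<subseteq> ball x r \<and> side Q \<ge> \<epsilon> * r))"

definition interior_corkscrew_domain :: "real \<Rightarrow> ereal \<Rightarrow> (real^'d) set \<Rightarrow> bool" where
  "interior_corkscrew_domain \<epsilon> \<delta> \<Omega> \<longleftrightarrow>
     open \<Omega> \<and> connected \<Omega> \<and> \<Omega> \<noteq> {} \<and> (\<exists>W. corkscrew_covering \<epsilon> \<delta> \<Omega> W)"

section \<open>The operator $\Lambda_0$\<close>

definition whitney_partition ::
  "(real^'d) set \<Rightarrow> 'd dyadic set \<Rightarrow> ('d dyadic \<Rightarrow> real^'d \<Rightarrow> real) \<Rightarrow> bool" where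
  "whitney_partition G W \<psi> \<longleftrightarrow>
     (\<forall>x\<in>G. ((\<lambda>Q. \<psi> Q x) has_sum 1) W) \<and>
     (\<forall>Q\<in>W. \<forall>x. 0 \<le> \<psi> Q x \<and> \<psi> Q x \<le> indicator (dilate (11/10) Q) x) \<and>
     (\<exists>M. \<forall>Q\<in>W. \<forall>x. \<exists>g. (GDERIV (\<psi> Q) x :> g) \<and> norm g \<le> M / side Q)"

text \<open>The requirement that $c_0\ell_0$ be much smaller than $\min\{\delta,1\}$ is
  $c_0\ell_0 \le \eta\min\{\delta,1\}$, with a threshold \<open>\<eta>\<close> supplied by the theorem.\<close>

definition admissible_scale :: "real \<Rightarrow> real \<Rightarrow> ereal \<Rightarrow> (real^'d) set \<Rightarrow> real \<Rightarrow> bool" where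
  "admissible_scale \<eta> c\<^sub>0 \<delta> \<Omega> l\<^sub>0 \<longleftrightarrow>
     (if \<not> bounded \<Omega> \<and> \<delta> = \<infinity> then l\<^sub>0 = 1
      else 0 < l\<^sub>0 \<and> ereal (c\<^sub>0 * l\<^sub>0) \<le> ereal \<eta> * min \<delta> 1)"

definition small_cubes :: "real \<Rightarrow> 'd dyadic set \<Rightarrow> 'd dyadic set" where
  "small_cubes l W = {Q \<in> W. side Q < l}"

definition symmetrized :: "real \<Rightarrow> 'd::finite dyadic \<Rightarrow> 'd dyadic \<Rightarrow> bool" where
  "symmetrized C Q S \<longleftrightarrow> long_dist (cube Q) (cube S) \<le> C * side Q \<and> side S = side Q"

definition mean :: "(real^'d \<Rightarrow> complex) \<Rightarrow> (real^'d) set \<Rightarrow> complex" where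
  "mean f A = (1 / measure lebesgue A) *\<^sub>R (LINT y:A|lebesgue. f y)"

definition Lambda0 ::
  "(real^'d) set \<Rightarrow> 'd dyadic set \<Rightarrow> ('d dyadic \<Rightarrow> real^'d \<Rightarrow> real) \<Rightarrow> ('d dyadic \<Rightarrow> 'd dyadic)
     \<Rightarrow> (real^'d \<Rightarrow> complex) \<Rightarrow> (real^'d \<Rightarrow> complex)" where
  "Lambda0 \<Omega> W\<^sub>3 \<psi> star f x =
     indicator \<Omega> x *\<^sub>R f x + (\<Sum>\<^sub>\<infinity>Q\<in>W\<^sub>3. \<psi> Q x *\<^sub>R mean f (cube (star Q)))"

end

theory Submission
  imports Defs
begin

text \<open>Write \<open>g = \<Lambda>\<^sub>0 f\<close> and let \<open>D\<close> be the distance to the frontier of the exterior. At an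
  exterior point \<open>x\<close> of a cube \<open>Q\<close> one compares \<open>g\<close> with the value \<open>f \<xi>\<close> for every single \<open>\<xi>\<close> in
  the symmetrized cube \<open>Q\<^sup>*\<close>, not with the mean over \<open>Q\<^sup>*\<close>; this makes Minkowski's integral
  inequality unnecessary when \<open>q > p\<close>. On balls of radius \<open>t \<le> c D\<close> around \<open>x\<close> the partition of unity makes \<open>g\<close> Lipschitz,
  with constant a multiple of \<open>1 / D\<close> times the differences between \<open>f \<xi>\<close> and the means over the
  nearby symmetrized cubes. A ball of radius \<open>t > c D\<close> around \<open>x\<close> lies in a comparable ball around \<open>\<xi>\<close>,
  where the oscillation of \<open>g\<close> is controlled by that of \<open>f\<close> in \<open>\<Omega>\<close>. So the inner norm of
  \<open>g\<close> at \<open>x\<close> is bounded by the inner norm of \<open>f\<close> at every \<open>\<xi> \<in> Q\<^sup>*\<close>; averaging the \<open>p\<close>-th powers over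
  \<open>\<xi>\<close> and summing over the boundedly overlapping \<open>Q\<^sup>*\<close> gives the estimate. Radii above a fixed
  multiple of \<open>\<ell>\<^sub>0\<close> cost only the \<open>L\<^sup>p\<close> norm, and the frontier of \<open>\<Omega>\<close> is porous, hence null.\<close>

text \<open>Both regimes of radii fit one profile, \<open>scale_model\<close>: linear in t / D below
  the distance D, constant beyond, weighted by D^s. Its inner norm is bounded uniformly in D because
  0 < s < 1, so only its coefficient has to be estimated. That coefficient is D^(-s) times
  differences between \<open>f \<xi>\<close> and averages, hence at most a multiple of D^(-s-d)
  times one oscillation of f at \<xi>, at a radius comparable to D. Oscillations grow with the
  radius, so the inner norm of f at \<xi> controls this single value.

  Subtracting \<open>f \<xi>\<close> requires the partition of unity to sum to 1 over the cubes that
  have a symmetrized one, which is guaranteed only near the frontier. Farther away the averages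
  themselves enter, and they cost the L^p norm.

  A symmetrized cube of exactly the side of Q exists for two reasons: the corkscrew condition at
  radius side Q / \<epsilon> gives a cube at least that large, and a segment from it to the frontier
  meets cubes of every smaller dyadic size. The lengths along this path add up to the least C, and
  \<open>\<eta> = \<epsilon>\<close> makes the radius admissible.\<close>

section \<open>Powers on [0, \<infinity>]\<close>

lemma epowr_ennreal: "0 \<le> x \<Longrightarrow> epowr (ennreal x) a = ennreal (x powr a)"
  by (simp add: epowr_def)

lemma epowr_top [simp]: "epowr \<infinity> a = \<infinity>" "epowr top a = top"
  by (simp_all add: epowr_def)

lemma epowr_0 [simp]: "epowr 0 a = 0"
  by (simp add: epowr_def)

lemma epowr_1 [simp]: "epowr x 1 = x"
  by (cases x) (simp_all add: epowr_ennreal)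

lemma epowr_mono: "x \<le> y \<Longrightarrow> 0 \<le> a \<Longrightarrow> epowr x a \<le> epowr y a"
  by (cases x; cases y) (auto simp: epowr_ennreal powr_mono2 top_unique)

lemma epowr_eq_top_iff [simp]: "epowr x a = top \<longleftrightarrow> x = top"
  by (cases x) (auto simp: epowr_ennreal)

lemma epowr_mult:
  assumes "0 < a"
  shows "epowr (x * y) a = epowr x a * epowr y a"
proof -
  have top: "epowr (top * z) a = top * epowr z a" for z
    using assms by (cases z) (auto simp: epowr_ennreal ennreal_top_mult ennreal_eq_0_iff)
  show ?thesis
  proof (cases x)
    case (real r)
    show ?thesis
    proof (cases y)
      case (real r')
      then show ?thesis
        using \<open>x = ennreal r\<close> \<open>0 \<le> r\<close> by (simp add: epowr_ennreal powr_mult flip: ennreal_mult)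
    next
      case top': top
      show ?thesis unfolding top' using top[of x] by (simp add: mult.commute)
    qed
  next
    case top': top
    show ?thesis unfolding top' using top[of y] by simp
  qed
qed

lemma epowr_epowr: "epowr (epowr x a) b = epowr x (a * b)"
  by (cases x) (auto simp: epowr_ennreal powr_powr)

lemma epowr_measurable [measurable]: "(\<lambda>x. epowr x a) \<in> borel_measurable borel"
  unfolding epowr_def by measurable

text \<open>Bounding the sum by twice the maximum treats concave and convex powers alike. Both
  occur: the exponents below are q, p, p / q and 1 / p.\<close>

lemma epowr_add_le:
  assumes "0 < a"
  shows "epowr (x + y) a \<le> ennreal (2 powr a) * (epowr x a + epowr y a)"
proof -
  have "x + y \<le> ennreal 2 * max x y"
    using add_mono[of x "max x y" y "max x y"] by (simp add: mult_2)
  then have "epowr (x + y) a \<le> epowr (ennreal 2 * max x y) a"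
    using assms by (intro epowr_mono) auto
  also have "\<dots> = ennreal (2 powr a) * epowr (max x y) a"
    using assms by (subst epowr_mult) (auto simp: epowr_ennreal simp del: ennreal_numeral)
  also have "\<dots> \<le> ennreal (2 powr a) * (epowr x a + epowr y a)"
    by (intro mult_left_mono) (auto simp: max_def)
  finally show ?thesis .
qed

lemma epowr_sum_le:
  assumes "0 < a" "finite T"
  shows "epowr (\<Sum>i\<in>T. v i) a \<le> ennreal (real (card T) powr a) * (\<Sum>i\<in>T. epowr (v i) a)"
proof (cases "T = {}")
  case False
  define m where "m = Max (v ` T)"
  have "m \<in> v ` T" using False assms by (simp add: m_def)
  then obtain k where k: "k \<in> T" "m = v k" by auto
  have "(\<Sum>i\<in>T. v i) \<le> of_nat (card T) * m"
    using assms False by (intro sum_bounded_above) (auto simp: m_def)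
  then have "epowr (\<Sum>i\<in>T. v i) a \<le> epowr (ennreal (real (card T)) * m) a"
    using assms by (intro epowr_mono) (auto simp: ennreal_of_nat_eq_real_of_nat)
  also have "\<dots> = ennreal (real (card T) powr a) * epowr (v k) a"
    using assms k by (subst epowr_mult) (auto simp: epowr_ennreal)
  also have "\<dots> \<le> ennreal (real (card T) powr a) * (\<Sum>i\<in>T. epowr (v i) a)"
    using assms k by (intro mult_left_mono member_le_sum) auto
  finally show ?thesis .
qed simp

section \<open>Lebesgue measure and Jensen's inequality\<close>

lemma lebesgue_lborel_sets [measurable]: "(\<lambda>x. x) \<in> lebesgue \<rightarrow>\<^sub>M borel"
  by (simp add: measurable_completion)

text \<open>The norms integrate against the completed measure, and both Tonelli's theorem and the
  measurability of parameter integrals are applied to it directly.\<close>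

lemma sigma_finite_lebesgue: "sigma_finite_measure (lebesgue :: 'a::euclidean_space measure)"
proof (rule sigma_finite_measure.intro, intro exI conjI ballI)
  let ?A = "range (\<lambda>n::nat. ball (0::'a) (real n))"
  show "countable ?A" by simp
  show "?A \<subseteq> sets lebesgue" by auto
  have "\<exists>n. x \<in> ball 0 (real n)" for x :: 'a
    using reals_Archimedean2[of "norm x"] by simp
  then show "\<Union> ?A = space lebesgue" by auto
  show "emeasure lebesgue a \<noteq> \<infinity>" if "a \<in> ?A" for a
    using that emeasure_lborel_ball_finite[of "0::'a"] by (auto simp: less_top[symmetric])
qed

interpretation lebesgue: sigma_finite_measure "lebesgue :: 'a::euclidean_space measure"
  by (rule sigma_finite_lebesgue)

lemma pair_sigma_finite_lebesgue:
  "pair_sigma_finite (lebesgue :: 'a::euclidean_space measure) (lebesgue :: 'b::euclidean_space measure)"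
  by (intro pair_sigma_finite.intro sigma_finite_lebesgue)

text \<open>Jensen's inequality on a set of finite measure. With m the mean of u, Young's inequality
  gives the tangent line of r^p at m, that is p m^(p-1) r \<le> r^p + (p-1) m^p; integrating it
  yields m^p b \<le> \<integral> u^p. If u is not integrable, r \<le> 1 + r^p forces the right side
  to be infinite as well.\<close>

lemma epowr_set_nn_integral_le:
  fixes u :: "'a \<Rightarrow> real"
  assumes u [measurable]: "u \<in> borel_measurable M" and u0: "\<And>x. 0 \<le> u x"
    and B [measurable]: "B \<in> sets M" and b: "emeasure M B = ennreal b" "0 < b" and p: "1 \<le> p"
  shows "epowr (\<integral>\<^sup>+x\<in>B. ennreal (u x) \<partial>M) p
    \<le> ennreal (b powr (p - 1)) * (\<integral>\<^sup>+x\<in>B. ennreal (u x powr p) \<partial>M)"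
proof (cases "(\<integral>\<^sup>+x\<in>B. ennreal (u x) \<partial>M) = \<infinity>")
  case True
  have le: "r \<le> 1 + r powr p" if "0 \<le> r" for r :: real
  proof (cases "r \<le> 1")
    case False
    then show ?thesis using powr_mono[of 1 p r] p that by simp
  qed (use that in \<open>simp add: add_increasing2\<close>)
  have le': "ennreal (u x) \<le> 1 + ennreal (u x powr p)" for x
    using ennreal_leI[OF le[OF u0[of x]]] by simp
  have "(\<integral>\<^sup>+x\<in>B. ennreal (u x) \<partial>M)
      \<le> (\<integral>\<^sup>+x. indicator B x + ennreal (u x powr p) * indicator B x \<partial>M)"
    by (intro nn_integral_mono) (auto simp: indicator_def le')
  also have "\<dots> = ennreal b + (\<integral>\<^sup>+x\<in>B. ennreal (u x powr p) \<partial>M)"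
    using b by (subst nn_integral_add) auto
  finally have "(\<integral>\<^sup>+x\<in>B. ennreal (u x powr p) \<partial>M) = \<infinity>"
    using True by (auto simp: top_unique)
  then show ?thesis using b by (simp add: ennreal_mult_top ennreal_eq_0_iff)
next
  case False
  then obtain I where I: "0 \<le> I" "(\<integral>\<^sup>+x\<in>B. ennreal (u x) \<partial>M) = ennreal I"
    by (cases "(\<integral>\<^sup>+x\<in>B. ennreal (u x) \<partial>M)") auto
  show ?thesis
  proof (cases "p = 1")
    case True
    then show ?thesis using b u0 by simp
  next
    case p1: False
    with p have p1: "1 < p" by simp
    define m where "m = I / b"
    have m0: "0 \<le> m" using I b by (simp add: m_def)
    have young: "p * m powr (p - 1) * r \<le> r powr p + (p - 1) * m powr p" if "0 \<le> r" for r
    proof -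
      have "r * m powr (p - 1) \<le> r powr p / p + (m powr (p - 1)) powr (p / (p - 1)) / (p / (p - 1))"
        using p1 that by (intro Youngs_inequality) (auto simp: field_simps)
      also have "(m powr (p - 1)) powr (p / (p - 1)) = m powr p"
        using p1 by (simp add: powr_powr)
      finally have "p * (r * m powr (p - 1)) \<le> p * (r powr p / p + m powr p / (p / (p - 1)))"
        using p1 by (intro mult_left_mono) auto
      also have "\<dots> = r powr p + (p - 1) * m powr p"
        using p1 by (simp add: field_simps)
      finally show ?thesis by (simp add: mult_ac)
    qed
    have "ennreal (p * m powr (p - 1)) * ennreal I
        = (\<integral>\<^sup>+x. ennreal (p * m powr (p - 1) * u x) * indicator B x \<partial>M)"
      unfolding I(2)[symmetric] using p1 u0
      by (subst nn_integral_cmult[symmetric]) (auto simp: ennreal_mult mult_ac)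
    also have "\<dots> \<le> (\<integral>\<^sup>+x. ennreal (u x powr p) * indicator B x
        + ennreal ((p - 1) * m powr p) * indicator B x \<partial>M)"
      using young u0 p1 by (intro nn_integral_mono)
        (auto simp: indicator_def simp flip: ennreal_plus intro!: ennreal_leI)
    also have "\<dots> = (\<integral>\<^sup>+x\<in>B. ennreal (u x powr p) \<partial>M) + ennreal ((p - 1) * m powr p) * ennreal b"
      using b by (subst nn_integral_add) (auto simp: nn_integral_cmult)
    finally have main: "ennreal (p * m powr (p - 1) * I)
        \<le> (\<integral>\<^sup>+x\<in>B. ennreal (u x powr p) \<partial>M) + ennreal ((p - 1) * m powr p * b)"
      using p1 I b by (simp add: ennreal_mult)
    show ?thesis
    proof (cases "(\<integral>\<^sup>+x\<in>B. ennreal (u x powr p) \<partial>M)")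
      case (real J)
      have "p * m powr (p - 1) * I \<le> J + (p - 1) * m powr p * b"
        using main real p1 b by (simp add: ennreal_le_iff flip: ennreal_plus)
      moreover have mb: "m powr (p - 1) * I = m powr p * b"
      proof (cases "m = 0")
        case False
        then show ?thesis using b m0 by (simp add: powr_diff m_def field_simps)
      qed (use b in \<open>simp add: m_def\<close>)
      moreover from mb have "p * m powr (p - 1) * I = p * (m powr p * b)" by (simp add: mult.assoc)
      ultimately have "m powr p * b \<le> J" by (simp add: left_diff_distrib mult.assoc)
      moreover have "I powr p = b powr (p - 1) * (m powr p * b)"
        using b I by (simp add: m_def powr_divide powr_diff field_simps)
      ultimately have "I powr p \<le> b powr (p - 1) * J"
        by (simp add: mult_left_mono)
      then show ?thesis using I real by (simp add: epowr_ennreal ennreal_leI flip: ennreal_mult)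
    next
      case top
      then show ?thesis using b by (simp add: ennreal_mult_top ennreal_eq_0_iff)
    qed
  qed
qed

section \<open>The inner norm over the scales\<close>

text \<open>The p-th power of the weighted L^q(dt/t) norm, since this is what
  \<open>F_seminorm\<close> integrates in x. The argument is an arbitrary function of the radius, so
  that oscillations can be replaced by explicit majorants.\<close>

definition scale_norm ::
  "real \<Rightarrow> real \<Rightarrow> real \<Rightarrow> real \<Rightarrow> ennreal \<Rightarrow> (real \<Rightarrow> ennreal) \<Rightarrow> ennreal" where
  "scale_norm s d \<rho> p q h =
     (if q = \<infinity>
      then epowr (SUP t\<in>{0<..<\<rho>}. h t / ennreal (t powr (s + d))) p
      else epowr (\<integral>\<^sup>+t\<in>{0<..<\<rho>}. epowr (h t) (enn2real q)
                  / ennreal (t powr (s * enn2real q + d * enn2real q))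
                  / ennreal t \<partial>lebesgue) (p / enn2real q))"

lemma F_seminorm_scale_norm:
  fixes U :: "(real^'d) set"
  shows "F_seminorm s \<rho> p q U f =
    epowr (\<integral>\<^sup>+x\<in>U. scale_norm s (real CARD('d)) \<rho> p q (osc U f x) \<partial>lebesgue) (1 / p)"
  by (simp add: F_seminorm_def scale_norm_def)

lemma enn2real_ge_1: "1 \<le> q \<Longrightarrow> q \<noteq> \<infinity> \<Longrightarrow> 1 \<le> enn2real q"
  by (cases q) (auto simp flip: ennreal_1)

lemma divide_ennreal_powr: "0 < t \<Longrightarrow> x / ennreal (t powr a) = x * ennreal (t powr - a)"
  by (simp add: divide_ennreal_def inverse_ennreal powr_minus)

lemma scale_norm_mono:
  assumes "0 \<le> p" "\<And>t. 0 < t \<Longrightarrow> t < \<rho> \<Longrightarrow> h t \<le> k t"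
  shows "scale_norm s d \<rho> p q h \<le> scale_norm s d \<rho> p q k"
proof (cases "q = \<infinity>")
  case True
  then show ?thesis
    using assms by (auto simp: scale_norm_def intro!: epowr_mono SUP_subset_mono divide_right_mono_ennreal)
next
  case False
  then show ?thesis
    using assms unfolding scale_norm_def if_not_P[OF False]
    by (intro epowr_mono nn_integral_mono)
      (auto simp: indicator_def intro!: epowr_mono divide_right_mono_ennreal)
qed

text \<open>For finite q, \<open>epowr_add_le\<close> is applied to the power r inside the integral
  and to the power p / r outside. The cost is 2^p * 2^(p/r), at most 4^p as r \<ge> 1, so the
  constant is independent of q.\<close>

lemma scale_norm_add_le:
  assumes p: "1 \<le> p" and q: "1 \<le> q"
    and [measurable]: "h \<in> borel_measurable borel" "k \<in> borel_measurable borel"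
  shows "scale_norm s d \<rho> p q (\<lambda>t. h t + k t)
    \<le> ennreal (4 powr p) * (scale_norm s d \<rho> p q h + scale_norm s d \<rho> p q k)"
proof (cases "q = \<infinity>")
  case True
  let ?S = "\<lambda>h. SUP t\<in>{0<..<\<rho>}. h t / ennreal (t powr (s + d))"
  have "?S (\<lambda>t. h t + k t) \<le> ?S h + ?S k"
    by (intro SUP_least) (auto simp: add_divide_distrib_ennreal intro!: add_mono SUP_upper)
  then have "epowr (?S (\<lambda>t. h t + k t)) p \<le> epowr (?S h + ?S k) p"
    using p by (intro epowr_mono) auto
  also have "\<dots> \<le> ennreal (2 powr p) * (epowr (?S h) p + epowr (?S k) p)"
    using p by (intro epowr_add_le) auto
  also have "\<dots> \<le> ennreal (4 powr p) * (epowr (?S h) p + epowr (?S k) p)"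
    using p by (intro mult_right_mono ennreal_leI powr_mono2) auto
  finally show ?thesis using True by (simp add: scale_norm_def)
next
  case False
  define r where "r = enn2real q"
  have r: "1 \<le> r" using enn2real_ge_1[OF q False] by (simp add: r_def)
  let ?w = "\<lambda>h t. epowr (h t) r / ennreal (t powr (s * r + d * r)) / ennreal t * indicator {0<..<\<rho>} t"
  have "(\<integral>\<^sup>+t. ?w (\<lambda>t. h t + k t) t \<partial>lebesgue) \<le> (\<integral>\<^sup>+t. ennreal (2 powr r) * (?w h t + ?w k t) \<partial>lebesgue)"
  proof (intro nn_integral_mono)
    fix t
    have "?w (\<lambda>t. h t + k t) t \<le> ennreal (2 powr r) * (epowr (h t) r + epowr (k t) r)
       / ennreal (t powr (s * r + d * r)) / ennreal t * indicator {0<..<\<rho>} t"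
      using r by (intro mult_right_mono divide_right_mono_ennreal epowr_add_le) auto
    then show "?w (\<lambda>t. h t + k t) t \<le> ennreal (2 powr r) * (?w h t + ?w k t)"
      by (simp add: add_divide_distrib_ennreal distrib_left distrib_right ennreal_times_divide[symmetric] mult.assoc)
  qed
  also have "\<dots> = ennreal (2 powr r) * ((\<integral>\<^sup>+t. ?w h t \<partial>lebesgue) + (\<integral>\<^sup>+t. ?w k t \<partial>lebesgue))"
    by (simp add: nn_integral_cmult nn_integral_add nn_integral_completion)
  finally have "epowr (\<integral>\<^sup>+t. ?w (\<lambda>t. h t + k t) t \<partial>lebesgue) (p / r)
      \<le> epowr (ennreal (2 powr r) * ((\<integral>\<^sup>+t. ?w h t \<partial>lebesgue) + (\<integral>\<^sup>+t. ?w k t \<partial>lebesgue))) (p / r)"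
    using p r by (intro epowr_mono) auto
  also have "\<dots> = ennreal (2 powr p) * epowr ((\<integral>\<^sup>+t. ?w h t \<partial>lebesgue) + (\<integral>\<^sup>+t. ?w k t \<partial>lebesgue)) (p / r)"
    using p r by (subst epowr_mult) (auto simp: epowr_ennreal powr_powr)
  also have "\<dots> \<le> ennreal (2 powr p) * (ennreal (2 powr (p / r)) *
     (epowr (\<integral>\<^sup>+t. ?w h t \<partial>lebesgue) (p / r) + epowr (\<integral>\<^sup>+t. ?w k t \<partial>lebesgue) (p / r)))"
    using p r by (intro mult_left_mono epowr_add_le) auto
  also have "\<dots> \<le> ennreal (4 powr p) *
     (epowr (\<integral>\<^sup>+t. ?w h t \<partial>lebesgue) (p / r) + epowr (\<integral>\<^sup>+t. ?w k t \<partial>lebesgue) (p / r))"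
  proof -
    have "2 powr (p / r) \<le> (2::real) powr p"
      using p r by (intro powr_mono) (auto simp: divide_le_eq_1 field_simps mult_le_cancel_left1)
    then have "2 powr p * 2 powr (p / r) \<le> (2 * 2) powr p"
      unfolding powr_mult by (intro mult_left_mono) auto
    then show ?thesis
      unfolding mult.assoc[symmetric] by (intro mult_right_mono) (auto simp flip: ennreal_mult intro!: ennreal_leI)
  qed
  finally show ?thesis using False by (simp add: scale_norm_def r_def)
qed

lemma scale_norm_cmult:
  assumes p: "1 \<le> p" and q: "1 \<le> q" and [measurable]: "h \<in> borel_measurable borel"
  shows "scale_norm s d \<rho> p q (\<lambda>t. c * h t) = epowr c p * scale_norm s d \<rho> p q h"
proof (cases "q = \<infinity>")
  case True
  have "(SUP t\<in>{0<..<\<rho>}. c * h t / ennreal (t powr (s + d)))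
      = c * (SUP t\<in>{0<..<\<rho>}. h t / ennreal (t powr (s + d)))"
    by (simp add: SUP_mult_left_ennreal ennreal_times_divide)
  then show ?thesis using True p by (simp add: scale_norm_def epowr_mult)
next
  case False
  define r where "r = enn2real q"
  have r: "1 \<le> r" using enn2real_ge_1[OF q False] by (simp add: r_def)
  let ?w = "\<lambda>h t. epowr (h t) r / ennreal (t powr (s * r + d * r)) / ennreal t * indicator {0<..<\<rho>} t"
  have "(\<integral>\<^sup>+t. ?w (\<lambda>t. c * h t) t \<partial>lebesgue) = epowr c r * (\<integral>\<^sup>+t. ?w h t \<partial>lebesgue)"
    unfolding nn_integral_completion using r
    by (subst nn_integral_cmult[symmetric]) (auto simp: epowr_mult divide_ennreal_def mult.assoc)
  moreover have "epowr (epowr c r * x) (p / r) = epowr c p * epowr x (p / r)" for x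
    using p r by (subst epowr_mult) (auto simp: epowr_epowr)
  ultimately show ?thesis using False by (simp add: scale_norm_def r_def)
qed

text \<open>The measure dt/t is invariant under t \<mapsto> c t, so only the weight contributes a
  factor. The cutoff \<rho>0 keeps the dilated radii below R; this is how a norm over radii up to 1
  is bounded by a norm over radii up to R.\<close>

lemma scale_norm_dilation:
  assumes p: "1 \<le> p" and q: "1 \<le> q" and s: "0 \<le> s" "0 \<le> d" and [measurable]: "h \<in> borel_measurable borel"
    and l: "0 < c" "c * \<rho>0 \<le> R"
  shows "scale_norm s d \<rho> p q (\<lambda>t. if t < \<rho>0 then h (c * t) else 0)
    \<le> ennreal (c powr ((s + d) * p)) * scale_norm s d R p q h"
proof (cases "q = \<infinity>")
  case True
  let ?S = "SUP t\<in>{0<..<R}. h t / ennreal (t powr (s + d))"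
  have "(SUP t\<in>{0<..<\<rho>}. (if t < \<rho>0 then h (c * t) else 0) / ennreal (t powr (s + d)))
      \<le> ennreal (c powr (s + d)) * ?S"
  proof (intro SUP_least)
    fix t assume t: "t \<in> {0<..<\<rho>}"
    show "(if t < \<rho>0 then h (c * t) else 0) / ennreal (t powr (s + d)) \<le> ennreal (c powr (s + d)) * ?S"
    proof (cases "t < \<rho>0")
      case True
      have "h (c * t) / ennreal (t powr (s + d))
          = ennreal (c powr (s + d)) * (h (c * t) / ennreal ((c * t) powr (s + d)))"
      proof -
        have "c powr (s + d) * (c * t) powr - (s + d) = t powr - (s + d)"
          using l t by (simp add: powr_mult mult.assoc[symmetric] flip: powr_add)
        moreover have "0 < t" "0 < c * t" using l t by auto
        ultimately show ?thesis
          by (simp only: divide_ennreal_powr mult.left_commute[of _ "h _"] powr_ge_zero flip: ennreal_mult)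
      qed
      also have "\<dots> \<le> ennreal (c powr (s + d)) * ?S"
      proof (intro mult_left_mono SUP_upper)
        have "c * t < c * \<rho>0" using True l by simp
        also note l(2)
        finally show "c * t \<in> {0<..<R}" using t l by auto
      qed auto
      finally show ?thesis using True by simp
    qed simp
  qed
  then have "epowr (SUP t\<in>{0<..<\<rho>}. (if t < \<rho>0 then h (c * t) else 0) / ennreal (t powr (s + d))) p
      \<le> epowr (ennreal (c powr (s + d)) * ?S) p"
    using p by (intro epowr_mono) auto
  also have "\<dots> = ennreal (c powr ((s + d) * p)) * epowr ?S p"
    using p by (simp add: epowr_mult epowr_ennreal powr_powr)
  finally show ?thesis using True by (simp add: scale_norm_def)
next
  case False
  define r where "r = enn2real q"
  have r: "1 \<le> r" using enn2real_ge_1[OF q False] by (simp add: r_def)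
  let ?w = "\<lambda>u. epowr (h u) r / ennreal (u powr (s * r + d * r)) / ennreal u * indicator {0<..<R} u"
  define J where "J = (\<integral>\<^sup>+u. ?w u \<partial>lebesgue)"
  let ?L = "\<integral>\<^sup>+t\<in>{0<..<\<rho>}. epowr (if t < \<rho>0 then h (c * t) else 0) r
     / ennreal (t powr (s * r + d * r)) / ennreal t \<partial>lebesgue"
  have "?L \<le> (\<integral>\<^sup>+t. ennreal (c powr (s * r + d * r) * c) * ?w (c * t) \<partial>lebesgue)"
  proof (intro nn_integral_mono)
    fix t
    show "epowr (if t < \<rho>0 then h (c * t) else 0) r / ennreal (t powr (s * r + d * r)) / ennreal t
        * indicator {0<..<\<rho>} t \<le> ennreal (c powr (s * r + d * r) * c) * ?w (c * t)"
    proof (cases "0 < t \<and> t < \<rho>0")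
      case True
      define H where "H = epowr (h (c * t)) r"
      have "c * t < c * \<rho>0" using True l by simp
      also note l(2)
      finally have i: "indicator {0<..<R} (c * t) = (1::ennreal)" using True l by auto
      have d1: "x / (ennreal a * ennreal b) * ennreal a = x / ennreal b" if "0 < a" "0 < b" for x and a b :: real
      proof -
        have "inverse (a * b) * a = inverse b" using that by simp
        moreover have "x * ennreal (inverse (a * b)) * ennreal a = x * ennreal (inverse (a * b) * a)"
          using that by (simp add: mult.assoc ennreal_mult del: inverse_mult_distrib)
        ultimately show ?thesis
          using that by (simp add: divide_ennreal_def inverse_ennreal del: inverse_mult_distrib flip: ennreal_mult)
      qed
      have "ennreal (c powr (s * r + d * r) * c) * (H / ennreal ((c * t) powr (s * r + d * r)) / ennreal (c * t))
         = H / ennreal ((c * t) powr (s * r + d * r)) * ennreal (c powr (s * r + d * r)) / ennreal (c * t) * ennreal c"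
        using l by (simp add: ennreal_mult ennreal_times_divide mult_ac)
      also have "\<dots> = H / ennreal (t powr (s * r + d * r)) / ennreal t"
        using l True by (simp add: d1 powr_mult ennreal_mult)
      finally show ?thesis unfolding i using True by (simp add: H_def indicator_def)
    qed (auto simp: indicator_def)
  qed
  also have "\<dots> = ennreal (c powr (s * r + d * r)) * (ennreal c * (\<integral>\<^sup>+t. ?w (c * t) \<partial>lebesgue))"
    using l unfolding nn_integral_completion
    by (subst nn_integral_cmult) (auto simp: ennreal_mult mult.assoc)
  also have "ennreal c * (\<integral>\<^sup>+t. ?w (c * t) \<partial>lebesgue) = J"
    using l nn_integral_real_affine[of ?w c 0] by (simp add: J_def nn_integral_completion)
  finally have "epowr ?L (p / r) \<le> epowr (ennreal (c powr (s * r + d * r)) * J) (p / r)"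
    using p r by (intro epowr_mono) auto
  also have "\<dots> = ennreal (c powr ((s + d) * p)) * epowr J (p / r)"
  proof -
    have "(s * r + d * r) * (p / r) = (s + d) * p" using r by (simp add: field_simps)
    then show ?thesis using p r by (subst epowr_mult) (auto simp: epowr_ennreal powr_powr)
  qed
  finally show ?thesis using False by (simp add: scale_norm_def r_def J_def)
qed

text \<open>A monotone h is at least h u on (u, 2u), a range of radii on which dt/t has mass at
  least 1/2 and the weight changes by a factor of at most 2^(s+d). So one value of h is controlled
  by the whole norm.\<close>

lemma scale_norm_ge_point:
  assumes p: "1 \<le> p" and q: "1 \<le> q" and s: "0 \<le> s" "0 \<le> d"
    and h: "\<And>t u. t \<le> u \<Longrightarrow> h t \<le> h u" and u: "0 < u" "2 * u \<le> R"
  shows "epowr (ennreal (u powr (- s - d)) * h u) p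
    \<le> ennreal (2 powr ((s + d + 1) * p)) * scale_norm s d R p q h"
proof (cases "q = \<infinity>")
  case True
  have "ennreal (u powr (- s - d)) * h u = h u / ennreal (u powr (s + d))"
    unfolding divide_ennreal_powr[OF u(1)] by (simp only: mult.commute minus_add_distrib diff_conv_add_uminus)
  also have "\<dots> \<le> (SUP t\<in>{0<..<R}. h t / ennreal (t powr (s + d)))"
    using u by (intro SUP_upper) auto
  finally have "epowr (ennreal (u powr (- s - d)) * h u) p
     \<le> epowr (SUP t\<in>{0<..<R}. h t / ennreal (t powr (s + d))) p"
    using p by (intro epowr_mono) auto
  also have "\<dots> \<le> ennreal (2 powr ((s + d + 1) * p)) * \<dots>"
  proof -
    have "1 \<le> (2::real) powr ((s + d + 1) * p)"
      using p s by (intro ge_one_powr_ge_zero) auto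
    then have "1 * x \<le> ennreal (2 powr ((s + d + 1) * p)) * x" for x
      by (intro mult_right_mono) (auto simp flip: ennreal_1 intro!: ennreal_leI)
    then show ?thesis by simp
  qed
  finally show ?thesis using True by (simp add: scale_norm_def)
next
  case False
  define r where "r = enn2real q"
  have r: "1 \<le> r" using enn2real_ge_1[OF q False] by (simp add: r_def)
  let ?a = "s * r + d * r"
  let ?w = "\<lambda>t. epowr (h t) r / ennreal (t powr ?a) / ennreal t * indicator {0<..<R} t"
  \<comment> \<open>A lower bound for the integrand on (u, 2u): h at the left end, both weights at
    the right end.\<close>
  let ?H = "epowr (h u) r / ennreal ((2 * u) powr ?a) / ennreal (2 * u)"
  have a0: "0 \<le> ?a" using s r by simp
  have "?H * ennreal u = (\<integral>\<^sup>+t. ?H * indicator {u<..<2 * u} t \<partial>lborel)"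
    using u by (subst nn_integral_cmult_indicator) auto
  also have "\<dots> \<le> (\<integral>\<^sup>+t. ?w t \<partial>lborel)"
  proof (intro nn_integral_mono)
    fix t
    have "?H \<le> epowr (h t) r / ennreal (t powr ?a) / ennreal t" if "u < t" "t < 2 * u"
    proof -
      have "0 < (2 * u) powr ?a" "0 < t powr ?a" "0 < 2 * u" "0 < t" using that u by auto
      then show ?thesis
        unfolding divide_ennreal_def using that u r a0
        by (simp only: inverse_ennreal)
          (intro mult_mono epowr_mono h ennreal_leI le_imp_inverse_le powr_mono2; auto)
    qed
    then show "?H * indicator {u<..<2 * u} t \<le> ?w t"
      using u by (auto simp: indicator_def)
  qed
  finally have le: "?H * ennreal u \<le> (\<integral>\<^sup>+t. ?w t \<partial>lebesgue)"
    by (simp add: nn_integral_completion)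
  have eq: "epowr (h u) r * ennreal (u powr - ?a) = ennreal (2 powr (?a + 1)) * (?H * ennreal u)"
  proof -
    have "?H * ennreal u = epowr (h u) r * ennreal (inverse ((2 * u) powr ?a) * inverse (2 * u) * u)"
    proof -
      have gen: "x * ennreal a * ennreal b * ennreal c = x * ennreal (a * b * c)"
        if "0 \<le> a" "0 \<le> b" "0 \<le> c" for x a b c
        using that by (simp add: ennreal_mult mult.assoc)
      have "0 < (2 * u) powr ?a" "0 < 2 * u" using u by auto
      then show ?thesis
        unfolding divide_ennreal_def using u by (simp only: inverse_ennreal) (rule gen; simp)
    qed
    moreover have "2 powr (b + 1) * (inverse ((2 * u) powr b) * inverse (2 * u) * u) = u powr - b" for b
      using u by (simp add: powr_mult powr_add powr_minus field_simps)
    ultimately show ?thesis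
      using u by (simp add: mult.left_commute[of "ennreal (2 powr _)"] flip: ennreal_mult)
  qed
  have "epowr (ennreal (u powr (- s - d)) * h u) p = epowr (epowr (h u) r * ennreal (u powr - ?a)) (p / r)"
  proof -
    have e: "(- s - d) * p = - ?a * (p / r)" using r by (simp add: field_simps)
    have "epowr (ennreal (u powr (- s - d)) * h u) p = ennreal (u powr ((- s - d) * p)) * epowr (h u) p"
      using p by (simp add: epowr_mult epowr_ennreal powr_powr)
    also have "\<dots> = epowr (epowr (h u) r * ennreal (u powr - ?a)) (p / r)"
      unfolding e using p r by (simp add: epowr_mult epowr_epowr epowr_ennreal powr_powr mult.commute)
    finally show ?thesis .
  qed
  also have "\<dots> \<le> epowr (ennreal (2 powr (?a + 1)) * (\<integral>\<^sup>+t. ?w t \<partial>lebesgue)) (p / r)"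
    unfolding eq using p r le by (intro epowr_mono mult_left_mono) auto
  also have "\<dots> = ennreal (2 powr ((?a + 1) * (p / r))) * epowr (\<integral>\<^sup>+t. ?w t \<partial>lebesgue) (p / r)"
    using p r by (simp add: epowr_mult epowr_ennreal powr_powr)
  also have "\<dots> \<le> ennreal (2 powr ((s + d + 1) * p)) * epowr (\<integral>\<^sup>+t. ?w t \<partial>lebesgue) (p / r)"
  proof (intro mult_right_mono ennreal_leI powr_mono)
    have "(?a + 1) * (p / r) = (s + d) * p + p / r" using r by (simp add: field_simps)
    also have "p / r \<le> p" using p r by (simp add: divide_le_eq mult_le_cancel_left1)
    finally show "(?a + 1) * (p / r) \<le> (s + d + 1) * p" by (simp add: algebra_simps)
  qed auto
  finally show ?thesis using False by (simp add: scale_norm_def r_def)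
qed

text \<open>The oscillation profile, up to a constant, of a function that is Lipschitz with constant
  1 / D below the scale D and varies by at most 1 beyond; t^d is the volume of the ball, and D^s
  normalises the inner norm.\<close>

abbreviation "scale_model s d D t \<equiv> t powr d * min (t / D) 1 * (D :: real) powr s"

text \<open>Divided by t^(s+d) the profile is (t/D)^(1-s) up to D and (D/t)^s beyond D. By scaling,
  the L^q(dt/t) norm over all radii does not depend on D; it is finite at 0 because s < 1 and at
  infinity because s > 0.\<close>

lemma scale_norm_model_le:
  assumes p: "1 \<le> p" and q: "1 \<le> q" and s: "0 < s" "s < 1"
  shows "\<exists>K::real. \<forall>D>0. scale_norm s d \<rho> p q (\<lambda>t. ennreal (scale_model s d D t)) \<le> ennreal K"
proof (cases "q = \<infinity>")
  case True
  have "scale_norm s d \<rho> p q (\<lambda>t. ennreal (scale_model s d D t)) \<le> ennreal 1" if D: "0 < D" for D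
  proof -
    have "(SUP t\<in>{0<..<\<rho>}. ennreal (scale_model s d D t) / ennreal (t powr (s + d))) \<le> 1"
    proof (intro SUP_least)
      fix t assume t: "t \<in> {0<..<\<rho>}"
      \<comment> \<open>For t \<le> D the power s < 1 increases the quotient; for t > D the power is
        at least 1.\<close>
      have "min (t / D) 1 \<le> (t / D) powr s"
      proof (cases "t \<le> D")
        case True
        then show ?thesis using t D s powr_mono'[of s 1 "t / D"] by simp
      next
        case False
        then show ?thesis using t D s by (simp add: ge_one_powr_ge_zero)
      qed
      then have "min (t / D) 1 * D powr s \<le> t powr s"
        using t D by (simp add: powr_divide pos_le_divide_eq)
      then have "t powr d * (min (t / D) 1 * D powr s) \<le> t powr d * t powr s"
        by (intro mult_left_mono) auto
      then have "scale_model s d D t \<le> t powr (s + d)"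
        by (simp add: powr_add mult_ac)
      then have "ennreal (scale_model s d D t) / ennreal (t powr (s + d))
          \<le> ennreal (t powr (s + d)) / ennreal (t powr (s + d))"
        by (intro divide_right_mono_ennreal ennreal_leI)
      also have "\<dots> = 1" using t by (intro ennreal_divide_self) auto
      finally show "ennreal (scale_model s d D t) / ennreal (t powr (s + d)) \<le> 1" .
    qed
    from epowr_mono[OF this, of p] show ?thesis
      using True p epowr_ennreal[of 1 p] by (simp add: scale_norm_def)
  qed
  then show ?thesis by blast
next
  case False
  define r where "r = enn2real q"
  have r: "1 \<le> r" using enn2real_ge_1[OF q False] by (simp add: r_def)
  \<comment> \<open>The integrals of v^((1-s)r - 1) over (0, 1) and of v^(-sr - 1) over (1,
    \<infinity>), with v = t / D.\<close>
  let ?K = "1 / (r - s * r) + 1 / (s * r)"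
  have sr: "0 < s * r" "0 < r - s * r" using r s by auto
  have "scale_norm s d \<rho> p q (\<lambda>t. ennreal (scale_model s d D t)) \<le> ennreal (?K powr (p / r))"
    if D: "0 < D" for D
  proof -
    let ?A = "\<lambda>t. ennreal (t powr (r - s * r - 1)) * indicator {0..D} t"
    let ?B = "\<lambda>t. ennreal (t powr (- (s * r) - 1)) * indicator {D..} t"
    have A: "(\<integral>\<^sup>+t. ?A t \<partial>lborel) = ennreal (D powr (r - s * r) / (r - s * r))"
      using has_integral_powr_from_0[of "r - s * r - 1" D] sr D s
      by (subst nn_integral_has_integral_lebesgue') auto
    have B: "(\<integral>\<^sup>+t. ?B t \<partial>lborel) = ennreal (D powr (- (s * r)) / (s * r))"
      using has_integral_powr_to_inf[of "- (s * r) - 1" D] sr D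
      by (subst nn_integral_has_integral_lebesgue') auto
    have "(\<integral>\<^sup>+t\<in>{0<..<\<rho>}. epowr (ennreal (scale_model s d D t)) r
        / ennreal (t powr (s * r + d * r)) / ennreal t \<partial>lebesgue)
      \<le> (\<integral>\<^sup>+t. ennreal (D powr (s * r - r)) * ?A t + ennreal (D powr (s * r)) * ?B t \<partial>lborel)"
      unfolding nn_integral_completion
    proof (intro nn_integral_mono)
      fix t
      show "epowr (ennreal (scale_model s d D t)) r
        / ennreal (t powr (s * r + d * r)) / ennreal t * indicator {0<..<\<rho>} t
        \<le> ennreal (D powr (s * r - r)) * ?A t + ennreal (D powr (s * r)) * ?B t"
      proof (cases "0 < t")
        case t: True
        have "epowr (ennreal (scale_model s d D t)) r
            = ennreal (t powr (d * r) * min (t / D) 1 powr r * D powr (s * r))"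
          using t D by (simp add: epowr_ennreal powr_mult powr_powr)
        also have "\<dots> / ennreal (t powr (s * r + d * r)) / ennreal t
            = ennreal (t powr (d * r) * min (t / D) 1 powr r * D powr (s * r) / t powr (s * r + d * r) / t)"
          using t D by (simp add: divide_ennreal)
        also have "t powr (d * r) * min (t / D) 1 powr r * D powr (s * r) / t powr (s * r + d * r) / t
            = D powr (s * r) * min (t / D) 1 powr r * t powr (- (s * r) - 1)"
          using t D by (simp add: powr_add powr_diff powr_minus field_simps)
        also have "\<dots> = (if t \<le> D then D powr (s * r - r) * t powr (r - s * r - 1)
            else D powr (s * r) * t powr (- (s * r) - 1))"
          using t D by (simp add: powr_divide powr_diff powr_add powr_minus field_simps)
        finally show ?thesis
          using t D by (auto simp: indicator_def ennreal_mult add_increasing2)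
      qed (simp add: indicator_def)
    qed
    also have "\<dots> = ennreal (D powr (s * r - r)) * ennreal (D powr (r - s * r) / (r - s * r))
        + ennreal (D powr (s * r)) * ennreal (D powr (- (s * r)) / (s * r))"
      by (subst nn_integral_add) (auto simp: nn_integral_cmult A B simp del: minus_mult_left)
    also have "\<dots> = ennreal ?K"
    proof -
      have "D powr (s * r - r) * (D powr (r - s * r) / (r - s * r)) = 1 / (r - s * r)"
        "D powr (s * r) * (D powr (- (s * r)) / (s * r)) = 1 / (s * r)"
        using D sr by (simp_all flip: powr_add)
      moreover have "ennreal a * ennreal b + ennreal c * ennreal e = ennreal (a * b + c * e)"
        if "0 \<le> a" "0 \<le> b" "0 \<le> c" "0 \<le> e" for a b c e
        using that by (simp add: ennreal_mult)
      moreover have "0 \<le> D powr (r - s * r) / (r - s * r)" "0 \<le> D powr (- (s * r)) / (s * r)"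
        using sr by (auto intro!: divide_nonneg_pos)
      ultimately show ?thesis by (metis powr_ge_zero)
    qed
    finally have "epowr (\<integral>\<^sup>+t\<in>{0<..<\<rho>}. epowr (ennreal (scale_model s d D t)) r
        / ennreal (t powr (s * r + d * r)) / ennreal t \<partial>lebesgue) (p / r) \<le> epowr (ennreal ?K) (p / r)"
      using p r by (intro epowr_mono) auto
    also have "\<dots> = ennreal (?K powr (p / r))"
      using sr by (intro epowr_ennreal add_nonneg_nonneg divide_nonneg_pos) auto
    finally show ?thesis using False by (simp add: scale_norm_def r_def)
  qed
  then show ?thesis by blast
qed

section \<open>Measurability of the oscillation and of the inner norm\<close>

lemma osc_mono:
  fixes U :: "(real^'d) set"
  shows "t \<le> u \<Longrightarrow> osc U f x t \<le> osc U f x u"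
  unfolding osc_def by (intro nn_integral_mono) (auto simp: indicator_def)

text \<open>With the moving ball written as the condition \<open>dist x y < t\<close> inside the
  integrand, this is measurability of a parameter integral. Joint measurability in x and t is what
  the further integral over t requires.\<close>

lemma osc_measurable_pair:
  fixes U :: "(real^'d) set" and f :: "real^'d \<Rightarrow> complex"
  assumes [measurable]: "f \<in> borel_measurable lebesgue" "U \<in> sets lebesgue"
  shows "(\<lambda>(x, t). osc U f x t) \<in> borel_measurable (lebesgue \<Otimes>\<^sub>M borel)"
proof -
  have [measurable]: "(\<lambda>x. x) \<in> lebesgue \<rightarrow>\<^sub>M (borel :: (real^'d) measure)"
    by (rule lebesgue_lborel_sets)
  have "(\<lambda>z. \<integral>\<^sup>+y. ennreal (norm (f (fst z) - f y)) * indicator U y * (if dist (fst z) y < snd z then 1 else 0) \<partial>lebesgue)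
      \<in> borel_measurable (lebesgue \<Otimes>\<^sub>M borel)"
  proof (rule lebesgue.borel_measurable_nn_integral)
    have [measurable]: "(\<lambda>w. fst (fst w)) \<in> (lebesgue \<Otimes>\<^sub>M borel) \<Otimes>\<^sub>M lebesgue \<rightarrow>\<^sub>M (borel :: (real^'d) measure)"
      "(\<lambda>w. snd w) \<in> (lebesgue \<Otimes>\<^sub>M borel) \<Otimes>\<^sub>M lebesgue \<rightarrow>\<^sub>M (borel :: (real^'d) measure)"
      if "True" for a :: "real^'d"
      by (auto intro: measurable_compose[OF _ lebesgue_lborel_sets])
    show "(\<lambda>(z, y). ennreal (norm (f (fst z) - f y)) * indicator U y * (if dist (fst z) y < snd z then 1 else 0))
      \<in> borel_measurable ((lebesgue \<Otimes>\<^sub>M (borel :: real measure)) \<Otimes>\<^sub>M lebesgue)"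
      unfolding split_beta by measurable
  qed
  moreover have "osc U f x t = (\<integral>\<^sup>+y. ennreal (norm (f x - f y)) * indicator U y * (if dist x y < t then 1 else 0) \<partial>lebesgue)" for x t
    unfolding osc_def by (intro nn_integral_cong) (auto simp: indicator_def)
  ultimately show ?thesis by (simp add: split_beta')
qed

lemma osc_measurable [measurable]:
  fixes U :: "(real^'d) set" and f :: "real^'d \<Rightarrow> complex"
  assumes "f \<in> borel_measurable lebesgue" "U \<in> sets lebesgue"
  shows "osc U f x \<in> borel_measurable borel"
  using measurable_compose[OF measurable_Pair1'[of x lebesgue borel] osc_measurable_pair[OF assms]]
  by simp

text \<open>Open balls are increasing unions of the smaller ones with radii in T, so monotone
  convergence applies. With rational radii for T this makes the supremum of the case q = \<infinity>
  countable.\<close>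

lemma osc_left_continuous:
  fixes U :: "(real^'d) set" and f :: "real^'d \<Rightarrow> complex"
  assumes [measurable]: "f \<in> borel_measurable lebesgue" "U \<in> sets lebesgue" and "0 < t"
    and T: "\<And>u. u < t \<Longrightarrow> 0 < u \<Longrightarrow> \<exists>v\<in>T. u < v \<and> v < t" and T0: "\<And>v. v \<in> T \<Longrightarrow> 0 < v"
  shows "osc U f x t \<le> (SUP v\<in>T \<inter> {..<t}. osc U f x v)"
proof -
  have "\<exists>v. v \<in> T \<and> t - t / (real n + 2) < v \<and> v < t" for n :: nat
  proof -
    have "t / (real n + 2) < t" using \<open>0 < t\<close> by (simp add: divide_less_eq)
    then show ?thesis using T[of "t - t / (real n + 2)"] \<open>0 < t\<close> by auto
  qed
  then obtain v where v: "\<And>n. v n \<in> T" "\<And>n. t - t / (real n + 2) < v n" "\<And>n. v n < t"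
    by metis
  have "\<exists>n. t - t / (real n + 2) > c" if "c < t" for c
  proof -
    obtain n where "t / (t - c) < real n" using reals_Archimedean2 by blast
    then have "t < real n * (t - c)" using that by (simp add: pos_divide_less_eq)
    also have "\<dots> \<le> (real n + 2) * (t - c)" using that by (intro mult_right_mono) auto
    finally have "c < t - t / (real n + 2)" by (simp add: field_simps)
    then show ?thesis by blast
  qed
  then have ex: "\<exists>n. c < v n" if "c < t" for c
    using v(2) that less_trans by blast
  \<comment> \<open>Running maxima turn the radii \<open>v n\<close> into an increasing sequence, as
    monotone convergence demands.\<close>
  define w where "w n = Max (v ` {..n})" for n
  have w_in: "w n \<in> v ` {..n}" for n unfolding w_def by (intro Max_in) auto
  have w: "w n \<in> T" "w n < t" for n using w_in[of n] v by auto
  have w_ge: "v n \<le> w n" for n unfolding w_def by (intro Max_ge) auto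
  have w_mono: "w m \<le> w n" if "m \<le> n" for m n
    unfolding w_def using that by (intro Max_mono) auto
  have "osc U f x t = (\<integral>\<^sup>+y. (SUP n. ennreal (norm (f x - f y)) * indicator (ball x (w n) \<inter> U) y) \<partial>lebesgue)"
    unfolding osc_def
  proof (intro nn_integral_cong)
    fix y
    show "ennreal (norm (f x - f y)) * indicator (ball x t \<inter> U) y
       = (SUP n. ennreal (norm (f x - f y)) * indicator (ball x (w n) \<inter> U) y)"
    proof (cases "y \<in> ball x t \<inter> U")
      case True
      then obtain n where "dist x y < v n" using ex by auto
      then have "y \<in> ball x (w n) \<inter> U" using True w_ge[of n] by auto
      then show ?thesis
        using True by (intro antisym SUP_upper2[of n] SUP_least) (auto simp: indicator_def)
    next
      case False
      then have "y \<notin> ball x (w n) \<inter> U" for n using w(2)[of n] by auto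
      then show ?thesis using False by simp
    qed
  qed
  also have "\<dots> = (SUP n. osc U f x (w n))"
    unfolding osc_def
    by (intro nn_integral_monotone_convergence_SUP)
      (auto simp: incseq_def le_fun_def indicator_def dest: w_mono)
  also have "\<dots> \<le> (SUP v\<in>T \<inter> {..<t}. osc U f x v)"
    using w by (intro SUP_least SUP_upper) auto
  finally show ?thesis .
qed

lemma scale_norm_osc_measurable:
  fixes U :: "(real^'d) set" and f :: "real^'d \<Rightarrow> complex"
  assumes [measurable]: "f \<in> borel_measurable lebesgue" "U \<in> sets lebesgue" and sd: "0 \<le> s" "0 \<le> d"
  shows "(\<lambda>x. scale_norm s d \<rho> p q (osc U f x)) \<in> borel_measurable lebesgue"
proof (cases "q = \<infinity>")
  case True
  let ?T = "\<rat> \<inter> {0<..<\<rho>} :: real set"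
  have "(SUP t\<in>{0<..<\<rho>}. osc U f x t / ennreal (t powr (s + d)))
      = (SUP t\<in>?T. osc U f x t / ennreal (t powr (s + d)))" for x
  proof (intro antisym SUP_least SUP_subset_mono)
    fix t assume t: "t \<in> {0<..<\<rho>}"
    have "osc U f x t \<le> (SUP v\<in>?T \<inter> {..<t}. osc U f x v)"
    proof (intro osc_left_continuous)
      fix u :: real assume "u < t" "0 < u"
      then show "\<exists>v\<in>?T. u < v \<and> v < t"
        using Rats_dense_in_real[of u t] t by force
    qed (use t in auto)
    then have "osc U f x t / ennreal (t powr (s + d))
        \<le> (SUP v\<in>?T \<inter> {..<t}. osc U f x v) / ennreal (t powr (s + d))"
      by (rule divide_right_mono_ennreal)
    also have "\<dots> = (SUP v\<in>?T \<inter> {..<t}. osc U f x v / ennreal (t powr (s + d)))"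
      by (simp add: divide_ennreal_def SUP_mult_right_ennreal)
    also have "\<dots> \<le> (SUP t\<in>?T. osc U f x t / ennreal (t powr (s + d)))"
    proof (intro SUP_least)
      fix v assume v: "v \<in> ?T \<inter> {..<t}"
      \<comment> \<open>Replacing t by a smaller rational v in the weight only enlarges the
        quotient, because the exponent s + d is nonnegative.\<close>
      have "osc U f x v / ennreal (t powr (s + d)) \<le> osc U f x v / ennreal (v powr (s + d))"
        using v t sd unfolding divide_ennreal_powr
        by (subst divide_ennreal_powr, simp)+ (intro mult_left_mono ennreal_leI powr_mono2', auto)
      also have "\<dots> \<le> (SUP t\<in>?T. osc U f x t / ennreal (t powr (s + d)))"
        using v by (intro SUP_upper) auto
      finally show "osc U f x v / ennreal (t powr (s + d)) \<le> (SUP t\<in>?T. osc U f x t / ennreal (t powr (s + d)))" .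
    qed
    finally show "osc U f x t / ennreal (t powr (s + d)) \<le> (SUP t\<in>?T. osc U f x t / ennreal (t powr (s + d)))" .
  qed (auto intro!: SUP_upper)
  moreover have "(\<lambda>x. osc U f x t) \<in> borel_measurable lebesgue" for t
    using measurable_compose[OF measurable_Pair2'[of t borel lebesgue] osc_measurable_pair[OF assms(1,2)]]
    by simp
  moreover have "countable ?T" by (intro countable_Int1 countable_rat)
  ultimately show ?thesis using True by (simp add: scale_norm_def)
next
  case False
  have [measurable]: "(\<lambda>w. osc U f (fst w) (snd w)) \<in> borel_measurable (lebesgue \<Otimes>\<^sub>M borel)"
    using osc_measurable_pair[OF assms(1,2)] by (simp add: split_beta')
  have "(\<lambda>x. \<integral>\<^sup>+t\<in>{0<..<\<rho>}. epowr (osc U f x t) (enn2real q)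
       / ennreal (t powr (s * enn2real q + d * enn2real q)) / ennreal t \<partial>lborel) \<in> borel_measurable lebesgue"
  proof (rule lborel.borel_measurable_nn_integral)
    have [measurable]: "(\<lambda>w. osc U f (fst w) (snd w)) \<in> borel_measurable (lebesgue \<Otimes>\<^sub>M lborel)"
      using \<open>(\<lambda>w. osc U f (fst w) (snd w)) \<in> borel_measurable (lebesgue \<Otimes>\<^sub>M borel)\<close>
      by (subst measurable_cong_sets[OF sets_pair_measure_cong[OF refl sets_lborel] refl])
    show "(\<lambda>(x, t). epowr (osc U f x t) (enn2real q) / ennreal (t powr (s * enn2real q + d * enn2real q))
       / ennreal t * indicator {0<..<\<rho>} t) \<in> borel_measurable (lebesgue \<Otimes>\<^sub>M lborel)"
      unfolding split_beta by measurable
  qed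
  then show ?thesis using False by (simp add: scale_norm_def nn_integral_completion)
qed

section \<open>Whitney coverings\<close>

lemma side_pos [simp]: "0 < side Q" "0 \<le> side Q" "side Q \<noteq> 0"
  by (simp_all add: side_def)

text \<open>Via the l^1 norm, a cube has diameter at most d times its side. This crude factor d,
  later \<open>rdim\<close>, is used in place of the square root of d throughout.\<close>

lemma norm_le_card_bound:
  fixes x :: "real^'d"
  assumes "\<And>i. \<bar>x $ i\<bar> \<le> c"
  shows "norm x \<le> real CARD('d) * c"
proof -
  have "norm x \<le> (\<Sum>i\<in>UNIV. \<bar>x $ i\<bar>)" by (rule norm_le_l1_cart)
  also have "\<dots> \<le> (\<Sum>i\<in>(UNIV::'d set). c)" by (intro sum_mono assms)
  finally show ?thesis by simp
qed

lemma dilate_eq_box: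
  "dilate r Q = box (\<chi> i. center Q $ i - r * side Q / 2) (\<chi> i. center Q $ i + r * side Q / 2)"
  by (simp only: set_eq_iff dilate_def mem_box_cart abs_diff_less_iff mem_Collect_eq vec_lambda_beta simp_thms)

lemma open_dilate [simp]: "open (dilate r Q)"
  and convex_dilate [simp]: "convex (dilate r Q)"
  and bounded_dilate [simp]: "bounded (dilate r Q)"
  by (auto simp: dilate_eq_box intro: open_box convex_box bounded_box)

lemma dilate_borel [measurable]: "dilate r Q \<in> sets borel"
  by (simp add: borel_open)

lemma emeasure_dilate:
  fixes Q :: "'d::finite dyadic"
  assumes "0 \<le> r"
  shows "emeasure lborel (dilate r Q) = ennreal ((r * side Q) ^ CARD('d))"
proof -
  let ?a = "(\<chi> i. center Q $ i - r * side Q / 2) :: real^'d"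
  let ?b = "(\<chi> i. center Q $ i + r * side Q / 2) :: real^'d"
  have rs: "0 \<le> r * side Q" using assms by simp
  have "?a \<bullet> i \<le> ?b \<bullet> i \<and> (?b - ?a) \<bullet> i = r * side Q" if i: "i \<in> Basis" for i
  proof -
    obtain k where "i = axis k 1" using i unfolding Basis_vec_def Basis_real_def by blast
    then show ?thesis using rs by (simp add: inner_axis)
  qed
  then have "emeasure lborel (box ?a ?b) = ennreal (\<Prod>i\<in>(Basis :: (real^'d) set). r * side Q)"
    by (subst emeasure_lborel_box) auto
  then show ?thesis by (simp add: dilate_eq_box)
qed

lemma dilate_mono: "r \<le> r' \<Longrightarrow> dilate r Q \<subseteq> dilate r' Q"
proof
  fix x assume r: "r \<le> r'" and x: "x \<in> dilate r Q"
  have "r * side Q \<le> r' * side Q" using r by (intro mult_right_mono) auto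
  then show "x \<in> dilate r' Q" using x unfolding dilate_def by (auto intro: less_le_trans)
qed

lemma dist_dilate_le:
  fixes Q :: "'d::finite dyadic"
  assumes "x \<in> dilate r Q" "y \<in> dilate r' Q"
  shows "dist x y \<le> real CARD('d) * ((r + r') * side Q / 2)"
  unfolding dist_norm
proof (intro norm_le_card_bound)
  fix i
  have "\<bar>x $ i - center Q $ i\<bar> < r * side Q / 2" "\<bar>y $ i - center Q $ i\<bar> < r' * side Q / 2"
    using assms by (auto simp: dilate_def)
  moreover have "(r + r') * side Q / 2 = r * side Q / 2 + r' * side Q / 2" by (simp add: field_simps)
  ultimately show "\<bar>(x - y) $ i\<bar> \<le> (r + r') * side Q / 2"
    unfolding vector_minus_component abs_less_iff abs_le_iff by linarith
qed

lemma dilate_ball: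
  assumes "x \<in> dilate r Q" "dist x y < (r' - r) * side Q / 2"
  shows "y \<in> dilate r' Q"
proof -
  have "\<bar>y $ i - center Q $ i\<bar> < r' * side Q / 2" for i
  proof -
    have "\<bar>y $ i - x $ i\<bar> \<le> dist x y"
      using component_le_norm_cart[of "y - x" i] by (simp add: dist_norm norm_minus_commute)
    moreover have "\<bar>x $ i - center Q $ i\<bar> < r * side Q / 2" using assms by (auto simp: dilate_def)
    moreover have "(r' - r) * side Q / 2 = r' * side Q / 2 - r * side Q / 2" by (simp add: field_simps)
    ultimately show ?thesis using assms(2) by linarith
  qed
  then show ?thesis by (simp add: dilate_def)
qed

lemma center_in_dilate: "0 < r \<Longrightarrow> center Q \<in> dilate r Q"
  by (simp add: dilate_def)

lemma closure_cube_subset: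
  assumes "1 < r"
  shows "closure (cube Q) \<subseteq> dilate r Q"
proof
  fix x assume "x \<in> closure (cube Q)"
  moreover have "0 < (r - 1) * side Q / 2" using assms by simp
  ultimately obtain y where y: "y \<in> cube Q" "dist y x < (r - 1) * side Q / 2"
    unfolding closure_approachable by blast
  then show "x \<in> dilate r Q"
    using dilate_ball[of y 1 Q x r] by (simp add: dilate_1)
qed

lemma cube_subset_dilate: "1 \<le> r \<Longrightarrow> cube Q \<subseteq> dilate r Q"
  using dilate_mono[of 1 r Q] by (simp add: dilate_1)

lemma open_cube [simp]: "open (cube Q)" and convex_cube [simp]: "convex (cube Q)"
  and bounded_cube [simp]: "bounded (cube Q)"
  and cube_borel [measurable]: "cube Q \<in> sets borel"
  unfolding dilate_1[symmetric] by simp_all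

lemma emeasure_cube:
  fixes Q :: "'d::finite dyadic"
  shows "emeasure lborel (cube Q) = ennreal (side Q ^ CARD('d))"
  using emeasure_dilate[of 1 Q] by (simp add: dilate_1)

lemma measure_cube:
  fixes Q :: "'d::finite dyadic"
  shows "measure lebesgue (cube Q) = side Q ^ CARD('d)"
  by (simp add: measure_def emeasure_cube)

lemma cube_nonempty [simp]: "cube Q \<noteq> {}"
  using center_in_dilate[of 1 Q] by (auto simp: dilate_1)

lemma dist_cube_le:
  fixes Q :: "'d::finite dyadic"
  assumes "x \<in> cube Q" "y \<in> cube Q"
  shows "dist x y \<le> real CARD('d) * side Q"
  using dist_dilate_le[of x 1 Q y 1] assms by (simp add: dilate_1)

lemma dist_le_long_dist:
  assumes "bounded A" "bounded B" "x \<in> A" "y \<in> B"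
  shows "dist x y \<le> long_dist A B"
proof -
  have "dist x y - (diameter A + diameter B) \<le> setdist A B"
  proof (rule le_setdistI)
    fix a b assume ab: "a \<in> A" "b \<in> B"
    have "dist x y \<le> dist x a + dist a b + dist b y"
      using dist_triangle[of x y a] dist_triangle[of a y b] by linarith
    moreover have "dist x a \<le> diameter A" "dist b y \<le> diameter B"
      using ab assms diameter_bounded_bound by blast+
    ultimately show "dist x y - (diameter A + diameter B) \<le> dist a b" by linarith
  qed (use assms in auto)
  then show ?thesis by (simp add: long_dist_def)
qed

lemma long_dist_cube_le:
  fixes Q S :: "'d::finite dyadic"
  assumes "x \<in> cube Q" "y \<in> cube S"
  shows "long_dist (cube Q) (cube S) \<le> real CARD('d) * side Q + real CARD('d) * side S + dist x y"
proof -
  have "diameter (cube Q) \<le> real CARD('d) * side Q" for Q :: "'d dyadic"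
    by (intro diameter_le) (auto simp: dist_cube_le[unfolded dist_norm] dist_norm)
  then show ?thesis
    unfolding long_dist_def using setdist_le_dist[OF assms] by (intro add_mono) auto
qed

lemma whitney_const_D:
  assumes "whitney_covering_const C \<Omega> W"
  shows "0 < C" "disjoint_family_on cube W" "(\<Union>Q\<in>W. closure (cube Q)) = \<Omega>"
    "\<And>Q. Q \<in> W \<Longrightarrow> C * side Q \<le> setdist (cube Q) (frontier \<Omega>)"
    "\<And>Q. Q \<in> W \<Longrightarrow> setdist (cube Q) (frontier \<Omega>) \<le> 4 * C * side Q"
    "\<exists>N. \<forall>x. finite {Q \<in> W. x \<in> dilate 50 Q} \<and> card {Q \<in> W. x \<in> dilate 50 Q} \<le> N"
    "\<And>S Q. S \<in> W \<Longrightarrow> Q \<in> W \<Longrightarrow> cube S \<subseteq> dilate 5 Q \<Longrightarrow> side S \<ge> side Q / 2"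
proof -
  note W = assms[unfolded whitney_covering_const_def]
  show "0 < C" using W by (elim conjE)
  show "disjoint_family_on cube W" using W by (elim conjE)
  show "(\<Union>Q\<in>W. closure (cube Q)) = \<Omega>" using W by (elim conjE)
  show "C * side Q \<le> setdist (cube Q) (frontier \<Omega>)" if "Q \<in> W" for Q
    using W that by (elim conjE) simp
  show "setdist (cube Q) (frontier \<Omega>) \<le> 4 * C * side Q" if "Q \<in> W" for Q
    using W that by (elim conjE) simp
  show "\<exists>N. \<forall>x. finite {Q \<in> W. x \<in> dilate 50 Q} \<and> card {Q \<in> W. x \<in> dilate 50 Q} \<le> N"
    using W by (elim conjE)
  show "side S \<ge> side Q / 2" if "S \<in> W" "Q \<in> W" "cube S \<subseteq> dilate 5 Q" for S Q
    using W that by (elim conjE) simp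
qed

text \<open>The convention \<open>setdist A {} = 0\<close> would contradict the positive lower bound
  on the distance.\<close>

lemma whitney_frontier_nonempty:
  assumes "whitney_covering_const C \<Omega> W" "Q \<in> W"
  shows "frontier \<Omega> \<noteq> {}"
proof
  assume "frontier \<Omega> = {}"
  moreover have "0 < C * side Q" using whitney_const_D(1)[OF assms(1)] by simp
  ultimately show False using whitney_const_D(4)[OF assms] by simp
qed

lemma setdist_le_infdist_cube:
  assumes "x \<in> closure (cube Q)" "F \<noteq> {}"
  shows "setdist (cube Q) F \<le> infdist x F"
proof -
  have "setdist (cube Q) F = setdist (closure (cube Q)) F" by simp
  also have "\<dots> \<le> setdist {x} F" using assms by (intro setdist_subset_left) auto
  finally show ?thesis using assms by (simp add: infdist_eq_setdist)
qed

text \<open>Near a point of the frontier inside \<open>dilate 5 Q\<close> there would be arbitrarily small cubes,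
  against the last clause of the definition of a Whitney covering. This makes the constant
  of the covering harmless when it is small.\<close>

lemma whitney_dilate_5_disjoint:
  fixes \<Omega> :: "(real^'d) set"
  assumes W: "whitney_covering_const C \<Omega> W" and Q: "Q \<in> W"
  shows "dilate 5 Q \<inter> frontier \<Omega> = {}"
proof (rule ccontr)
  assume "dilate 5 Q \<inter> frontier \<Omega> \<noteq> {}"
  then obtain z where z: "z \<in> dilate 5 Q" "z \<in> frontier \<Omega>" by blast
  obtain e where e: "0 < e" "ball z e \<subseteq> dilate 5 Q"
    using z(1) open_contains_ball_eq[of "dilate 5 Q"] by auto
  have C: "0 < C" using whitney_const_D(1)[OF W] .
  \<comment> \<open>A point of \<Omega> within b of z lies in the closure of a cube S of side below
    b / C, and all points of S are within b * k of z. The first term of b then places S in the ball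
    of radius e, the second makes its side less than a quarter of that of Q.\<close>
  define k where "k = 1 + real CARD('d) * 2 / C"
  have k: "0 < k" unfolding k_def using C by (intro add_pos_nonneg) auto
  define b where "b = min (e / (2 * k)) (C * side Q / 4)"
  have b: "0 < b" using e C k by (auto simp: b_def)
  have "z \<in> closure \<Omega>" using z(2) by (simp add: frontier_def)
  then obtain y where y: "y \<in> \<Omega>" "dist y z < b" using b unfolding closure_approachable by blast
  then obtain S where S: "S \<in> W" "y \<in> closure (cube S)" using whitney_const_D(3)[OF W] by blast
  have "C * side S \<le> infdist y (frontier \<Omega>)"
    using whitney_const_D(4)[OF W S(1)] setdist_le_infdist_cube[OF S(2), of "frontier \<Omega>"] z(2) by force
  also have "\<dots> \<le> dist y z" using z(2) by (rule infdist_le)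
  finally have small: "C * side S < b" using y by simp
  have "cube S \<subseteq> ball z e"
  proof
    fix v assume v: "v \<in> cube S"
    have "dist v y \<le> real CARD('d) * ((1 + 2) * side S / 2)"
      using v S(2) closure_cube_subset[of 2 S] by (intro dist_dilate_le) (auto simp: dilate_1)
    also have "\<dots> \<le> real CARD('d) * 2 * side S" by (simp add: mult_left_mono)
    also have "\<dots> \<le> real CARD('d) * 2 * (b / C)"
      using small C by (intro mult_left_mono) (auto simp: field_simps)
    finally have "dist v z < real CARD('d) * 2 * (b / C) + b"
      using y(2) dist_triangle[of v z y] by linarith
    also have "\<dots> = b * k" by (simp add: k_def algebra_simps)
    also have "\<dots> \<le> e / (2 * k) * k"
      using k by (intro mult_right_mono) (auto simp: b_def)
    also have "\<dots> = e / 2" using k by simp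
    also have "\<dots> \<le> e" using e by simp
    finally show "v \<in> ball z e" by (simp add: dist_commute)
  qed
  then have "side Q / 2 \<le> side S" using e whitney_const_D(7)[OF W S(1) Q] by blast
  then have "C * (side Q / 2) \<le> C * side S" using C by simp
  moreover have "C * side S < C * side Q / 4" using small by (simp add: b_def)
  moreover have "0 < C * side Q" using C by simp
  ultimately show False by linarith
qed

text \<open>The dilated cube is connected and contains Q, so it could leave \<Omega> only by
  crossing the frontier.\<close>

lemma whitney_dilate_5_subset:
  fixes \<Omega> :: "(real^'d) set"
  assumes W: "whitney_covering_const C \<Omega> W" and Q: "Q \<in> W"
  shows "dilate 5 Q \<subseteq> \<Omega>"
proof (rule ccontr)
  assume "\<not> dilate 5 Q \<subseteq> \<Omega>"
  moreover have "cube Q \<subseteq> \<Omega>" using whitney_const_D(3)[OF W] Q closure_subset by blast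
  then have "dilate 5 Q \<inter> \<Omega> \<noteq> {}"
    using cube_subset_dilate[of 5 Q] cube_nonempty[of Q] by fastforce
  ultimately have "dilate 5 Q \<inter> frontier \<Omega> \<noteq> {}"
    by (intro connected_Int_frontier convex_connected) auto
  then show False using whitney_dilate_5_disjoint[OF assms] by simp
qed

text \<open>A frontier point closer than 3/2 = (5 - 2) / 2 sides to a point of 2Q would lie in 5Q.
  The bound is free of the covering constant.\<close>

lemma whitney_infdist_ge:
  fixes \<Omega> :: "(real^'d) set"
  assumes W: "whitney_covering_const C \<Omega> W" and Q: "Q \<in> W" and x: "x \<in> dilate 2 Q"
  shows "3/2 * side Q \<le> infdist x (frontier \<Omega>)"
proof -
  have "3/2 * side Q \<le> dist x z" if z: "z \<in> frontier \<Omega>" for z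
  proof (rule ccontr)
    assume "\<not> 3/2 * side Q \<le> dist x z"
    then have "z \<in> dilate 5 Q" by (intro dilate_ball[OF x]) simp
    then show False using whitney_dilate_5_disjoint[OF W Q] z by (simp add: disjoint_iff)
  qed
  then show ?thesis
    unfolding infdist_notempty[OF whitney_frontier_nonempty[OF W Q]]
    by (intro cINF_greatest whitney_frontier_nonempty[OF W Q])
qed

lemma whitney_infdist_le:
  fixes \<Omega> :: "(real^'d) set"
  assumes W: "whitney_covering_const C \<Omega> W" and Q: "Q \<in> W" and x: "x \<in> dilate 2 Q"
  shows "infdist x (frontier \<Omega>) \<le> (4 * C + 2 * real CARD('d)) * side Q"
proof -
  have ne: "frontier \<Omega> \<noteq> {}" using whitney_frontier_nonempty[OF W Q] .
  have "infdist x (frontier \<Omega>) - 2 * real CARD('d) * side Q \<le> setdist (cube Q) (frontier \<Omega>)"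
  proof (rule le_setdistI)
    fix a b assume ab: "a \<in> cube Q" "b \<in> frontier \<Omega>"
    have "dist x a \<le> real CARD('d) * ((2 + 1) * side Q / 2)"
      using ab x by (intro dist_dilate_le) (auto simp: dilate_1)
    also have "\<dots> \<le> real CARD('d) * (2 * side Q)" by (intro mult_left_mono) auto
    finally have "dist x a \<le> 2 * real CARD('d) * side Q" by simp
    moreover have "infdist x (frontier \<Omega>) \<le> dist x a + dist a b"
      using infdist_le[OF ab(2), of x] dist_triangle[of x b a] by linarith
    ultimately show "infdist x (frontier \<Omega>) - 2 * real CARD('d) * side Q \<le> dist a b" by linarith
  qed (use ne in auto)
  then show ?thesis using whitney_const_D(5)[OF W Q] by (simp add: algebra_simps)
qed

text \<open>The segment from y to b leaves \<Omega>, hence meets the frontier.\<close>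

lemma infdist_frontier_le_dist:
  fixes \<Omega> :: "'a::euclidean_space set"
  assumes "y \<in> \<Omega>" "b \<notin> \<Omega>"
  shows "infdist y (frontier \<Omega>) \<le> dist y b"
proof -
  have "closed_segment y b \<inter> frontier \<Omega> \<noteq> {}"
    using assms by (intro connected_Int_frontier) auto
  then obtain z where z: "z \<in> closed_segment y b" "z \<in> frontier \<Omega>" by blast
  have "infdist y (frontier \<Omega>) \<le> dist y z" using z(2) by (rule infdist_le)
  also have "\<dots> \<le> dist y b" using dist_in_closed_segment[OF z(1)] by (simp add: dist_commute)
  finally show ?thesis .
qed

lemma ball_infdist_frontier_subset:
  fixes \<Omega> :: "'a::euclidean_space set"
  assumes "x \<in> \<Omega>" "dist x y < infdist x (frontier \<Omega>)"
  shows "y \<in> \<Omega>"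
  using infdist_frontier_le_dist[OF assms(1), of y] assms(2) by (meson not_le)

section \<open>Local finiteness, and cubes of every intermediate size\<close>

text \<open>A cube touching a small ball about x has side at least a fixed multiple of the distance
  from x to the frontier, so its dilate by 50 contains x; finite superposition bounds the number of
  such cubes.\<close>

lemma whitney_locally_finite:
  fixes \<Omega> :: "(real^'d) set"
  assumes W: "whitney_covering_const C \<Omega> W" and x: "x \<in> \<Omega>"
  shows "\<exists>e>0. finite {Q \<in> W. closure (cube Q) \<inter> ball x e \<noteq> {}}"
proof -
  let ?D = "\<lambda>x. infdist x (frontier \<Omega>)"
  let ?k = "4 * C + 2 * real CARD('d)"
  have C: "0 < C" using whitney_const_D(1)[OF W] .
  have "1 \<le> real CARD('d)" by simp
  then have k: "2 \<le> ?k" using C by linarith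
  obtain Q where Q: "Q \<in> W" "x \<in> closure (cube Q)" using x whitney_const_D(3)[OF W] by blast
  have "0 < 3/2 * side Q" by simp
  also have "\<dots> \<le> ?D x" using Q(2) closure_cube_subset[of 2 Q] by (intro whitney_infdist_ge[OF W Q(1)]) auto
  finally have D: "0 < ?D x" .
  \<comment> \<open>Within e of x the distance to the frontier is at least half that of x, so every
    cube met there has side at least e.\<close>
  define e where "e = ?D x / (2 * ?k)"
  have e: "0 < e" using D k unfolding e_def by simp
  have e2: "e \<le> ?D x / 2" unfolding e_def using D k by (intro divide_left_mono) auto
  have "{Q \<in> W. closure (cube Q) \<inter> ball x e \<noteq> {}} \<subseteq> {Q \<in> W. x \<in> dilate 50 Q}"
  proof
    fix S assume "S \<in> {Q \<in> W. closure (cube Q) \<inter> ball x e \<noteq> {}}"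
    then obtain y where S: "S \<in> W" and y: "y \<in> closure (cube S)" "y \<in> ball x e" by blast
    have y2: "y \<in> dilate 2 S" using closure_cube_subset[of 2 S] y by auto
    have "?D x \<le> ?D y + dist x y" by (rule infdist_triangle)
    then have "?D x / 2 \<le> ?D y" using y(2) e2 by auto
    also have "\<dots> \<le> ?k * side S" by (rule whitney_infdist_le[OF W S y2])
    finally have "e \<le> side S" unfolding e_def using k by (simp add: field_simps)
    also have "\<dots> \<le> (50 - 2) * side S / 2" by simp
    finally have "x \<in> dilate 50 S" using y(2) by (intro dilate_ball[OF y2]) (auto simp: dist_commute)
    then show "S \<in> {Q \<in> W. x \<in> dilate 50 Q}" using S by simp
  qed
  moreover have "finite {Q \<in> W. x \<in> dilate 50 Q}" using whitney_const_D(6)[OF W] by blast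
  ultimately show ?thesis using e finite_subset by blast
qed

text \<open>By local finiteness the closed cubes of any subfamily have a relatively closed union.
  This supplies the two open sets of the connectedness argument along a segment.\<close>

lemma whitney_open_diff_Union:
  fixes \<Omega> :: "(real^'d) set"
  assumes W: "whitney_covering_const C \<Omega> W" and \<Omega>: "open \<Omega>" and V: "V \<subseteq> W"
  shows "open (\<Omega> - (\<Union>Q\<in>V. closure (cube Q)))"
proof (subst open_contains_ball, intro ballI)
  fix x assume x: "x \<in> \<Omega> - (\<Union>Q\<in>V. closure (cube Q))"
  obtain e where e: "0 < e" "finite {Q \<in> W. closure (cube Q) \<inter> ball x e \<noteq> {}}"
    using whitney_locally_finite[OF W, of x] x by blast
  let ?F = "{Q \<in> V. closure (cube Q) \<inter> ball x e \<noteq> {}}"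
  have "finite ?F" using e(2) V by (elim finite_subset[rotated]) auto
  then have "open (\<Omega> \<inter> ball x e - (\<Union>Q\<in>?F. closure (cube Q)))"
    using \<Omega> by (intro open_Diff closed_UN open_Int) auto
  moreover have "x \<in> \<Omega> \<inter> ball x e - (\<Union>Q\<in>?F. closure (cube Q))" using x e by auto
  ultimately obtain r where "0 < r" "ball x r \<subseteq> \<Omega> \<inter> ball x e - (\<Union>Q\<in>?F. closure (cube Q))"
    by (meson open_contains_ball)
  then show "\<exists>e>0. ball x e \<subseteq> \<Omega> - (\<Union>Q\<in>V. closure (cube Q))"
    by (intro exI[of _ r]) blast
qed

text \<open>Coordinatewise the centre of Q is reached through z at a cost below side S / 2 + side S
  + side Q, at most 5/2 side Q. It makes the last clause in the definition of a Whitney covering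
  available for touching cubes.\<close>

lemma cube_subset_dilate_5_touching:
  fixes Q S :: "'d::finite dyadic"
  assumes z: "z \<in> closure (cube Q)" "z \<in> closure (cube S)" and le: "side S \<le> side Q"
  shows "cube S \<subseteq> dilate 5 Q"
proof
  fix v assume "v \<in> cube S"
  then have v: "v \<in> dilate 1 S" by (simp add: dilate_1)
  have zz: "z \<in> dilate 2 S" "z \<in> dilate 2 Q"
    using z closure_cube_subset[of 2 S] closure_cube_subset[of 2 Q] by auto
  have "\<bar>v $ i - center Q $ i\<bar> < 5 * side Q / 2" for i
  proof -
    have "\<bar>v $ i - center S $ i\<bar> < 1 * side S / 2" "\<bar>z $ i - center S $ i\<bar> < 2 * side S / 2"
      "\<bar>z $ i - center Q $ i\<bar> < 2 * side Q / 2"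
      using v zz by (auto simp: dilate_def)
    then show ?thesis using le unfolding abs_less_iff by linarith
  qed
  then show "v \<in> dilate 5 Q" by (simp add: dilate_def)
qed

text \<open>Sides are integer powers of two.\<close>

lemma side_less_imp_half:
  assumes "side S < side Q"
  shows "side S \<le> side Q / 2"
proof -
  have "- fst S < - fst Q"
  proof (rule ccontr)
    assume "\<not> - fst S < - fst Q"
    then have "side Q \<le> side S" unfolding side_def by (intro power_int_increasing) auto
    then show False using assms by simp
  qed
  then have "- fst S \<le> - fst Q - 1" by simp
  then have "side S \<le> 2 powi (- fst Q - 1)"
    unfolding side_def by (intro power_int_increasing) auto
  also have "\<dots> = side Q / 2" by (simp add: side_def power_int_diff)
  finally show ?thesis .
qed

text \<open>Touching Whitney cubes differ in size by a factor at most two, so the sizes met on the way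
  from a cube to the frontier leave out no power of two.\<close>

lemma whitney_intermediate_cube:
  fixes \<Omega> :: "(real^'d) set" and P :: "'d dyadic"
  assumes W: "whitney_covering_const C \<Omega> W" and \<Omega>: "open \<Omega>" and Q: "Q \<in> W"
    and le: "side P \<le> side Q" and a: "a \<in> cube Q" and x: "x \<notin> \<Omega>"
  shows "\<exists>S\<in>W. side S = side P \<and> (\<exists>z\<in>closed_segment a x. z \<in> closure (cube S))"
proof -
  let ?D = "\<lambda>x. infdist x (frontier \<Omega>)"
  \<comment> \<open>The point b is the first one outside \<Omega> on the way from a to x, so the
    half-open piece T from a to b stays in \<Omega>.\<close>
  have "compact (closed_segment a x - \<Omega>)" using \<Omega> by (intro compact_diff) auto
  moreover have "closed_segment a x - \<Omega> \<noteq> {}" using x by auto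
  ultimately obtain b where b: "b \<in> closed_segment a x - \<Omega>"
    and bmin: "\<And>y. y \<in> closed_segment a x - \<Omega> \<Longrightarrow> dist a b \<le> dist a y"
    using distance_attains_inf[of "closed_segment a x - \<Omega>" a] compact_imp_closed by metis
  have a\<Omega>: "a \<in> \<Omega>" using a Q whitney_const_D(3)[OF W] closure_subset by blast
  then have ab: "0 < dist a b" using b by auto
  define \<gamma> where "\<gamma> t = a + t *\<^sub>R (b - a)" for t :: real
  define T where "T = \<gamma> ` {0..<1}"
  have seg: "\<gamma> t \<in> closed_segment a x" if "t \<in> {0..<1}" for t
  proof -
    have "\<gamma> t \<in> closed_segment a b"
      using that by (auto simp: in_segment \<gamma>_def algebra_simps intro!: exI[of _ t])
    moreover have "closed_segment a b \<subseteq> closed_segment a x"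
      using b by (subst subset_closed_segment) auto
    ultimately show ?thesis by auto
  qed
  have T\<Omega>: "T \<subseteq> \<Omega>"
  proof
    fix y assume "y \<in> T"
    then obtain t where t: "t \<in> {0..<1}" "y = \<gamma> t" by (auto simp: T_def)
    have "dist a y = t * dist a b"
      using t by (simp add: \<gamma>_def dist_norm norm_minus_commute)
    also have "\<dots> < 1 * dist a b" using t ab by (intro mult_strict_right_mono) auto
    finally show "y \<in> \<Omega>" using bmin[of y] seg[OF t(1)] t by force
  qed
  have "connected T"
    unfolding T_def \<gamma>_def by (intro connected_continuous_image continuous_intros) auto
  \<comment> \<open>No dyadic side lies strictly between side P / 2 and side P, so A and B exhaust
    W. The aim is a point of T in closed cubes of both kinds.\<close>
  define A where "A = {S \<in> W. side P \<le> side S}"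
  define B where "B = {S \<in> W. side S \<le> side P / 2}"
  have AB: "W \<subseteq> A \<union> B"
    using side_less_imp_half[of _ P] unfolding A_def B_def by (metis (mono_tags, lifting) Un_iff mem_Collect_eq not_le subsetI)
  let ?A = "\<Union>S\<in>A. closure (cube S)" and ?B = "\<Union>S\<in>B. closure (cube S)"
  have "?A \<inter> ?B \<inter> T \<noteq> {}"
  proof
    assume empty: "?A \<inter> ?B \<inter> T = {}"
    have "(\<Omega> - ?A) \<inter> T = {} \<or> (\<Omega> - ?B) \<inter> T = {}"
    proof (rule connectedD[OF \<open>connected T\<close>])
      show "open (\<Omega> - ?A)" "open (\<Omega> - ?B)"
        by (auto simp: A_def B_def intro!: whitney_open_diff_Union[OF W \<Omega>])
      show "(\<Omega> - ?A) \<inter> (\<Omega> - ?B) \<inter> T = {}"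
        using whitney_const_D(3)[OF W] AB by blast
      show "T \<subseteq> (\<Omega> - ?A) \<union> (\<Omega> - ?B)"
        using T\<Omega> empty by blast
    qed
    moreover have "a \<in> T" by (auto simp: T_def \<gamma>_def image_iff intro!: bexI[of _ 0])
    moreover have "a \<in> ?A" using a Q le closure_subset unfolding A_def by blast
    ultimately have TA: "T \<subseteq> ?A" using T\<Omega> a\<Omega> empty by blast
    \<comment> \<open>At this parameter the path is within side P of b. No cube of A reaches there,
      since 3/2 of its side is at most the distance to the frontier.\<close>
    define t where "t = max 0 (1 - side P / dist a b)"
    have t: "t \<in> {0..<1}" using ab by (auto simp: t_def)
    have "dist (\<gamma> t) b = (1 - t) * dist a b"
    proof -
      have "\<gamma> t - b = (1 - t) *\<^sub>R (a - b)" by (simp add: \<gamma>_def algebra_simps)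
      then show ?thesis using t by (simp add: dist_norm)
    qed
    also have "\<dots> \<le> side P / dist a b * dist a b" using ab by (intro mult_right_mono) (auto simp: t_def)
    finally have "dist (\<gamma> t) b \<le> side P" using ab by simp
    moreover have "\<gamma> t \<in> T" using t by (auto simp: T_def)
    moreover obtain S where S: "S \<in> W" "side P \<le> side S" "\<gamma> t \<in> closure (cube S)"
      using TA \<open>\<gamma> t \<in> T\<close> by (auto simp: A_def)
    moreover have "3/2 * side S \<le> ?D (\<gamma> t)"
      using S closure_cube_subset[of 2 S] by (intro whitney_infdist_ge[OF W S(1)]) auto
    moreover have "?D (\<gamma> t) \<le> dist (\<gamma> t) b"
      using T\<Omega> \<open>\<gamma> t \<in> T\<close> b by (intro infdist_frontier_le_dist) auto
    moreover have "0 < side S" by simp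
    ultimately show False by linarith
  qed
  then obtain z S1 S2 where z: "z \<in> T" "S1 \<in> W" "side P \<le> side S1" "z \<in> closure (cube S1)"
      "S2 \<in> W" "side S2 \<le> side P / 2" "z \<in> closure (cube S2)"
    by (auto simp: A_def B_def)
  have pos: "0 < side P" by simp
  then have le2: "side S2 \<le> side S1" using z by linarith
  \<comment> \<open>Together with side S2 \<le> side P / 2 this gives side S1 \<le> side P, so S1
    has exactly the required side.\<close>
  have "side S1 / 2 \<le> side S2"
    using whitney_const_D(7)[OF W z(5,2)] cube_subset_dilate_5_touching[OF z(4,7) le2] by blast
  then have "side S1 = side P" using z by linarith
  moreover have "z \<in> closed_segment a x" using z(1) seg by (auto simp: T_def)
  ultimately show ?thesis using z by blast
qed

section \<open>Existence of symmetrized cubes\<close>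

text \<open>The corkscrew ball around a frontier point b close to Q holds a cube P at least as large
  as Q; since b lies outside \<Omega>, the segment from P to b meets a cube of exactly the side of
  Q. In the bound for C, 4 \<open>C2\<close> + 1 is the way from Q to b, 1 / \<epsilon> the
  corkscrew ball, another 1 the step from a closed cube into the open one, and 2 d the two
  diameters.\<close>

lemma exists_symmetrized_cube:
  fixes \<Omega> :: "(real^'d) set"
  assumes \<epsilon>: "0 < \<epsilon>" and \<Omega>: "open \<Omega>" and cork: "corkscrew_covering \<epsilon> \<delta> \<Omega> W0"
    and W2: "whitney_covering_const C2 (- closure \<Omega>) W2" and Q: "Q \<in> W2"
    and \<delta>: "ereal (side Q / \<epsilon>) \<le> \<delta>"
    and C: "2 * real CARD('d) + 4 * C2 + 2 + 1 / \<epsilon> \<le> C"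
  shows "\<exists>S\<in>W0. symmetrized C Q S"
proof -
  obtain C0 where W0: "whitney_covering_const C0 \<Omega> W0"
    using cork by (auto simp: corkscrew_covering_def whitney_covering_def)
  let ?F = "frontier (- closure \<Omega>)"
  have "setdist (cube Q) ?F < 4 * C2 * side Q + side Q"
    using whitney_const_D(5)[OF W2 Q] side_pos(1)[of Q] by linarith
  then obtain a b where ab: "a \<in> cube Q" "b \<in> ?F" "dist a b < 4 * C2 * side Q + side Q"
    using setdist_ltE[of "cube Q" ?F] whitney_frontier_nonempty[OF W2 Q] cube_nonempty by metis
  \<comment> \<open>The exterior has the frontier of the closure of \<Omega>, which may be smaller
    than the frontier of \<Omega> but is contained in it.\<close>
  have b: "b \<in> frontier \<Omega>" using ab(2) interior_mono[OF closure_subset, of \<Omega>]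
    unfolding frontier_complement by (auto simp: frontier_def)
  let ?r = "side Q / \<epsilon>"
  have r: "0 < ?r" using \<epsilon> by simp
  then obtain P where P: "P \<in> W0" "cube P \<subseteq> ball b ?r" "\<epsilon> * ?r \<le> side P"
    using cork b \<delta> unfolding corkscrew_covering_def by blast
  have "side Q \<le> side P" using P(3) \<epsilon> by simp
  moreover obtain a' where a': "a' \<in> cube P" using cube_nonempty by blast
  moreover have "b \<notin> \<Omega>" using b \<Omega> by (simp add: frontier_def interior_open)
  ultimately obtain S z where S: "S \<in> W0" "side S = side Q" "z \<in> closed_segment a' b" "z \<in> closure (cube S)"
    using whitney_intermediate_cube[OF W0 \<Omega> P(1)] by blast
  obtain v where v: "v \<in> cube S" "dist v z < side Q"
    using S(4) unfolding closure_approachable by (metis side_pos(1))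
  have "dist z b \<le> dist a' b" using dist_in_closed_segment[OF S(3)] by auto
  also have "dist a' b < ?r" using P(2) a' by (auto simp: dist_commute)
  finally have "dist a v < (4 * C2 * side Q + side Q) + ?r + side Q"
    using ab(3) v(2) dist_triangle[of a v b] dist_triangle[of b v z] by (simp add: dist_commute)
  then have "long_dist (cube Q) (cube S) \<le> (2 * real CARD('d) + 4 * C2 + 2 + 1 / \<epsilon>) * side Q"
    using long_dist_cube_le[OF ab(1) v(1)] S(2) by (simp add: algebra_simps)
  also have "\<dots> \<le> C * side Q" using C by (intro mult_right_mono) auto
  finally show ?thesis using S by (auto simp: symmetrized_def)
qed

section \<open>Porosity: the frontier is null\<close>

text \<open>If a bounded piece S had measure m > 0, take an open U containing S of measure at most
  (1 + c) m and a Vitali covering of S by disjoint balls inside U. The hole in each ball removes the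
  fraction c, so m \<le> (1 - c)(1 + c) m < m.\<close>

lemma porous_negligible:
  fixes F :: "(real^'d) set"
  assumes F: "closed F" and \<epsilon>: "0 < \<epsilon>"
    and porous: "\<And>x. x \<in> F \<Longrightarrow> \<exists>R>0. \<forall>r. 0 < r \<longrightarrow> r < R \<longrightarrow>
      (\<exists>Q :: 'd dyadic. cube Q \<subseteq> ball x r \<and> cube Q \<inter> F = {} \<and> \<epsilon> * r \<le> side Q)"
  shows "negligible F"
proof -
  have "negligible (F \<inter> ball 0 (real n))" for n
  proof (rule ccontr)
    let ?d = "CARD('d)"
    define S where "S = F \<inter> ball 0 (real n)"
    assume "\<not> negligible (F \<inter> ball 0 (real n))"
    have S: "S \<in> lmeasurable"
      unfolding S_def using F by (intro bounded_set_imp_lmeasurable bounded_Int) auto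
    define m where "m = measure lebesgue S"
    have m: "0 < m"
      using \<open>\<not> negligible _\<close> S negligible_iff_measure[of S] by (auto simp: m_def S_def zero_less_measure_iff)
    define \<omega> where "\<omega> = unit_ball_vol (real ?d)"
    have \<omega>: "0 < \<omega>" by (simp add: \<omega>_def)
    \<comment> \<open>A cube of side \<epsilon> r fills the fraction \<epsilon>^d / \<omega> of a
      ball of radius r; the cap 1/2 keeps 1 - c positive.\<close>
    define c where "c = min (1/2) (\<epsilon> ^ ?d / \<omega>)"
    have c: "0 < c" "c \<le> 1/2" "c * \<omega> \<le> \<epsilon> ^ ?d"
    proof -
      show "0 < c" using \<omega> \<epsilon> by (auto simp: c_def)
      show "c \<le> 1/2" unfolding c_def by (rule min.cobounded1)
      have "c * \<omega> \<le> \<epsilon> ^ ?d / \<omega> * \<omega>" using \<omega> by (intro mult_right_mono) (auto simp: c_def)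
      then show "c * \<omega> \<le> \<epsilon> ^ ?d" using \<omega> by simp
    qed
    have "S \<in> sets lebesgue" using S by (rule fmeasurableD)
    then obtain U where U: "open U" "S \<subseteq> U" and US: "U - S \<in> lmeasurable" "emeasure lebesgue (U - S) < ennreal (c * m)"
      using sets_lebesgue_outer_open[of S "c * m"] c m by (metis mult_pos_pos)
    have U3: "emeasure lebesgue U \<le> ennreal (m + c * m)"
    proof -
      have "emeasure lebesgue U \<le> emeasure lebesgue (S \<union> (U - S))"
        using S US U by (intro emeasure_mono) auto
      also have "\<dots> \<le> emeasure lebesgue S + emeasure lebesgue (U - S)"
        using S US by (intro emeasure_subadditive) auto
      also have "\<dots> \<le> ennreal m + ennreal (c * m)"
        using S US by (intro add_mono) (auto simp: m_def emeasure_eq_measure2)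
      finally show ?thesis using c m by simp
    qed
    define K where "K = {(x, r). x \<in> S \<and> 0 < r \<and> ball x r \<subseteq> U \<and>
      (\<exists>Q :: 'd dyadic. cube Q \<subseteq> ball x r \<and> cube Q \<inter> F = {} \<and> \<epsilon> * r \<le> side Q)}"
    have cover: "\<exists>i. i \<in> K \<and> x \<in> ball (fst i) (snd i) \<and> snd i < e" if x: "x \<in> S" and e: "0 < e" for x e
    proof -
      obtain R where R: "0 < R" "\<And>r. 0 < r \<Longrightarrow> r < R \<Longrightarrow>
          \<exists>Q :: 'd dyadic. cube Q \<subseteq> ball x r \<and> cube Q \<inter> F = {} \<and> \<epsilon> * r \<le> side Q"
        using porous[of x] x unfolding S_def by blast
      obtain r' where r': "0 < r'" "ball x r' \<subseteq> U" using U x by (meson open_contains_ball subsetD)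
      define r where "r = min r' (min (R / 2) (e / 2))"
      have "0 < r" "r < R" "r < e" "r \<le> r'" using R r' e by (auto simp: r_def)
      then have "(x, r) \<in> K" using x r'(2) R(2)[of r] subset_ball[of r r' x] unfolding K_def by blast
      then show ?thesis using \<open>0 < r\<close> \<open>r < e\<close> by (intro exI[of _ "(x, r)"]) auto
    qed
    obtain I where I: "countable I" "I \<subseteq> K"
      "pairwise (\<lambda>i j. disjnt (ball (fst i) (snd i)) (ball (fst j) (snd j))) I"
      "negligible (S - (\<Union>i\<in>I. ball (fst i) (snd i)))"
      by (rule Vitali_covering_theorem_balls[OF cover])
    let ?b = "\<lambda>i. ball (fst i) (snd i)"
    have disj: "disjoint_family_on ?b I"
      using I(3) unfolding disjoint_family_on_def pairwise_def disjnt_def by metis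
    then have disj': "disjoint_family_on (\<lambda>i. S \<inter> ?b i) I"
      unfolding disjoint_family_on_def by blast
    have Ssets: "S \<in> sets lebesgue" using S by (rule fmeasurableD)
    have hole: "emeasure lebesgue (S \<inter> ?b i) \<le> ennreal (1 - c) * emeasure lebesgue (?b i)" if i: "i \<in> I" for i
    proof -
      obtain x r where xr: "i = (x, r)" by fastforce
      have "i \<in> K" using i I(2) by blast
      then obtain Q :: "'d dyadic" where r: "0 < r" and Q: "cube Q \<subseteq> ball x r" "cube Q \<inter> F = {}" "\<epsilon> * r \<le> side Q"
        unfolding K_def xr by blast
      have "emeasure lebesgue (S \<inter> ?b i) \<le> emeasure lebesgue (ball x r - cube Q)"
        using Q by (intro emeasure_mono) (auto simp: S_def xr)
      also have "\<dots> = emeasure lborel (ball x r) - emeasure lborel (cube Q)"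
        using Q by (subst emeasure_Diff) (auto simp: emeasure_cube)
      also have "\<dots> = ennreal (\<omega> * r ^ ?d - side Q ^ ?d)"
        using r by (simp add: emeasure_ball emeasure_cube \<omega>_def ennreal_minus)
      also have "\<dots> \<le> ennreal ((1 - c) * (\<omega> * r ^ ?d))"
      proof (rule ennreal_leI)
        have "c * \<omega> * r ^ ?d \<le> \<epsilon> ^ ?d * r ^ ?d" using c r by (intro mult_right_mono) auto
        also have "\<dots> = (\<epsilon> * r) ^ ?d" by (simp add: power_mult_distrib)
        also have "\<dots> \<le> side Q ^ ?d" using Q(3) r \<epsilon> by (intro power_mono) auto
        finally show "\<omega> * r ^ ?d - side Q ^ ?d \<le> (1 - c) * (\<omega> * r ^ ?d)" by (simp add: algebra_simps)
      qed
      also have "\<dots> = ennreal (1 - c) * emeasure lebesgue (?b i)"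
        using r c \<omega> by (simp add: xr emeasure_ball \<omega>_def ennreal_mult)
      finally show ?thesis .
    qed
    define B where "B = (\<Union>i\<in>I. ?b i)"
    have "open B" unfolding B_def by (intro open_UN ballI open_ball)
    then have B: "B \<in> sets lebesgue" by simp
    have Kb: "?b i \<subseteq> U" if "i \<in> K" for i
      using that by (cases i) (simp add: K_def)
    have BU: "B \<subseteq> U" using Kb I(2) unfolding B_def by blast
    have "emeasure lebesgue S = emeasure lebesgue ((S \<inter> B) \<union> (S - B))"
      by (simp add: Int_Diff_Un)
    also have "\<dots> = emeasure lebesgue (S \<inter> B)"
      using I(4) Ssets B unfolding B_def[symmetric]
      by (intro emeasure_Un_null_set) (auto simp: negligible_iff_null_sets)
    also have "S \<inter> B = (\<Union>i\<in>I. S \<inter> ?b i)" unfolding B_def by blast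
    also have "emeasure lebesgue (\<Union>i\<in>I. S \<inter> ?b i) = (\<integral>\<^sup>+i. emeasure lebesgue (S \<inter> ?b i) \<partial>count_space I)"
      using I(1) disj' Ssets by (intro emeasure_UN_countable) auto
    also have "\<dots> \<le> (\<integral>\<^sup>+i. ennreal (1 - c) * emeasure lebesgue (?b i) \<partial>count_space I)"
      using hole by (intro nn_integral_mono) auto
    also have "\<dots> = ennreal (1 - c) * (\<integral>\<^sup>+i. emeasure lebesgue (?b i) \<partial>count_space I)"
      by (rule nn_integral_cmult) auto
    also have "(\<integral>\<^sup>+i. emeasure lebesgue (?b i) \<partial>count_space I) = emeasure lebesgue B"
      unfolding B_def using I(1) disj by (intro emeasure_UN_countable[symmetric]) auto
    also have "ennreal (1 - c) * \<dots> \<le> ennreal (1 - c) * emeasure lebesgue U"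
      using BU U by (intro mult_left_mono emeasure_mono) auto
    also have "\<dots> \<le> ennreal (1 - c) * ennreal (m + c * m)"
      using U3 by (intro mult_left_mono) auto
    finally have "ennreal m \<le> ennreal ((1 - c) * (m + c * m))"
      using S c m by (simp add: m_def emeasure_eq_measure2 ennreal_mult)
    then have "m \<le> (1 - c) * (m + c * m)"
      using c m by (subst (asm) ennreal_le_iff) auto
    also have "\<dots> = m - c * c * m" by (simp add: algebra_simps)
    also have "\<dots> < m" using c m by simp
    finally show False by simp
  qed
  then have "negligible (\<Union>n::nat. F \<inter> ball 0 (real n))" by (intro negligible_Union_nat) auto
  moreover have "F = (\<Union>n::nat. F \<inter> ball 0 (real n))"
    using reals_Archimedean2[of "norm _"] by auto
  ultimately show ?thesis by simp
qed

text \<open>The corkscrew cubes lie in the open set \<Omega>, so they are holes in its frontier.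
  Pointwise estimates are thus needed only in \<Omega> and in the exterior.\<close>

lemma corkscrew_frontier_negligible:
  fixes \<Omega> :: "(real^'d) set"
  assumes \<epsilon>: "0 < \<epsilon>" and \<delta>: "0 < \<delta>" and \<Omega>: "open \<Omega>" and cork: "corkscrew_covering \<epsilon> \<delta> \<Omega> W"
  shows "negligible (frontier \<Omega>)"
proof (rule porous_negligible[OF _ \<epsilon>])
  fix x assume x: "x \<in> frontier \<Omega>"
  obtain R where R: "0 < R" "ereal R \<le> \<delta>"
  proof (cases \<delta>)
    case (real r)
    then show ?thesis using that[of r] \<delta> by simp
  qed (use \<delta> that[of 1] in auto)
  have "\<exists>Q :: 'd dyadic. cube Q \<subseteq> ball x r \<and> cube Q \<inter> frontier \<Omega> = {} \<and> \<epsilon> * r \<le> side Q"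
    if r: "0 < r" "r < R" for r
  proof -
    have "ereal r \<le> \<delta>" using r R by (meson ereal_less_eq(3) less_imp_le order_trans)
    then obtain Q where Q: "Q \<in> W" "cube Q \<subseteq> ball x r" "\<epsilon> * r \<le> side Q"
      using cork x r unfolding corkscrew_covering_def by blast
    have "cube Q \<subseteq> \<Omega>"
      using cork Q(1) whitney_const_D(3) closure_subset
      unfolding corkscrew_covering_def whitney_covering_def by blast
    then have "cube Q \<inter> frontier \<Omega> = {}" using \<Omega> by (auto simp: frontier_def interior_open)
    then show ?thesis using Q by blast
  qed
  then show "\<exists>R>0. \<forall>r. 0 < r \<longrightarrow> r < R \<longrightarrow>
      (\<exists>Q :: 'd dyadic. cube Q \<subseteq> ball x r \<and> cube Q \<inter> frontier \<Omega> = {} \<and> \<epsilon> * r \<le> side Q)"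
    using R by blast
qed simp

section \<open>Bounded overlap of the symmetrized cubes\<close>

text \<open>If x lies in several symmetrized cubes, these coincide, as the cubes of
  \<open>W0\<close> are disjoint; so the original cubes share one side. They are disjoint and
  contained in the ball about x of radius C times that side, and comparing volumes bounds their
  number.\<close>

lemma symmetrized_overlap:
  fixes W0 W :: "'d::finite dyadic set"
  assumes disj: "disjoint_family_on cube W0" "disjoint_family_on cube W"
    and star: "\<And>Q. Q \<in> W \<Longrightarrow> star Q \<in> W0 \<and> symmetrized C Q (star Q)"
  shows "finite {Q \<in> W. x \<in> cube (star Q)} \<and>
    card {Q \<in> W. x \<in> cube (star Q)} \<le> nat \<lceil>unit_ball_vol (real CARD('d)) * C ^ CARD('d)\<rceil>"
proof (rule finite_if_finite_subsets_card_bdd)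
  fix T assume T: "T \<subseteq> {Q \<in> W. x \<in> cube (star Q)}" "finite T"
  let ?d = "CARD('d)"
  show "card T \<le> nat \<lceil>unit_ball_vol (real ?d) * C ^ ?d\<rceil>"
  proof (cases "T = {}")
    case False
    then obtain P where P: "P \<in> T" by blast
    let ?l = "side P"
    have side: "side Q = ?l" if Q: "Q \<in> T" for Q
    proof -
      have "x \<in> cube (star Q) \<inter> cube (star P)" "star Q \<in> W0" "star P \<in> W0" using T P Q star by blast+
      then have "star Q = star P" using disj(1) unfolding disjoint_family_on_def by blast
      moreover have "Q \<in> W" "P \<in> W" using T P Q by blast+
      ultimately show ?thesis using star[of Q] star[of P] unfolding symmetrized_def by metis
    qed
    have dist: "dist y x \<le> C * ?l" if "Q \<in> T" "y \<in> cube Q" for Q y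
    proof -
      have "dist y x \<le> long_dist (cube Q) (cube (star Q))"
        using that T by (intro dist_le_long_dist) auto
      also have "\<dots> \<le> C * side Q" using star[of Q] T that by (auto simp: symmetrized_def)
      finally show ?thesis using side that by simp
    qed
    obtain y where "y \<in> cube P" using cube_nonempty by blast
    then have C: "0 \<le> C * ?l" using dist[OF P, of y] zero_le_dist[of y x] by linarith
    have "real (card T) * ?l ^ ?d = (\<Sum>Q\<in>T. measure lebesgue (cube Q))"
      using side by (simp add: measure_cube)
    also have "\<dots> = measure lebesgue (\<Union>Q\<in>T. cube Q)"
    proof (rule measure_finite_Union[symmetric])
      show "disjoint_family_on cube T" using T disj(2) by (elim disjoint_family_on_mono[rotated]) blast
    qed (use T in \<open>auto simp: emeasure_cube\<close>)
    also have "\<dots> \<le> measure lebesgue (cball x (C * ?l))"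
      using T(2) dist by (intro measure_mono_fmeasurable) (auto simp: dist_commute)
    also have "\<dots> = unit_ball_vol (real ?d) * (C * ?l) ^ ?d"
      using content_cball[OF C, of x] by simp
    finally have "real (card T) * ?l ^ ?d \<le> (unit_ball_vol (real ?d) * C ^ ?d) * ?l ^ ?d"
      by (simp add: power_mult_distrib mult_ac)
    then have "real (card T) \<le> unit_ball_vol (real ?d) * C ^ ?d"
      by (rule mult_right_le_imp_le) simp
    then show ?thesis by linarith
  qed simp
qed

section \<open>Oscillation of the extension\<close>

lemma norm_diff_mean_le:
  fixes S :: "'d::finite dyadic"
  assumes f: "set_integrable lebesgue (cube S) f"
  shows "ennreal (norm (c - mean f (cube S))) * ennreal (side S ^ CARD('d))
    \<le> (\<integral>\<^sup>+y\<in>cube S. ennreal (norm (c - f y)) \<partial>lebesgue)"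
proof -
  let ?m = "side S ^ CARD('d)"
  have fin: "emeasure lebesgue (cube S) \<noteq> \<infinity>" by (simp add: emeasure_cube)
  have c: "set_integrable lebesgue (cube S) (\<lambda>_. c)"
    unfolding set_integrable_def using fin by (intro integrable_scaleR_left integrable_real_indicator) (auto simp: less_top)
  have m: "0 < ?m" by simp
  have "(LINT y:cube S|lebesgue. c) = ?m *\<^sub>R c"
    using fin by (subst set_integral_const) (auto simp: measure_cube less_top)
  then have "?m *\<^sub>R (c - mean f (cube S)) = (LINT y:cube S|lebesgue. c - f y)"
    using c f m by (simp add: set_integral_diff mean_def measure_cube scaleR_right_diff_distrib)
  then have "norm (LINT y:cube S|lebesgue. c - f y) = norm (c - mean f (cube S)) * ?m"
    using m by (metis abs_of_pos mult.commute norm_scaleR)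
  then have "ennreal (norm (c - mean f (cube S)) * ?m) = ennreal (norm (LINT y:cube S|lebesgue. c - f y))"
    by simp
  also have "\<dots> \<le> (\<integral>\<^sup>+y. ennreal (norm (indicator (cube S) y *\<^sub>R (c - f y))) \<partial>lebesgue)"
    unfolding set_lebesgue_integral_def using set_integral_diff(1)[OF c f]
    by (intro integral_norm_bound_ennreal) (simp add: set_integrable_def)
  also have "\<dots> = (\<integral>\<^sup>+y\<in>cube S. ennreal (norm (c - f y)) \<partial>lebesgue)"
    by (intro nn_integral_cong) (auto simp: indicator_def)
  finally show ?thesis by (simp add: ennreal_mult)
qed

lemma emeasure_ball_lebesgue:
  fixes x :: "real^'d"
  shows "0 \<le> t \<Longrightarrow> emeasure lebesgue (ball x t) = ennreal (unit_ball_vol (real CARD('d)) * t ^ CARD('d))"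
  by (simp add: emeasure_ball)

lemma ball_lebesgue [measurable]: "ball x t \<in> sets lebesgue"
  by simp

lemma osc_le_const:
  fixes x :: "real^'d"
  assumes "0 \<le> t" and "\<And>y. y \<in> ball x t \<Longrightarrow> norm (f x - f y) \<le> B"
  shows "osc UNIV f x t \<le> ennreal (unit_ball_vol (real CARD('d)) * t ^ CARD('d)) * ennreal B"
proof -
  have "osc UNIV f x t \<le> (\<integral>\<^sup>+y. ennreal B * indicator (ball x t) y \<partial>lebesgue)"
    unfolding osc_def using assms(2) by (intro nn_integral_mono) (auto simp: indicator_def intro!: ennreal_leI)
  also have "\<dots> = ennreal B * emeasure lebesgue (ball x t)"
    by (rule nn_integral_cmult_indicator) simp
  finally show ?thesis using emeasure_ball_lebesgue[OF assms(1), of x] by (simp add: mult.commute)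
qed

text \<open>Sums over cubes are written as integrals over \<open>count_space\<close>, which lets
  them be exchanged with Lebesgue integrals.\<close>

lemma borel_measurable_nn_integral_count_space:
  fixes F :: "'i \<Rightarrow> 'a \<Rightarrow> ennreal"
  assumes I: "countable I" and F: "\<And>i. i \<in> I \<Longrightarrow> F i \<in> borel_measurable M"
  shows "(\<lambda>x. \<integral>\<^sup>+i. F i x \<partial>count_space I) \<in> borel_measurable M"
proof (cases "finite I")
  case True
  then show ?thesis using F by (simp add: nn_integral_count_space_finite)
next
  case False
  have "(\<integral>\<^sup>+i. F i x \<partial>count_space I) = (\<Sum>n. F (from_nat_into I n) x)" for x
    using nn_integral_bij_count_space[OF bij_betw_from_nat_into[OF I False], of "\<lambda>i. F i x"]
    by (simp add: nn_integral_count_space_nat)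
  moreover have "F (from_nat_into I n) \<in> borel_measurable M" for n
    using False by (intro F from_nat_into) auto
  ultimately show ?thesis by simp
qed

text \<open>The corkscrew condition appears through its consequences: a null frontier and the map
  \<open>star\<close>. In the application \<open>l\<close> is ten times the scale of the
  construction, \<open>L\<close> is the constant C of the symmetrization, and \<open>M\<close> is a
  bound for the gradients in Lipschitz form.\<close>

locale whitney_extension =
  fixes \<Omega> :: "(real^'d) set" and W0 W2 W3 :: "'d dyadic set"
    and \<psi> :: "'d dyadic \<Rightarrow> real^'d \<Rightarrow> real" and star :: "'d dyadic \<Rightarrow> 'd dyadic"
    and C2 l L M :: real and N :: nat
  assumes open_dom: "open \<Omega>"
    and frontier_null: "negligible (frontier \<Omega>)"
    and W0_subset: "\<And>Q. Q \<in> W0 \<Longrightarrow> cube Q \<subseteq> \<Omega>"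
    and W0_disj: "disjoint_family_on cube W0"
    and W2: "whitney_covering_const C2 (- closure \<Omega>) W2"
    and overlap50: "\<And>x. finite {Q \<in> W2. x \<in> dilate 50 Q}" "\<And>x. card {Q \<in> W2. x \<in> dilate 50 Q} \<le> N"
    and psi_sum: "\<And>x. x \<in> - closure \<Omega> \<Longrightarrow> ((\<lambda>Q. \<psi> Q x) has_sum 1) W2"
    and psi_nonneg: "\<And>Q x. Q \<in> W2 \<Longrightarrow> 0 \<le> \<psi> Q x"
    and psi_le: "\<And>Q x. Q \<in> W2 \<Longrightarrow> \<psi> Q x \<le> indicator (dilate (11/10) Q) x"
    and psi_lipschitz: "\<And>Q x y. Q \<in> W2 \<Longrightarrow> \<bar>\<psi> Q x - \<psi> Q y\<bar> \<le> M / side Q * dist x y"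
    and M_nonneg: "0 \<le> M"
    and W3: "W3 = {Q \<in> W2. side Q < l}" and l_pos: "0 < l"
    and star_in: "\<And>Q. Q \<in> W3 \<Longrightarrow> star Q \<in> W0"
    and star_sym: "\<And>Q. Q \<in> W3 \<Longrightarrow> symmetrized L Q (star Q)" and L_nonneg: "0 \<le> L"
begin

abbreviation "G \<equiv> - closure \<Omega>"
definition "rdim = real CARD('d)"
definition "\<omega> = unit_ball_vol (real CARD('d))"
definition "dd x = infdist x (frontier G)"
text \<open>For x in 2Q the distance \<open>dd x\<close> lies between side Q and \<kappa> times side
  Q.\<close>

definition "\<kappa> = 4 * C2 + 2 * rdim"
text \<open>The factor 2, larger than the 11/10 of the supports, leaves room for moving x: one
  finite set then serves a whole neighbourhood of x, see \<open>close_near\<close>.\<close>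

definition "near x = {Q \<in> W2. x \<in> dilate 2 Q}"
definition "N' = nat \<lceil>unit_ball_vol (real CARD('d)) * L ^ CARD('d)\<rceil>"
definition "ext f = Lambda0 \<Omega> W3 \<psi> star f"
definition "avg f Q = mean f (cube (star Q))"
text \<open>Satisfied by the extension by zero of any function in the space on \<Omega>; all means
  in the construction then come from integrable functions.\<close>

definition "admissible f \<longleftrightarrow> f \<in> borel_measurable lebesgue \<and> (\<forall>Q\<in>W3. set_integrable lebesgue (cube (star Q)) f)"

lemma rdim_ge_1: "1 \<le> rdim" by (simp add: rdim_def)

lemma kappa_ge_2: "2 \<le> \<kappa>"
  using whitney_const_D(1)[OF W2] rdim_ge_1 by (simp add: \<kappa>_def)

lemma omega_pos: "0 < \<omega>" by (simp add: \<omega>_def)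

lemma W3_W2: "Q \<in> W3 \<Longrightarrow> Q \<in> W2" by (simp add: W3)

lemma nearD:
  assumes "Q \<in> near x"
  shows "Q \<in> W2" "x \<in> dilate 2 Q" "x \<in> G" "3/2 * side Q \<le> dd x" "side Q < dd x" "dd x \<le> \<kappa> * side Q"
proof -
  show *: "Q \<in> W2" "x \<in> dilate 2 Q" using assms by (auto simp: near_def)
  show "x \<in> G"
    using whitney_dilate_5_subset[OF W2 *(1)] dilate_mono[of 2 5 Q] *(2) by auto
  show ge: "3/2 * side Q \<le> dd x"
    using whitney_infdist_ge[OF W2 *(1) *(2)] by (simp add: dd_def)
  show "side Q < dd x" using ge side_pos(1)[of Q] by linarith
  show "dd x \<le> \<kappa> * side Q"
    using whitney_infdist_le[OF W2 *(1) *(2)] by (simp add: dd_def \<kappa>_def rdim_def)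
qed

lemma near_subset_50: "near x \<subseteq> {Q \<in> W2. x \<in> dilate 50 Q}"
  unfolding near_def using dilate_mono[of 2 50] by auto

lemma finite_near [simp]: "finite (near x)"
  using overlap50(1) near_subset_50 by (rule finite_subset[rotated])

lemma card_near: "card (near x) \<le> N"
  using card_mono[OF overlap50(1) near_subset_50] overlap50(2) order_trans by blast

lemma psi_le_1: "Q \<in> W2 \<Longrightarrow> \<psi> Q x \<le> 1"
  by (rule order_trans[OF psi_le]) (auto simp: indicator_def)

lemma psi_support:
  assumes "Q \<in> W2" "\<psi> Q x \<noteq> 0"
  shows "x \<in> dilate (11/10) Q"
proof (rule ccontr)
  assume "x \<notin> dilate (11/10) Q"
  then show False using psi_le[OF assms(1), of x] psi_nonneg[OF assms(1), of x] assms(2) by simp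
qed

lemma psi_near: "Q \<in> W2 \<Longrightarrow> \<psi> Q x \<noteq> 0 \<Longrightarrow> Q \<in> near x"
  using psi_support[of Q x] dilate_mono[of "11/10" 2 Q] by (auto simp: near_def)

lemma psi_sum_finite:
  assumes x: "x \<in> G" and T: "finite T" "T \<subseteq> W2" "\<And>Q. Q \<in> W2 \<Longrightarrow> \<psi> Q x \<noteq> 0 \<Longrightarrow> Q \<in> T"
  shows "(\<Sum>Q\<in>T. \<psi> Q x) = 1"
proof -
  have "((\<lambda>Q. \<psi> Q x) has_sum 1) T"
    using psi_sum[OF x] by (rule has_sum_cong_neutral[THEN iffD1, rotated -1]) (use T in auto)
  then show ?thesis using T(1) by (meson has_sum_finite has_sum_unique)
qed

lemma ext_eq:
  assumes T: "finite T" "T \<subseteq> W3" "\<And>Q. Q \<in> W3 \<Longrightarrow> \<psi> Q x \<noteq> 0 \<Longrightarrow> Q \<in> T"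
  shows "ext f x = indicator \<Omega> x *\<^sub>R f x + (\<Sum>Q\<in>T. \<psi> Q x *\<^sub>R avg f Q)"
proof -
  have "(\<Sum>\<^sub>\<infinity>Q\<in>W3. \<psi> Q x *\<^sub>R mean f (cube (star Q))) = (\<Sum>\<^sub>\<infinity>Q\<in>T. \<psi> Q x *\<^sub>R mean f (cube (star Q)))"
    using T by (intro infsum_cong_neutral) auto
  then show ?thesis using T(1) by (simp add: ext_def Lambda0_def avg_def)
qed

lemma ext_inside:
  assumes "x \<in> \<Omega>" shows "ext f x = f x"
proof -
  have "\<psi> Q x = 0" if "Q \<in> W3" for Q
    using psi_near[of Q x] nearD(3)[of Q x] W3_W2[OF that] closure_subset assms by blast
  then have "ext f x = indicator \<Omega> x *\<^sub>R f x + (\<Sum>Q\<in>{}. \<psi> Q x *\<^sub>R avg f Q)"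
    by (intro ext_eq) auto
  then show ?thesis using assms by simp
qed

lemma ext_outside:
  assumes "x \<in> G" "finite T" "T \<subseteq> W3" "\<And>Q. Q \<in> W3 \<Longrightarrow> \<psi> Q x \<noteq> 0 \<Longrightarrow> Q \<in> T"
  shows "ext f x = (\<Sum>Q\<in>T. \<psi> Q x *\<^sub>R avg f Q)"
proof -
  have "x \<notin> \<Omega>" using assms(1) closure_subset by blast
  then show ?thesis using ext_eq[OF assms(2-4)] by simp
qed

text \<open>A cube near x has side below \<open>dd x\<close>, so close to the frontier the
  restriction to small cubes removes no term of the partition of unity.\<close>

lemma near_W3: "x \<in> G \<Longrightarrow> dd x \<le> l \<Longrightarrow> near x \<subseteq> W3"
  using nearD(1,5) by (fastforce simp: W3)

text \<open>The partition of unity lets a constant pass into the sum, provided T contains every cube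
  active at x. Where larger cubes are active, the choice c = 0 remains.\<close>

lemma ext_outside_diff:
  assumes x: "x \<in> G" and T: "finite T" "T \<subseteq> W3" "\<And>Q. Q \<in> W3 \<Longrightarrow> \<psi> Q x \<noteq> 0 \<Longrightarrow> Q \<in> T"
    and c: "c = 0 \<or> (\<forall>Q\<in>W2. \<psi> Q x \<noteq> 0 \<longrightarrow> Q \<in> T)"
  shows "ext f x - c = (\<Sum>Q\<in>T. \<psi> Q x *\<^sub>R (avg f Q - c))"
proof -
  have "T \<subseteq> W2" using T(2) W3_W2 by blast
  then have "(\<Sum>Q\<in>T. \<psi> Q x *\<^sub>R c) = c"
    using c psi_sum_finite[OF x T(1)] by (auto simp flip: scaleR_sum_left)
  then show ?thesis
    using ext_outside[OF x T] by (simp add: scaleR_right_diff_distrib sum_subtractf)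
qed

lemma norm_psi_sum_le:
  assumes "T \<subseteq> W2"
  shows "norm (\<Sum>Q\<in>T. \<psi> Q x *\<^sub>R b Q) \<le> (\<Sum>Q\<in>T. norm (b Q))"
proof (intro order_trans[OF norm_sum] sum_mono)
  fix Q assume "Q \<in> T"
  then have "0 \<le> \<psi> Q x" "\<psi> Q x \<le> 1" using assms psi_nonneg psi_le_1 by blast+
  then show "norm (\<psi> Q x *\<^sub>R b Q) \<le> norm (b Q)" by (simp add: mult_left_le_one_le)
qed

lemma star_dist:
  assumes "Q \<in> W3" "y \<in> dilate 2 Q" "\<eta> \<in> cube (star Q)"
  shows "dist y \<eta> \<le> (2 * rdim + L) * side Q"
proof -
  obtain z where z: "z \<in> cube Q" using cube_nonempty by blast
  have "dist y z \<le> real CARD('d) * ((2 + 1) * side Q / 2)"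
    using z assms(2) by (intro dist_dilate_le) (auto simp: dilate_1)
  also have "\<dots> \<le> rdim * (2 * side Q)" unfolding rdim_def by (intro mult_left_mono) auto
  finally have "dist y z \<le> 2 * rdim * side Q" by simp
  moreover have "dist z \<eta> \<le> long_dist (cube Q) (cube (star Q))"
    using z assms(3) by (intro dist_le_long_dist) auto
  moreover have "\<dots> \<le> L * side Q" using star_sym[OF assms(1)] by (simp add: symmetrized_def)
  ultimately show ?thesis using dist_triangle[of y \<eta> z] by (simp add: distrib_right)
qed

lemma star_subset: "Q \<in> W3 \<Longrightarrow> cube (star Q) \<subseteq> \<Omega>"
  using star_in W0_subset by blast

lemma side_star: "Q \<in> W3 \<Longrightarrow> side (star Q) = side Q"
  using star_sym by (simp add: symmetrized_def)

lemma avg_diff_le: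
  assumes "admissible f" "Q \<in> W3"
  shows "ennreal (norm (c - avg f Q)) * ennreal (side Q ^ CARD('d))
    \<le> (\<integral>\<^sup>+y\<in>cube (star Q). ennreal (norm (c - f y)) \<partial>lebesgue)"
  using norm_diff_mean_le[of "star Q" f c] assms side_star[OF assms(2)]
  by (simp add: admissible_def avg_def)

lemma dom_sets [measurable]: "\<Omega> \<in> sets borel"
  using open_dom by (rule borel_open)

text \<open>After exchanging sum and integral, each y is counted at most \<open>N'\<close>
  times.\<close>

lemma overlap_sum_le:
  assumes [measurable]: "\<Theta> \<in> borel_measurable lebesgue" and V: "V \<subseteq> W3"
    and E [measurable]: "E \<in> sets borel" and sub: "\<And>Q. Q \<in> V \<Longrightarrow> cube (star Q) \<subseteq> E"
  shows "(\<integral>\<^sup>+Q. (\<integral>\<^sup>+y\<in>cube (star Q). \<Theta> y \<partial>lebesgue) \<partial>count_space V)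
    \<le> ennreal (real N') * (\<integral>\<^sup>+y\<in>E. \<Theta> y \<partial>lebesgue)"
proof -
  have "(\<integral>\<^sup>+Q. (\<integral>\<^sup>+y\<in>cube (star Q). \<Theta> y \<partial>lebesgue) \<partial>count_space V)
      = (\<integral>\<^sup>+y. (\<integral>\<^sup>+Q. \<Theta> y * indicator (cube (star Q)) y \<partial>count_space V) \<partial>lebesgue)"
    by (rule nn_integral_count_space_nn_integral[symmetric]) auto
  also have "\<dots> \<le> (\<integral>\<^sup>+y. ennreal (real N') * (\<Theta> y * indicator E y) \<partial>lebesgue)"
  proof (intro nn_integral_mono)
    fix y
    have *: "finite {Q \<in> V. y \<in> cube (star Q)} \<and> card {Q \<in> V. y \<in> cube (star Q)} \<le> N'"
      unfolding N'_def
    proof (rule symmetrized_overlap[OF W0_disj])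
      show "disjoint_family_on cube V"
        using whitney_const_D(2)[OF W2] by (rule disjoint_family_on_mono[rotated]) (use V W3_W2 in blast)
    qed (use V star_in star_sym in blast)
    have "(\<integral>\<^sup>+Q. \<Theta> y * indicator (cube (star Q)) y \<partial>count_space V)
        = (\<Sum>Q\<in>{Q \<in> V. y \<in> cube (star Q)}. \<Theta> y * indicator (cube (star Q)) y)"
      using * by (intro nn_integral_count_space') (auto simp: indicator_def)
    also have "\<dots> = (\<Sum>Q\<in>{Q \<in> V. y \<in> cube (star Q)}. \<Theta> y * indicator E y)"
      using sub by (intro sum.cong) (auto simp: indicator_def)
    also have "\<dots> = of_nat (card {Q \<in> V. y \<in> cube (star Q)}) * (\<Theta> y * indicator E y)"
      by simp
    also have "\<dots> \<le> ennreal (real N') * (\<Theta> y * indicator E y)"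
      using * by (intro mult_right_mono) (auto simp: ennreal_of_nat_eq_real_of_nat intro!: ennreal_leI)
    finally show "(\<integral>\<^sup>+Q. \<Theta> y * indicator (cube (star Q)) y \<partial>count_space V)
        \<le> ennreal (real N') * (\<Theta> y * indicator E y)" .
  qed
  also have "\<dots> = ennreal (real N') * (\<integral>\<^sup>+y\<in>E. \<Theta> y \<partial>lebesgue)"
    by (rule nn_integral_cmult) auto
  finally show ?thesis .
qed

lemma dd_le_dist: "x \<in> \<Omega> \<Longrightarrow> y \<in> G \<Longrightarrow> dd y \<le> dist y x"
  unfolding dd_def using closure_subset by (intro infdist_frontier_le_dist) auto

lemma AE_frontier: "AE x in lebesgue. x \<notin> frontier \<Omega>"
  using frontier_null by (auto simp: negligible_iff_null_sets intro: AE_not_in)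

lemma not_frontier_cases: "x \<notin> frontier \<Omega> \<Longrightarrow> x \<in> \<Omega> \<or> x \<in> G"
  using open_dom by (auto simp: frontier_def interior_open)

section \<open>Oscillation around points of the domain\<close>

text \<open>At an exterior point y of the ball, \<open>f x - ext f y\<close> is a convex combination
  of the differences between \<open>f x\<close> and the averages of the cubes near y. Integrating
  such a difference over 2Q costs 2^d times the integral of |f x - f| over the symmetrized cube,
  which lies within (2 d + L) t of y. Bounded overlap sums these integrals.\<close>

lemma osc_ext_inside:
  assumes f: "admissible f" and x: "x \<in> \<Omega>" and t: "0 < t" "t \<le> l"
  shows "osc UNIV (ext f) x t \<le> ennreal (1 + 2 ^ CARD('d) * real N') * osc \<Omega> f x ((1 + 2 * rdim + L) * t)"
proof -
  let ?d = "CARD('d)" and ?r = "(1 + 2 * rdim + L) * t"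
  have [measurable]: "f \<in> borel_measurable lebesgue" using f by (simp add: admissible_def)
  \<comment> \<open>It contains all cubes near an exterior point y of the ball: their sides are
    below \<open>dd y\<close>, which is at most dist x y < t. Since t \<le> l, every cube of V has a
    symmetrized one.\<close>
  define V where "V = {Q \<in> W2. side Q < t \<and> dilate 2 Q \<inter> ball x t \<noteq> {}}"
  have V: "V \<subseteq> W3" using t by (auto simp: V_def W3)
  have tr: "t \<le> ?r" using t rdim_ge_1 L_nonneg by (simp add: algebra_simps)
  have Vsub: "cube (star Q) \<subseteq> ball x ?r \<inter> \<Omega>" if Q: "Q \<in> V" for Q
  proof
    fix \<eta> assume \<eta>: "\<eta> \<in> cube (star Q)"
    obtain y where y: "y \<in> dilate 2 Q" "y \<in> ball x t" using Q by (auto simp: V_def)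
    have "dist x \<eta> \<le> dist x y + (2 * rdim + L) * side Q"
      using star_dist[OF _ y(1) \<eta>] Q V dist_triangle[of x \<eta> y] by fastforce
    also have "\<dots> < t + (2 * rdim + L) * t"
      using y(2) Q rdim_ge_1 L_nonneg by (intro add_less_le_mono mult_left_mono) (auto simp: V_def)
    finally show "\<eta> \<in> ball x ?r \<inter> \<Omega>" using star_subset[of Q] V Q \<eta> by (auto simp: algebra_simps)
  qed
  have "osc UNIV (ext f) x t \<le> (\<integral>\<^sup>+y. ennreal (norm (f x - f y)) * indicator (ball x ?r \<inter> \<Omega>) y
      + (\<integral>\<^sup>+Q. ennreal (norm (f x - avg f Q)) * indicator (dilate 2 Q) y \<partial>count_space V) \<partial>lebesgue)"
    unfolding osc_def
  proof (intro nn_integral_mono_AE, use AE_frontier in eventually_elim)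
    fix y assume y: "y \<notin> frontier \<Omega>"
    show "ennreal (norm (ext f x - ext f y)) * indicator (ball x t \<inter> UNIV) y
       \<le> ennreal (norm (f x - f y)) * indicator (ball x ?r \<inter> \<Omega>) y
      + (\<integral>\<^sup>+Q. ennreal (norm (f x - avg f Q)) * indicator (dilate 2 Q) y \<partial>count_space V)"
    proof (cases "y \<in> ball x t")
      case yt: True
      show ?thesis
      proof (cases "y \<in> \<Omega>")
        case True
        then show ?thesis using x yt tr by (simp add: ext_inside)
      next
        case False
        then have yG: "y \<in> G" using not_frontier_cases[OF y] by blast
        have nV: "near y \<subseteq> V"
        proof
          fix Q assume Q: "Q \<in> near y"
          have "side Q < t" using nearD(5)[OF Q] dd_le_dist[OF x yG] yt by (simp add: dist_commute)
          then show "Q \<in> V" using nearD(1,2)[OF Q] yt by (auto simp: V_def)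
        qed
        have "norm (ext f y - f x) \<le> (\<Sum>Q\<in>near y. norm (avg f Q - f x))"
          using nV V W3_W2 psi_near
          by (subst ext_outside_diff[OF yG, of "near y"]) (auto intro!: norm_psi_sum_le)
        then have "ennreal (norm (ext f x - ext f y)) \<le> (\<Sum>Q\<in>near y. ennreal (norm (f x - avg f Q)))"
          using x by (simp add: ext_inside norm_minus_commute ennreal_leI)
        also have "\<dots> = (\<integral>\<^sup>+Q. ennreal (norm (f x - avg f Q)) * indicator (dilate 2 Q) y \<partial>count_space V)"
        proof -
          have "y \<notin> dilate 2 Q" if "Q \<in> V" "Q \<notin> near y" for Q
            using that V W3_W2 unfolding near_def by blast
          then have "(\<integral>\<^sup>+Q. ennreal (norm (f x - avg f Q)) * indicator (dilate 2 Q) y \<partial>count_space V)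
              = (\<Sum>Q\<in>near y. ennreal (norm (f x - avg f Q)) * indicator (dilate 2 Q) y)"
            by (intro nn_integral_count_space' finite_near nV) simp
          also have "\<dots> = (\<Sum>Q\<in>near y. ennreal (norm (f x - avg f Q)))"
            using nearD(2) by (intro sum.cong) auto
          finally show ?thesis by simp
        qed
        finally show ?thesis using yt by (simp add: add_increasing)
      qed
    qed simp
  qed
  also have "\<dots> = osc \<Omega> f x ?r
      + (\<integral>\<^sup>+y. (\<integral>\<^sup>+Q. ennreal (norm (f x - avg f Q)) * indicator (dilate 2 Q) y \<partial>count_space V) \<partial>lebesgue)"
    unfolding osc_def
  proof (rule nn_integral_add)
    show "(\<lambda>y. ennreal (norm (f x - f y)) * indicator (ball x ?r \<inter> \<Omega>) y) \<in> borel_measurable lebesgue"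
      by measurable
    show "(\<lambda>y. \<integral>\<^sup>+Q. ennreal (norm (f x - avg f Q)) * indicator (dilate 2 Q) y \<partial>count_space V) \<in> borel_measurable lebesgue"
      by (rule borel_measurable_nn_integral_count_space) (simp, measurable)
  qed
  also have "(\<integral>\<^sup>+y. (\<integral>\<^sup>+Q. ennreal (norm (f x - avg f Q)) * indicator (dilate 2 Q) y \<partial>count_space V) \<partial>lebesgue)
      = (\<integral>\<^sup>+Q. (\<integral>\<^sup>+y. ennreal (norm (f x - avg f Q)) * indicator (dilate 2 Q) y \<partial>lebesgue) \<partial>count_space V)"
    by (rule nn_integral_count_space_nn_integral) (simp, measurable)
  also have "\<dots> \<le> (\<integral>\<^sup>+Q. ennreal (2 ^ ?d) * (\<integral>\<^sup>+y\<in>cube (star Q). ennreal (norm (f x - f y)) \<partial>lebesgue) \<partial>count_space V)"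
  proof (intro nn_integral_mono)
    fix Q assume "Q \<in> space (count_space V)"
    then have Q: "Q \<in> W3" using V by auto
    have "(\<integral>\<^sup>+y. ennreal (norm (f x - avg f Q)) * indicator (dilate 2 Q) y \<partial>lebesgue)
        = ennreal (norm (f x - avg f Q)) * emeasure lebesgue (dilate 2 Q)"
      by (rule nn_integral_cmult_indicator) simp
    also have "\<dots> = ennreal (2 ^ ?d) * (ennreal (norm (f x - avg f Q)) * ennreal (side Q ^ ?d))"
      by (simp add: emeasure_dilate power_mult_distrib ennreal_mult mult_ac)
    also have "\<dots> \<le> ennreal (2 ^ ?d) * (\<integral>\<^sup>+y\<in>cube (star Q). ennreal (norm (f x - f y)) \<partial>lebesgue)"
      by (rule mult_left_mono[OF avg_diff_le[OF f Q]]) simp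
    finally show "(\<integral>\<^sup>+y. ennreal (norm (f x - avg f Q)) * indicator (dilate 2 Q) y \<partial>lebesgue)
      \<le> ennreal (2 ^ ?d) * (\<integral>\<^sup>+y\<in>cube (star Q). ennreal (norm (f x - f y)) \<partial>lebesgue)" .
  qed
  also have "\<dots> = ennreal (2 ^ ?d) * (\<integral>\<^sup>+Q. (\<integral>\<^sup>+y\<in>cube (star Q). ennreal (norm (f x - f y)) \<partial>lebesgue) \<partial>count_space V)"
    by (rule nn_integral_cmult) simp
  also have "\<dots> \<le> ennreal (2 ^ ?d) * (ennreal (real N') * osc \<Omega> f x ?r)"
    unfolding osc_def
  proof (intro mult_left_mono overlap_sum_le[OF _ V _ Vsub])
    show "(\<lambda>y. ennreal (norm (f x - f y))) \<in> borel_measurable lebesgue" by measurable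
    show "ball x ?r \<inter> \<Omega> \<in> sets borel" by measurable
  qed simp_all
  finally show ?thesis
    by (simp add: distrib_right ennreal_mult mult.assoc add_left_mono)
qed

section \<open>Oscillation around exterior points\<close>

text \<open>Moving from x to y at most halves the distance to the frontier, so a cube active at y
  has side at least dd x / (2 \<kappa>). Then dist x y is below 2/5 of the side, less than the
  margin 9/20 between the support 11/10 Q and 2Q.\<close>

lemma close_near:
  assumes x: "x \<in> G" and y: "dist x y < dd x / (5 * \<kappa>)"
  shows "y \<in> G" and "\<And>Q. Q \<in> W2 \<Longrightarrow> \<psi> Q y \<noteq> 0 \<Longrightarrow> Q \<in> near x"
proof -
  have k: "0 < \<kappa>" using kappa_ge_2 by simp
  have dx: "0 < dd x"
  proof -
    have "0 \<le> dist x y" by simp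
    then have "0 < dd x / (5 * \<kappa>)" using y by linarith
    then show ?thesis using k by (simp add: zero_less_divide_iff)
  qed
  have le: "dd x / (5 * \<kappa>) \<le> dd x / 10" using kappa_ge_2 dx by (intro divide_left_mono) auto
  then show "y \<in> G"
    using ball_infdist_frontier_subset[OF x, of y] y dx by (simp add: dd_def)
  fix Q assume Q: "Q \<in> W2" "\<psi> Q y \<noteq> 0"
  have "dd x \<le> dd y + dist x y" unfolding dd_def by (rule infdist_triangle)
  then have "dd x / 2 \<le> dd y" using le y dx by linarith
  also have "\<dots> \<le> \<kappa> * side Q" using psi_near[OF Q] nearD(6) by blast
  finally have "dd x / (5 * \<kappa>) \<le> 2/5 * side Q" using k by (simp add: field_simps)
  also have "\<dots> < (2 - 11/10) * side Q / 2" using side_pos(1)[of Q] by simp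
  finally have "x \<in> dilate 2 Q"
    using y by (intro dilate_ball[OF psi_support[OF Q]]) (simp add: dist_commute)
  then show "Q \<in> near x" using Q by (simp add: near_def)
qed

lemma psi_diff_sum_le:
  assumes T: "T \<subseteq> near x"
  shows "norm (\<Sum>Q\<in>T. (\<psi> Q x - \<psi> Q y) *\<^sub>R b Q) \<le> M * \<kappa> * dist x y / dd x * (\<Sum>Q\<in>T. norm (b Q))"
  unfolding sum_distrib_left
proof (intro order_trans[OF norm_sum] sum_mono)
  fix Q assume "Q \<in> T"
  then have Q: "Q \<in> near x" using T by blast
  have "0 < dd x" using nearD(5)[OF Q] side_pos(1)[of Q] by linarith
  then have "1 / side Q \<le> \<kappa> / dd x" using nearD(6)[OF Q] kappa_ge_2 by (simp add: field_simps)
  then have "M * (1 / side Q) * dist x y \<le> M * (\<kappa> / dd x) * dist x y"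
    using M_nonneg by (intro mult_right_mono mult_left_mono) auto
  then have "\<bar>\<psi> Q x - \<psi> Q y\<bar> \<le> M * \<kappa> * dist x y / dd x"
    using psi_lipschitz[OF nearD(1)[OF Q], of x y] by simp
  then show "norm ((\<psi> Q x - \<psi> Q y) *\<^sub>R b Q) \<le> M * \<kappa> * dist x y / dd x * norm (b Q)"
    unfolding norm_scaleR real_norm_def by (rule mult_right_mono) simp
qed

text \<open>Used with c = f \<xi> close to the frontier and with c = 0 elsewhere. Bounded overlap
  makes a plain sum as good as a maximum.\<close>

definition "avg_diff_sum f x c = (\<Sum>Q\<in>near x \<inter> W3. norm (avg f Q - c))"

lemma avg_diff_sum_nonneg: "0 \<le> avg_diff_sum f x c"
  by (simp add: avg_diff_sum_def sum_nonneg)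

lemma norm_ext_diff_le:
  assumes "x \<in> G" "c = 0 \<or> near x \<subseteq> W3"
  shows "norm (ext f x - c) \<le> avg_diff_sum f x c"
  using assms W3_W2 psi_near
  by (subst ext_outside_diff[of x "near x \<inter> W3"]) (auto simp: avg_diff_sum_def intro!: norm_psi_sum_le)

lemma dd_pos: "x \<in> G \<Longrightarrow> 0 < dd x"
proof -
  assume "x \<in> G"
  then obtain Q where "Q \<in> W2" "x \<in> closure (cube Q)" using whitney_const_D(3)[OF W2] by blast
  then have "Q \<in> near x" using closure_cube_subset[of 2 Q] by (auto simp: near_def)
  then show ?thesis using nearD(5)[of Q x] side_pos(1)[of Q] by linarith
qed

text \<open>On so small a ball both values of \<open>ext f\<close> are sums over the same finite set
  of cubes. Their difference is therefore controlled by the increments of the functions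
  \<open>\<psi> Q\<close>, after c has been subtracted from every average.\<close>

lemma osc_ext_small:
  assumes x: "x \<in> G" and c: "c = 0 \<or> near x \<subseteq> W3" and t: "0 < t" "t \<le> dd x / (5 * \<kappa>)"
  shows "osc UNIV (ext f) x t \<le> ennreal (\<omega> * t ^ CARD('d)) * ennreal (M * \<kappa> * t / dd x * avg_diff_sum f x c)"
  unfolding \<omega>_def
proof (rule osc_le_const)
  fix y assume y: "y \<in> ball x t"
  then have cl: "dist x y < dd x / (5 * \<kappa>)" using t by simp
  let ?T = "near x \<inter> W3"
  have "ext f x - c = (\<Sum>Q\<in>?T. \<psi> Q x *\<^sub>R (avg f Q - c))"
    using x c psi_near W3_W2 by (intro ext_outside_diff) auto
  moreover have "ext f y - c = (\<Sum>Q\<in>?T. \<psi> Q y *\<^sub>R (avg f Q - c))"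
    using close_near[OF x cl] c W3_W2 by (intro ext_outside_diff) auto
  moreover have "ext f x - ext f y = (ext f x - c) - (ext f y - c)" by simp
  ultimately have "norm (ext f x - ext f y) = norm (\<Sum>Q\<in>?T. (\<psi> Q x - \<psi> Q y) *\<^sub>R (avg f Q - c))"
    by (simp only: scaleR_left_diff_distrib sum_subtractf)
  also have "\<dots> \<le> M * \<kappa> * dist x y / dd x * avg_diff_sum f x c"
    unfolding avg_diff_sum_def by (rule psi_diff_sum_le) simp
  also have "\<dots> \<le> M * \<kappa> * t / dd x * avg_diff_sum f x c"
    using y M_nonneg kappa_ge_2 dd_pos[OF x] avg_diff_sum_nonneg
    by (intro mult_right_mono divide_right_mono mult_left_mono) auto
  finally show "norm (ext f x - ext f y) \<le> M * \<kappa> * t / dd x * avg_diff_sum f x c" .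
qed (use t in simp)

text \<open>At every point only finitely many terms are nonzero, so the partial sums along an
  enumeration of the cubes are eventually constant.\<close>

lemma ext_measurable [measurable]:
  assumes [measurable]: "f \<in> borel_measurable lebesgue"
  shows "ext f \<in> borel_measurable lebesgue"
proof -
  define F where "F n = {Q \<in> W3. to_nat Q < n}" for n :: nat
  have fin: "finite (F n)" for n
    by (rule finite_subset[of _ "to_nat -` {..<n}"]) (auto simp: F_def intro!: finite_vimageI)
  have [measurable]: "\<psi> Q \<in> borel_measurable lebesgue" if "Q \<in> W3" for Q
  proof -
    have "\<bar>\<psi> Q x - \<psi> Q y\<bar> \<le> M / side Q * dist x y" for x y using psi_lipschitz W3_W2[OF that] by blast
    then have "continuous_on UNIV (\<psi> Q)"
      using M_nonneg by (intro lipschitz_on_continuous_on[of "M / side Q"] lipschitz_onI) (auto simp: dist_real_def)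
    then show ?thesis by (intro measurable_completion) (simp add: borel_measurable_continuous_onI)
  qed
  have meas: "(\<lambda>x. indicator \<Omega> x *\<^sub>R f x + (\<Sum>Q\<in>F n. \<psi> Q x *\<^sub>R avg f Q)) \<in> borel_measurable lebesgue" for n
  proof (intro borel_measurable_add borel_measurable_sum)
    fix Q assume "Q \<in> F n"
    then have [measurable]: "\<psi> Q \<in> borel_measurable lebesgue" by (simp add: F_def)
    show "(\<lambda>x. \<psi> Q x *\<^sub>R avg f Q) \<in> borel_measurable lebesgue" by measurable
  qed measurable
  show ?thesis
  proof (rule borel_measurable_LIMSEQ_metric[OF meas])
    fix x
    show "(\<lambda>n. indicator \<Omega> x *\<^sub>R f x + (\<Sum>Q\<in>F n. \<psi> Q x *\<^sub>R avg f Q)) \<longlonglongrightarrow> ext f x"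
    proof (rule tendsto_eventually)
      have "eventually (\<lambda>n. \<forall>Q\<in>near x. to_nat Q < n) sequentially"
        by (subst eventually_ball_finite_distrib) (auto intro: eventually_gt_at_top)
      then show "\<forall>\<^sub>F n in sequentially. indicator \<Omega> x *\<^sub>R f x + (\<Sum>Q\<in>F n. \<psi> Q x *\<^sub>R avg f Q) = ext f x"
      proof eventually_elim
        case (elim n)
        have "Q \<in> F n" if "Q \<in> W3" "\<psi> Q x \<noteq> 0" for Q
          using psi_near[OF W3_W2[OF that(1)] that(2)] elim that by (auto simp: F_def)
        then have "ext f x = indicator \<Omega> x *\<^sub>R f x + (\<Sum>Q\<in>F n. \<psi> Q x *\<^sub>R avg f Q)"
          by (intro ext_eq fin) (auto simp: F_def)
        then show ?case by simp
      qed
    qed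
  qed
qed

text \<open>Insert \<open>f \<xi>\<close> between the two values. The change from x to \<xi> costs a
  constant on the ball; the rest is the oscillation at \<xi>, a point of the domain, where
  \<open>osc_ext_inside\<close> applies.\<close>

lemma osc_ext_near_large:
  assumes f: "f \<in> borel_measurable lebesgue"
    and x: "x \<in> G" "dd x \<le> l" and \<xi>: "\<xi> \<in> \<Omega>" and t: "0 < t"
  shows "osc UNIV (ext f) x t \<le> ennreal (\<omega> * t ^ CARD('d)) * ennreal (avg_diff_sum f x (f \<xi>))
    + osc UNIV (ext f) \<xi> (t + dist x \<xi>)"
proof -
  have [measurable]: "ext f \<in> borel_measurable lebesgue" using f by measurable
  have "norm (ext f x - f \<xi>) \<le> avg_diff_sum f x (f \<xi>)"
    using near_W3[OF x] by (intro norm_ext_diff_le x) blast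
  then have le: "norm (ext f x - ext f y) \<le> avg_diff_sum f x (f \<xi>) + norm (ext f \<xi> - ext f y)" for y
    using norm_triangle_ineq[of "ext f x - f \<xi>" "f \<xi> - ext f y"] by (simp add: ext_inside[OF \<xi>])
  have "osc UNIV (ext f) x t \<le> (\<integral>\<^sup>+y. ennreal (avg_diff_sum f x (f \<xi>)) * indicator (ball x t) y
      + ennreal (norm (ext f \<xi> - ext f y)) * indicator (ball \<xi> (t + dist x \<xi>) \<inter> UNIV) y \<partial>lebesgue)"
    unfolding osc_def
  proof (intro nn_integral_mono)
    fix y
    have "y \<in> ball \<xi> (t + dist x \<xi>)" if "y \<in> ball x t"
      using that dist_triangle[of \<xi> y x] by (simp add: dist_commute)
    then show "ennreal (norm (ext f x - ext f y)) * indicator (ball x t \<inter> UNIV) y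
      \<le> ennreal (avg_diff_sum f x (f \<xi>)) * indicator (ball x t) y
      + ennreal (norm (ext f \<xi> - ext f y)) * indicator (ball \<xi> (t + dist x \<xi>) \<inter> UNIV) y"
      using ennreal_leI[OF le[of y]] avg_diff_sum_nonneg
      by (auto simp: indicator_def ennreal_plus[symmetric] simp del: ennreal_plus)
  qed
  also have "\<dots> = ennreal (avg_diff_sum f x (f \<xi>)) * emeasure lebesgue (ball x t)
      + osc UNIV (ext f) \<xi> (t + dist x \<xi>)"
    unfolding osc_def by (subst nn_integral_add) (auto simp: nn_integral_cmult_indicator)
  finally show ?thesis using t emeasure_ball_lebesgue[of t x] by (simp add: \<omega>_def mult.commute)
qed

text \<open>Every symmetrized cube involved lies within 2 (2 d + L) dd x of \<xi>: once from \<xi>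
  to x, once from x to the cube. Its volume is comparable to dd x^d, which stays on the left to
  avoid dividing.\<close>

lemma avg_diff_sum_le:
  assumes f: "admissible f" and x: "x \<in> G" "dd x \<le> l" and \<xi>: "\<xi> \<in> \<Omega>" "dist x \<xi> \<le> (2 * rdim + L) * dd x"
  shows "ennreal (avg_diff_sum f x (f \<xi>)) * ennreal (dd x ^ CARD('d))
    \<le> ennreal (real N * \<kappa> ^ CARD('d)) * osc \<Omega> f \<xi> ((4 * rdim + 2 * L) * dd x)"
proof -
  let ?d = "CARD('d)" and ?O = "osc \<Omega> f \<xi> ((4 * rdim + 2 * L) * dd x)"
  have T: "near x \<subseteq> W3" by (rule near_W3[OF x])
  have each: "ennreal (norm (avg f Q - f \<xi>)) * ennreal (dd x ^ ?d) \<le> ennreal (\<kappa> ^ ?d) * ?O"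
    if Q: "Q \<in> near x" for Q
  proof -
    have sub: "cube (star Q) \<subseteq> ball \<xi> ((4 * rdim + 2 * L) * dd x) \<inter> \<Omega>"
    proof
      fix \<eta> assume \<eta>: "\<eta> \<in> cube (star Q)"
      have "dist x \<eta> \<le> (2 * rdim + L) * side Q"
        using star_dist[OF _ nearD(2)[OF Q] \<eta>] T Q by blast
      also have "\<dots> < (2 * rdim + L) * dd x"
        using nearD(5)[OF Q] rdim_ge_1 L_nonneg by (intro mult_strict_left_mono) auto
      finally have "dist \<xi> \<eta> < (2 * rdim + L) * dd x + (2 * rdim + L) * dd x"
        using \<xi>(2) dist_triangle[of \<xi> \<eta> x] dist_commute[of \<xi> x] by linarith
      then show "\<eta> \<in> ball \<xi> ((4 * rdim + 2 * L) * dd x) \<inter> \<Omega>"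
        using star_subset[of Q] T Q \<eta> by (auto simp: algebra_simps)
    qed
    have "dd x ^ ?d \<le> (\<kappa> * side Q) ^ ?d"
      using nearD(6)[OF Q] dd_pos[OF x(1)] by (intro power_mono) auto
    then have "ennreal (norm (avg f Q - f \<xi>)) * ennreal (dd x ^ ?d)
        \<le> ennreal (norm (avg f Q - f \<xi>)) * ennreal ((\<kappa> * side Q) ^ ?d)"
      by (intro mult_left_mono ennreal_leI) auto
    also have "\<dots> = ennreal (\<kappa> ^ ?d) * (ennreal (norm (f \<xi> - avg f Q)) * ennreal (side Q ^ ?d))"
      using kappa_ge_2 by (simp add: power_mult_distrib ennreal_mult norm_minus_commute mult_ac)
    also have "\<dots> \<le> ennreal (\<kappa> ^ ?d) * (\<integral>\<^sup>+y\<in>cube (star Q). ennreal (norm (f \<xi> - f y)) \<partial>lebesgue)"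
      using T Q by (intro mult_left_mono avg_diff_le f) auto
    also have "\<dots> \<le> ennreal (\<kappa> ^ ?d) * ?O"
      unfolding osc_def using sub by (intro mult_left_mono nn_integral_mono) (auto simp: indicator_def)
    finally show ?thesis .
  qed
  have "ennreal (avg_diff_sum f x (f \<xi>)) * ennreal (dd x ^ ?d)
      = (\<Sum>Q\<in>near x \<inter> W3. ennreal (norm (avg f Q - f \<xi>)) * ennreal (dd x ^ ?d))"
    by (simp add: avg_diff_sum_def sum_distrib_right flip: sum_ennreal)
  also have "\<dots> \<le> of_nat (card (near x \<inter> W3)) * (ennreal (\<kappa> ^ ?d) * ?O)"
    using each by (intro sum_bounded_above) auto
  also have "\<dots> \<le> ennreal (real N) * (ennreal (\<kappa> ^ ?d) * ?O)"
    using T card_near[of x] unfolding Int_absorb2[OF T] by (intro mult_right_mono) (auto simp: ennreal_of_nat_eq_real_of_nat intro!: ennreal_leI)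
  finally show ?thesis using kappa_ge_2 by (simp add: ennreal_mult mult.assoc)
qed

end

section \<open>Bounds at a point\<close>

text \<open>The common shape of all pointwise estimates: a Lipschitz profile at scale D, a dilated
  oscillation on radii below \<rho>0, and a profile at scale 1 that absorbs the remaining radii. K
  precedes h, \<phi>, a, b and D, hence is uniform in the function and the point.\<close>

lemma scale_norm_three_terms:
  assumes p: "1 \<le> p" and q: "1 \<le> q" and s: "0 < s" "s < 1" and d: "0 \<le> d"
    and c: "0 < c" "c * \<rho>0 \<le> R" and k: "0 \<le> k"
  shows "\<exists>K\<ge>0. \<forall>h \<phi> a b D. 0 < D \<longrightarrow> \<phi> \<in> borel_measurable borel \<longrightarrow>
    (\<forall>t. 0 < t \<longrightarrow> t < 1 \<longrightarrow> h t \<le> a * ennreal (scale_model s d D t)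
       + (ennreal k * (if t < \<rho>0 then \<phi> (c * t) else 0) + b * ennreal (scale_model s d 1 t))) \<longrightarrow>
    scale_norm s d 1 p q h \<le> ennreal K * (epowr a p + scale_norm s d R p q \<phi> + epowr b p)"
proof -
  obtain K0 where K0: "\<And>D. 0 < D \<Longrightarrow>
      scale_norm s d 1 p q (\<lambda>t. ennreal (scale_model s d D t)) \<le> ennreal K0"
    using scale_norm_model_le[OF p q s, of d 1] by blast
  define K1 where "K1 = max 0 K0 + k powr p * c powr ((s + d) * p)"
  define K where "K = 4 powr p * 4 powr p * K1"
  have K1: "0 \<le> K1" "K0 \<le> K1" "k powr p * c powr ((s + d) * p) \<le> K1"
  proof -
    have "0 \<le> k powr p * c powr ((s + d) * p)" by simp
    then show "0 \<le> K1" "K0 \<le> K1" "k powr p * c powr ((s + d) * p) \<le> K1"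
      unfolding K1_def by linarith+
  qed
  have "scale_norm s d 1 p q h \<le> ennreal K * (epowr a p + scale_norm s d R p q \<phi> + epowr b p)"
    if D: "0 < D" and [measurable]: "\<phi> \<in> borel_measurable borel"
      and h: "\<And>t. 0 < t \<Longrightarrow> t < 1 \<Longrightarrow> h t \<le> a * ennreal (scale_model s d D t)
       + (ennreal k * (if t < \<rho>0 then \<phi> (c * t) else 0) + b * ennreal (scale_model s d 1 t))"
    for h \<phi> a b and D :: real
  proof -
    let ?m = "\<lambda>D t. ennreal (scale_model s d D t)"
    let ?\<phi> = "\<lambda>t. if t < \<rho>0 then \<phi> (c * t) else 0"
    let ?S = "scale_norm s d 1 p q"
    have "?S h \<le> ?S (\<lambda>t. a * ?m D t + (ennreal k * ?\<phi> t + b * ?m 1 t))"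
      using p h by (intro scale_norm_mono) auto
    also have "\<dots> \<le> ennreal (4 powr p) * (?S (\<lambda>t. a * ?m D t) + ?S (\<lambda>t. ennreal k * ?\<phi> t + b * ?m 1 t))"
      by (rule scale_norm_add_le[OF p q]) measurable
    also have "\<dots> \<le> ennreal (4 powr p) * (?S (\<lambda>t. a * ?m D t) +
        ennreal (4 powr p) * (?S (\<lambda>t. ennreal k * ?\<phi> t) + ?S (\<lambda>t. b * ?m 1 t)))"
      by (intro mult_left_mono add_left_mono scale_norm_add_le[OF p q]) (measurable, auto)
    also have "\<dots> \<le> ennreal (4 powr p) * (ennreal (4 powr p) * ?S (\<lambda>t. a * ?m D t) +
        ennreal (4 powr p) * (?S (\<lambda>t. ennreal k * ?\<phi> t) + ?S (\<lambda>t. b * ?m 1 t)))"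
    proof (intro mult_left_mono add_right_mono)
      have "1 \<le> (4::real) powr p" using p by (intro ge_one_powr_ge_zero) auto
      then have "1 * x \<le> ennreal (4 powr p) * x" for x
        by (intro mult_right_mono) (auto simp flip: ennreal_1 intro!: ennreal_leI)
      then show "?S (\<lambda>t. a * ?m D t) \<le> ennreal (4 powr p) * ?S (\<lambda>t. a * ?m D t)" by simp
    qed simp
    also have "\<dots> = ennreal (4 powr p * 4 powr p) *
        (?S (\<lambda>t. a * ?m D t) + ?S (\<lambda>t. ennreal k * ?\<phi> t) + ?S (\<lambda>t. b * ?m 1 t))"
      by (simp add: ennreal_mult distrib_left mult.assoc add.assoc)
    also have "\<dots> \<le> ennreal (4 powr p * 4 powr p) *
        (ennreal K1 * epowr a p + ennreal K1 * scale_norm s d R p q \<phi> + ennreal K1 * epowr b p)"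
    proof (intro mult_left_mono add_mono)
      have m: "?S (?m D) \<le> ennreal K1" if "0 < D" for D
        using K0[OF that] K1 by (meson ennreal_leI order_trans)
      have "?S (\<lambda>t. a * ?m D t) = epowr a p * ?S (?m D)"
        by (rule scale_norm_cmult[OF p q]) measurable
      also have "\<dots> \<le> epowr a p * ennreal K1" by (intro mult_left_mono m D) auto
      finally show "?S (\<lambda>t. a * ?m D t) \<le> ennreal K1 * epowr a p" by (simp add: mult.commute)
      have "?S (\<lambda>t. b * ?m 1 t) = epowr b p * ?S (?m 1)"
        by (rule scale_norm_cmult[OF p q]) measurable
      also have "\<dots> \<le> epowr b p * ennreal K1" by (intro mult_left_mono m) auto
      finally show "?S (\<lambda>t. b * ?m 1 t) \<le> ennreal K1 * epowr b p" by (simp add: mult.commute)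
      have "?S (\<lambda>t. ennreal k * ?\<phi> t) = epowr (ennreal k) p * ?S ?\<phi>"
        by (rule scale_norm_cmult[OF p q]) measurable
      also have "\<dots> \<le> epowr (ennreal k) p * (ennreal (c powr ((s + d) * p)) * scale_norm s d R p q \<phi>)"
        using s d c by (intro mult_left_mono scale_norm_dilation[OF p q]) auto
      also have "\<dots> = ennreal (k powr p * c powr ((s + d) * p)) * scale_norm s d R p q \<phi>"
        using k by (simp add: epowr_ennreal ennreal_mult mult.assoc)
      also have "\<dots> \<le> ennreal K1 * scale_norm s d R p q \<phi>"
        using K1 by (intro mult_right_mono ennreal_leI) auto
      finally show "?S (\<lambda>t. ennreal k * ?\<phi> t) \<le> ennreal K1 * scale_norm s d R p q \<phi>" .
    qed simp
    also have "\<dots> = ennreal K * (epowr a p + scale_norm s d R p q \<phi> + epowr b p)"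
      using K1 by (simp add: K_def ennreal_mult distrib_left mult.assoc)
    finally show ?thesis .
  qed
  moreover have "0 \<le> K" using K1 by (simp add: K_def)
  ultimately show ?thesis by blast
qed

section \<open>Radii bounded below: the cost in the L^p norm\<close>

abbreviation lp_mass :: "real \<Rightarrow> (real^'d) set \<Rightarrow> (real^'d \<Rightarrow> complex) \<Rightarrow> ennreal" where
  "lp_mass p U f \<equiv> \<integral>\<^sup>+x\<in>U. ennreal (norm (f x) powr p) \<partial>lebesgue"

text \<open>A majorant, independent of t, of the oscillation of g at all radii t \<le> 1. Its p-th
  power has integral at most a constant times that of |g|^p.\<close>

definition unit_mass :: "(real^'d \<Rightarrow> complex) \<Rightarrow> real^'d \<Rightarrow> ennreal" where
  "unit_mass g x = ennreal (unit_ball_vol (real CARD('d))) * ennreal (norm (g x))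
     + (\<integral>\<^sup>+y\<in>ball x 1. ennreal (norm (g y)) \<partial>lebesgue)"

lemma osc_le_unit_mass:
  fixes g :: "real^'d \<Rightarrow> complex"
  assumes [measurable]: "g \<in> borel_measurable lebesgue" and t: "t \<le> 1"
  shows "osc UNIV g x t \<le> unit_mass g x"
proof -
  have "osc UNIV g x t \<le> (\<integral>\<^sup>+y. ennreal (norm (g x)) * indicator (ball x 1) y
      + ennreal (norm (g y)) * indicator (ball x 1) y \<partial>lebesgue)"
    unfolding osc_def
  proof (intro nn_integral_mono)
    fix y
    have "ennreal (norm (g x - g y)) \<le> ennreal (norm (g x)) + ennreal (norm (g y))"
      using ennreal_leI[OF norm_triangle_ineq4[of "g x" "g y"]] by simp
    then show "ennreal (norm (g x - g y)) * indicator (ball x t \<inter> UNIV) y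
        \<le> ennreal (norm (g x)) * indicator (ball x 1) y + ennreal (norm (g y)) * indicator (ball x 1) y"
      using t by (auto simp: indicator_def)
  qed
  also have "\<dots> = ennreal (norm (g x)) * emeasure lebesgue (ball x 1)
      + (\<integral>\<^sup>+y\<in>ball x 1. ennreal (norm (g y)) \<partial>lebesgue)"
    by (subst nn_integral_add) (auto simp: nn_integral_cmult_indicator)
  finally show ?thesis using emeasure_ball_lebesgue[of 1 x] by (simp add: unit_mass_def mult.commute)
qed

lemma epowr_unit_mass_le:
  fixes g :: "real^'d \<Rightarrow> complex"
  assumes [measurable]: "g \<in> borel_measurable lebesgue" and p: "1 \<le> p"
  defines "\<omega> \<equiv> unit_ball_vol (real CARD('d))"
  shows "epowr (unit_mass g x) p \<le> ennreal (2 powr p) * (ennreal (\<omega> powr p) * ennreal (norm (g x) powr p)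
    + ennreal (\<omega> powr (p - 1)) * (lp_mass p (ball x 1) g))"
proof -
  have \<omega>: "0 < \<omega>" by (simp add: \<omega>_def)
  have "epowr (unit_mass g x) p \<le> ennreal (2 powr p) * (epowr (ennreal \<omega> * ennreal (norm (g x))) p
      + epowr (\<integral>\<^sup>+y\<in>ball x 1. ennreal (norm (g y)) \<partial>lebesgue) p)"
    unfolding unit_mass_def \<omega>_def[symmetric] using p by (intro epowr_add_le) auto
  also have "\<dots> \<le> ennreal (2 powr p) * (ennreal (\<omega> powr p) * ennreal (norm (g x) powr p)
    + ennreal (\<omega> powr (p - 1)) * (lp_mass p (ball x 1) g))"
  proof (intro mult_left_mono add_mono)
    show "epowr (ennreal \<omega> * ennreal (norm (g x))) p \<le> ennreal (\<omega> powr p) * ennreal (norm (g x) powr p)"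
      using p \<omega> by (simp add: epowr_mult epowr_ennreal)
    show "epowr (\<integral>\<^sup>+y\<in>ball x 1. ennreal (norm (g y)) \<partial>lebesgue) p
      \<le> ennreal (\<omega> powr (p - 1)) * (lp_mass p (ball x 1) g)"
      using p \<omega> emeasure_ball_lebesgue[of 1 x] by (intro epowr_set_nn_integral_le) (auto simp: \<omega>_def)
  qed simp
  finally show ?thesis .
qed

text \<open>By Tonelli's theorem, as each y belongs to the unit balls about a set of centres of
  measure \<omega>.\<close>

lemma nn_integral_ball_average:
  fixes u :: "real^'d \<Rightarrow> ennreal"
  assumes [measurable]: "u \<in> borel_measurable lebesgue"
  shows "(\<lambda>x. \<integral>\<^sup>+y\<in>ball x 1. u y \<partial>lebesgue) \<in> borel_measurable lebesgue"
    and "(\<integral>\<^sup>+x. (\<integral>\<^sup>+y\<in>ball x 1. u y \<partial>lebesgue) \<partial>lebesgue)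
      = ennreal (unit_ball_vol (real CARD('d))) * (\<integral>\<^sup>+y. u y \<partial>lebesgue)"
proof -
  interpret pair_sigma_finite "lebesgue :: (real^'d) measure" "lebesgue :: (real^'d) measure"
    by (rule pair_sigma_finite_lebesgue)
  have [measurable]: "(\<lambda>w. fst w) \<in> lebesgue \<Otimes>\<^sub>M lebesgue \<rightarrow>\<^sub>M (borel :: (real^'d) measure)"
    "(\<lambda>w. snd w) \<in> lebesgue \<Otimes>\<^sub>M lebesgue \<rightarrow>\<^sub>M (borel :: (real^'d) measure)"
    by (auto intro: measurable_compose[OF _ lebesgue_lborel_sets])
  have m: "(\<lambda>(x, y). u y * (if dist x y < 1 then 1 else 0)) \<in> borel_measurable (lebesgue \<Otimes>\<^sub>M lebesgue)"
    unfolding split_beta by measurable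
  have eq: "(\<integral>\<^sup>+y\<in>ball x 1. u y \<partial>lebesgue) = (\<integral>\<^sup>+y. u y * (if dist x y < 1 then 1 else 0) \<partial>lebesgue)" for x
    by (intro nn_integral_cong) (auto simp: indicator_def)
  show "(\<lambda>x. \<integral>\<^sup>+y\<in>ball x 1. u y \<partial>lebesgue) \<in> borel_measurable lebesgue"
    unfolding eq using m by (rule lebesgue.borel_measurable_nn_integral)
  have "(\<integral>\<^sup>+x. (\<integral>\<^sup>+y\<in>ball x 1. u y \<partial>lebesgue) \<partial>lebesgue)
      = (\<integral>\<^sup>+y. (\<integral>\<^sup>+x. u y * (if dist x y < 1 then 1 else 0) \<partial>lebesgue) \<partial>lebesgue)"
    unfolding eq using m by (intro Fubini'[symmetric])
  also have "\<dots> = (\<integral>\<^sup>+y. ennreal (unit_ball_vol (real CARD('d))) * u y \<partial>lebesgue)"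
  proof (intro nn_integral_cong)
    fix y :: "real^'d"
    have "(\<integral>\<^sup>+x. u y * (if dist x y < 1 then 1 else 0) \<partial>lebesgue) = (\<integral>\<^sup>+x. u y * indicator (ball y 1) x \<partial>lebesgue)"
      by (intro nn_integral_cong) (auto simp: indicator_def dist_commute)
    also have "\<dots> = u y * emeasure lebesgue (ball y 1)" by (rule nn_integral_cmult_indicator) simp
    finally show "(\<integral>\<^sup>+x. u y * (if dist x y < 1 then 1 else 0) \<partial>lebesgue) = ennreal (unit_ball_vol (real CARD('d))) * u y"
      using emeasure_ball_lebesgue[of 1 y] by (simp add: mult.commute)
  qed
  also have "\<dots> = ennreal (unit_ball_vol (real CARD('d))) * (\<integral>\<^sup>+y. u y \<partial>lebesgue)"
    by (rule nn_integral_cmult) measurable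
  finally show "(\<integral>\<^sup>+x. (\<integral>\<^sup>+y\<in>ball x 1. u y \<partial>lebesgue) \<partial>lebesgue)
      = ennreal (unit_ball_vol (real CARD('d))) * (\<integral>\<^sup>+y. u y \<partial>lebesgue)" .
qed

lemma ennreal_mult_mult_le:
  assumes "a * b \<le> K" "0 \<le> a" "0 \<le> b"
  shows "ennreal a * (ennreal b * x) \<le> ennreal K * x"
proof -
  have "ennreal a * (ennreal b * x) = ennreal (a * b) * x" using assms by (simp add: ennreal_mult mult.assoc)
  also have "\<dots> \<le> ennreal K * x" using assms by (intro mult_right_mono ennreal_leI) auto
  finally show ?thesis .
qed

section \<open>The three pointwise bounds\<close>

context whitney_extension
begin

abbreviation "dom_norm s p q R f x \<equiv> scale_norm s rdim R p q (osc \<Omega> f x)"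
abbreviation "ext_norm s p q f x \<equiv> scale_norm s rdim 1 p q (osc UNIV (ext f) x)"
abbreviation "mass p f x \<equiv> epowr (unit_mass (ext f) x) p"
abbreviation "avg_sum f x \<equiv> avg_diff_sum f x 0"

text \<open>The cases are points of the domain, exterior points at distance at least \<rho>1 and
  exterior points closer than that. K and \<rho>1 depend neither on f nor on the points; the last
  bound holds for each \<xi> separately, which is what the later averaging over \<xi> uses.\<close>

lemma pointwise_bounds:
  assumes p: "1 \<le> p" and q: "1 \<le> q" and s: "0 < s" "s < 1" and R: "0 < R"
  obtains K :: real and \<rho>1 :: real where "0 \<le> K" "0 < \<rho>1" "\<rho>1 \<le> l"
    "\<And>f x. admissible f \<Longrightarrow> x \<in> \<Omega> \<Longrightarrow> ext_norm s p q f x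
       \<le> ennreal K * (dom_norm s p q R f x + mass p f x)"
    "\<And>f x. admissible f \<Longrightarrow> x \<in> G \<Longrightarrow> \<rho>1 \<le> dd x \<Longrightarrow> ext_norm s p q f x
       \<le> ennreal K * (epowr (ennreal (avg_sum f x)) p + mass p f x)"
    "\<And>f x \<xi>. admissible f \<Longrightarrow> x \<in> G \<Longrightarrow> dd x < \<rho>1 \<Longrightarrow> \<xi> \<in> \<Omega> \<Longrightarrow> dist x \<xi> \<le> (2 * rdim + L) * dd x \<Longrightarrow>
       ext_norm s p q f x
       \<le> ennreal K * (dom_norm s p q R f \<xi> + mass p f x)"
proof -
  let ?d = "CARD('d)"
  \<comment> \<open>\<open>l1\<close> is the dilation in \<open>osc_ext_inside\<close>; by
    \<open>l2\<close>, a ball of radius t > dd x / (5 \<kappa>) about x fits into the ball of radius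
    l2 * t about \<xi>; \<open>C'\<close> is the dilation in \<open>avg_diff_sum_le\<close>.\<close>
  define l1 where "l1 = 1 + 2 * rdim + L"
  define l2 where "l2 = 1 + 5 * \<kappa> * (2 * rdim + L)"
  define C' where "C' = 4 * rdim + 2 * L"
  have k: "2 \<le> \<kappa>" "0 < \<kappa>" using kappa_ge_2 by auto
  have pos: "1 \<le> l1" "1 \<le> l2" "1 \<le> C'" "0 \<le> rdim"
    using rdim_ge_1 L_nonneg k by (auto simp: l1_def l2_def C'_def)
  \<comment> \<open>Chosen so that for t < \<rho>0 the radius l2 * t stays below l, as
    \<open>osc_ext_inside\<close> demands, and l1 * l2 * t below R.\<close>
  define \<rho>0 where "\<rho>0 = min l (R / l1) / l2"
  \<comment> \<open>The bound l gives all cubes near x a symmetrized one; the other bound leaves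
    room for the doubled radius 2 * C' * dd x \<le> R in \<open>scale_norm_ge_point\<close>.\<close>
  define \<rho>1 where "\<rho>1 = min l (R / (2 * C'))"
  have \<rho>0: "0 < \<rho>0" "l2 * \<rho>0 \<le> l" "l1 * l2 * \<rho>0 \<le> R" "\<rho>0 \<le> l" "l1 * \<rho>0 \<le> R"
  proof -
    show "0 < \<rho>0" using l_pos R pos by (simp add: \<rho>0_def)
    have eq: "l2 * \<rho>0 = min l (R / l1)" using pos by (simp add: \<rho>0_def)
    show a: "l2 * \<rho>0 \<le> l" unfolding eq by simp
    have "l1 * (l2 * \<rho>0) \<le> l1 * (R / l1)" unfolding eq using pos by (intro mult_left_mono) auto
    then show b: "l1 * l2 * \<rho>0 \<le> R" using pos by (simp add: mult.assoc)
    have le: "\<rho>0 \<le> l2 * \<rho>0" using \<open>0 < \<rho>0\<close> pos by simp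
    then show "\<rho>0 \<le> l" using a by linarith
    have "l1 * \<rho>0 \<le> l1 * (l2 * \<rho>0)" using le pos by (intro mult_left_mono) auto
    then show "l1 * \<rho>0 \<le> R" using b by (simp add: mult.assoc)
  qed
  have \<rho>1: "0 < \<rho>1" "\<rho>1 \<le> l" "2 * (C' * \<rho>1) \<le> R"
  proof -
    show "0 < \<rho>1" "\<rho>1 \<le> l" using l_pos R pos by (auto simp: \<rho>1_def)
    have "2 * C' * \<rho>1 \<le> 2 * C' * (R / (2 * C'))" using pos by (intro mult_left_mono) (auto simp: \<rho>1_def)
    then show "2 * (C' * \<rho>1) \<le> R" using pos by simp
  qed
  define k1 where "k1 = 1 + 2 ^ ?d * real N'"
  have k1: "0 \<le> k1" by (simp add: k1_def)
  obtain Ka where Ka: "0 \<le> Ka" "\<And>h \<phi> a b D. 0 < D \<Longrightarrow> \<phi> \<in> borel_measurable borel \<Longrightarrow>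
    (\<And>t. 0 < t \<Longrightarrow> t < 1 \<Longrightarrow> h t \<le> a * ennreal (scale_model s rdim D t)
       + (ennreal k1 * (if t < \<rho>0 then \<phi> (l1 * t) else 0) + b * ennreal (scale_model s rdim 1 t))) \<Longrightarrow>
    scale_norm s rdim 1 p q h \<le> ennreal Ka * (epowr a p + scale_norm s rdim R p q \<phi> + epowr b p)"
    using scale_norm_three_terms[OF p q s, of rdim l1 \<rho>0 R k1] pos \<rho>0 k1 by auto
  obtain Kb where Kb: "0 \<le> Kb" "\<And>h \<phi> a b D. 0 < D \<Longrightarrow> \<phi> \<in> borel_measurable borel \<Longrightarrow>
    (\<And>t. 0 < t \<Longrightarrow> t < 1 \<Longrightarrow> h t \<le> a * ennreal (scale_model s rdim D t)
       + (ennreal k1 * (if t < \<rho>0 then \<phi> (l1 * l2 * t) else 0) + b * ennreal (scale_model s rdim 1 t))) \<Longrightarrow>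
    scale_norm s rdim 1 p q h \<le> ennreal Kb * (epowr a p + scale_norm s rdim R p q \<phi> + epowr b p)"
    using scale_norm_three_terms[OF p q s, of rdim "l1 * l2" \<rho>0 R k1] pos \<rho>0 k1 by auto
  \<comment> \<open>For r \<le> t < 1 the profile at scale 1 equals t^(d+1) and is at least r^(d+1).
    So large radii fit the third term of \<open>scale_norm_three_terms\<close>, with a multiple of
    \<open>unit_mass\<close> as coefficient.\<close>
  have crude: "osc UNIV (ext f) x t \<le> ennreal (r powr (- rdim - 1)) * unit_mass (ext f) x
       * ennreal (scale_model s rdim 1 t)"
    if f: "admissible f" and t: "0 < r" "r \<le> t" "t < 1" for f x r t
  proof -
    have [measurable]: "ext f \<in> borel_measurable lebesgue"
      using f by (intro ext_measurable) (simp add: admissible_def)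
    have "1 = r powr (- rdim - 1) * r powr (rdim + 1)" using t by (simp flip: powr_add)
    also have "\<dots> \<le> r powr (- rdim - 1) * t powr (rdim + 1)"
      using t pos by (intro mult_left_mono powr_mono2) auto
    also have "t powr (rdim + 1) = scale_model s rdim 1 t"
      using t by (simp add: powr_add)
    finally have "1 \<le> ennreal (r powr (- rdim - 1)) * ennreal (scale_model s rdim 1 t)"
      using t by (simp flip: ennreal_mult ennreal_1 del: ennreal_1)
    then have "unit_mass (ext f) x * 1 \<le> unit_mass (ext f) x *
      (ennreal (r powr (- rdim - 1)) * ennreal (scale_model s rdim 1 t))"
      by (intro mult_left_mono) auto
    then show ?thesis
      using osc_le_unit_mass[of "ext f" t x] t by (auto simp: mult_ac intro: order_trans)
  qed
  have meas: "osc \<Omega> f x \<in> borel_measurable borel" if "admissible f" for f x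
    using that by (intro osc_measurable) (auto simp: admissible_def)
  define e0 where "e0 = \<rho>0 powr (- rdim - 1)"
  have e0: "0 \<le> e0" by (simp add: e0_def)
  have inside: "ext_norm s p q f x
       \<le> ennreal Ka * (epowr 0 p + dom_norm s p q R f x + epowr (ennreal e0 * unit_mass (ext f) x) p)"
    if f: "admissible f" and x: "x \<in> \<Omega>" for f x
  proof (rule Ka(2)[of 1])
    fix t :: real assume t: "0 < t" "t < 1"
    show "osc UNIV (ext f) x t \<le> 0 * ennreal (scale_model s rdim 1 t)
       + (ennreal k1 * (if t < \<rho>0 then osc \<Omega> f x (l1 * t) else 0)
         + ennreal e0 * unit_mass (ext f) x * ennreal (scale_model s rdim 1 t))"
    proof (cases "t < \<rho>0")
      case True
      then show ?thesis
        using osc_ext_inside[OF f x t(1)] \<rho>0 by (simp add: l1_def k1_def add_increasing2)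
    next
      case False
      then show ?thesis using crude[OF f, of \<rho>0 t x] \<rho>0 t by (simp add: e0_def)
    qed
  qed (use meas f in auto)
  define r1 where "r1 = \<rho>1 / (5 * \<kappa>)"
  have r1: "0 < r1" using \<rho>1 k by (simp add: r1_def)
  define e1 where "e1 = r1 powr (- rdim - 1)"
  \<comment> \<open>As dd x \<ge> \<rho>1, the factor t / dd x is at most t / \<rho>1. The profile
    at scale 1 suffices, and the averages appear without a negative power of dd x.\<close>
  define k2 where "k2 = \<omega> * (M * \<kappa> / \<rho>1)"
  have k2: "0 \<le> k2" using M_nonneg k \<rho>1 omega_pos by (simp add: k2_def)
  have far: "ext_norm s p q f x
       \<le> ennreal Ka * (epowr (ennreal k2 * ennreal (avg_sum f x)) p + scale_norm s rdim R p q (\<lambda>_. 0)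
           + epowr (ennreal e1 * unit_mass (ext f) x) p)"
    if f: "admissible f" and x: "x \<in> G" "\<rho>1 \<le> dd x" for f x
  proof (rule Ka(2)[of 1])
    fix t :: real assume t: "0 < t" "t < 1"
    show "osc UNIV (ext f) x t \<le> ennreal k2 * ennreal (avg_sum f x) * ennreal (scale_model s rdim 1 t)
       + (ennreal k1 * (if t < \<rho>0 then 0 else 0)
         + ennreal e1 * unit_mass (ext f) x * ennreal (scale_model s rdim 1 t))"
    proof (cases "t < r1")
      case True
      have "r1 \<le> dd x / (5 * \<kappa>)" unfolding r1_def using x k by (intro divide_right_mono) auto
      then have "osc UNIV (ext f) x t \<le> ennreal (\<omega> * t ^ ?d) * ennreal (M * \<kappa> * t / dd x * avg_sum f x)"
        using True t x by (intro osc_ext_small) auto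
      also have "\<dots> = ennreal (\<omega> * t ^ ?d * (M * \<kappa> * t / dd x * avg_sum f x))"
        using omega_pos t M_nonneg k dd_pos[OF x(1)] avg_diff_sum_nonneg by (intro ennreal_mult[symmetric]) auto
      also have "\<dots> \<le> ennreal (\<omega> * t ^ ?d * (M * \<kappa> * t / \<rho>1 * avg_sum f x))"
        using omega_pos t M_nonneg k x \<rho>1 avg_diff_sum_nonneg
        by (intro ennreal_leI mult_left_mono mult_right_mono divide_left_mono mult_pos_pos) auto
      also have "\<omega> * t ^ ?d * (M * \<kappa> * t / \<rho>1 * avg_sum f x)
          = k2 * avg_sum f x * (scale_model s rdim 1 t)"
        using t by (simp add: k2_def rdim_def powr_realpow)
      also have "ennreal \<dots> = ennreal k2 * ennreal (avg_sum f x) * ennreal (scale_model s rdim 1 t)"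
        using k2 t avg_diff_sum_nonneg by (simp add: ennreal_mult)
      finally show ?thesis by (simp add: add_increasing2)
    next
      case False
      then show ?thesis
        using crude[OF f, of r1 t x] r1 t by (simp add: e1_def add_increasing)
    qed
  qed auto
  \<comment> \<open>M serves the radii up to dd x / (5 \<kappa>), where the Lipschitz bound holds; 5
    serves the larger ones, where 5 * \<kappa> * min (t / dd x) 1 \<ge> 1.\<close>
  define k3 where "k3 = \<omega> * \<kappa> * (M + 5)"
  have k3: "0 \<le> k3" using omega_pos k M_nonneg by (simp add: k3_def)
  have near: "ext_norm s p q f x
       \<le> ennreal Kb * (epowr (ennreal (k3 * avg_diff_sum f x (f \<xi>) * dd x powr - s)) p
           + dom_norm s p q R f \<xi> + epowr (ennreal e0 * unit_mass (ext f) x) p)"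
    if f: "admissible f" and x: "x \<in> G" "dd x < \<rho>1" and \<xi>: "\<xi> \<in> \<Omega>" "dist x \<xi> \<le> (2 * rdim + L) * dd x"
    for f x \<xi>
  proof (rule Kb(2))
    show D: "0 < dd x" by (rule dd_pos[OF x(1)])
    have Dl: "dd x \<le> l" using x \<rho>1 by simp
    have fm: "f \<in> borel_measurable lebesgue" using f by (simp add: admissible_def)
    let ?V = "avg_diff_sum f x (f \<xi>)"
    have V: "0 \<le> ?V" by (rule avg_diff_sum_nonneg)
    fix t :: real assume t: "0 < t" "t < 1"
    have conv: "ennreal (\<omega> * t ^ ?d * (\<kappa> * (M + 5) * min (t / dd x) 1 * ?V))
        = ennreal (k3 * ?V * dd x powr - s) * ennreal (scale_model s rdim (dd x) t)"
    proof -
      have "dd x powr - s * dd x powr s = 1" using D by (simp flip: powr_add)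
      then have eq: "\<omega> * t ^ ?d * (\<kappa> * (M + 5) * min (t / dd x) 1 * ?V)
          = (k3 * ?V * dd x powr - s) * (scale_model s rdim (dd x) t)"
        using t by (simp add: k3_def rdim_def powr_realpow)
      show ?thesis unfolding eq using k3 V t D by (intro ennreal_mult mult_nonneg_nonneg) auto
    qed
    show "osc UNIV (ext f) x t
       \<le> ennreal (k3 * ?V * dd x powr - s) * ennreal (scale_model s rdim (dd x) t)
       + (ennreal k1 * (if t < \<rho>0 then osc \<Omega> f \<xi> (l1 * l2 * t) else 0)
         + ennreal e0 * unit_mass (ext f) x * ennreal (scale_model s rdim 1 t))"
    proof (cases "t < \<rho>0")
      case t0: True
      show ?thesis
      proof (cases "t \<le> dd x / (5 * \<kappa>)")
        case True
        have "osc UNIV (ext f) x t \<le> ennreal (\<omega> * t ^ ?d) * ennreal (M * \<kappa> * t / dd x * ?V)"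
          using near_W3[OF x(1) Dl] by (intro osc_ext_small x t True) blast
        also have "\<dots> = ennreal (\<omega> * t ^ ?d * (M * \<kappa> * t / dd x * ?V))"
          using omega_pos t M_nonneg k D V by (intro ennreal_mult[symmetric]) auto
        also have "\<dots> \<le> ennreal (\<omega> * t ^ ?d * (\<kappa> * (M + 5) * min (t / dd x) 1 * ?V))"
        proof (intro ennreal_leI mult_left_mono mult_right_mono V)
          have "dd x / (5 * \<kappa>) \<le> dd x / 1" using D k by (intro divide_left_mono) auto
          then have "min (t / dd x) 1 = t / dd x" using True D by (simp add: min_def)
          moreover have "M * \<kappa> * (t / dd x) \<le> \<kappa> * (M + 5) * (t / dd x)"
            using t D k by (intro mult_right_mono) (auto simp: algebra_simps)
          ultimately show "M * \<kappa> * t / dd x \<le> \<kappa> * (M + 5) * min (t / dd x) 1" by simp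
        qed (use omega_pos t in auto)
        finally show ?thesis unfolding conv by (simp add: add_increasing2)
      next
        case False
        then have tD: "dd x < 5 * \<kappa> * t" using k by (simp add: field_simps)
        have "dist x \<xi> \<le> (2 * rdim + L) * (5 * \<kappa> * t)"
          using \<xi>(2) tD rdim_ge_1 L_nonneg by (elim order_trans) (intro mult_left_mono; simp)
        then have le2: "t + dist x \<xi> \<le> l2 * t" by (simp add: l2_def algebra_simps)
        have "l2 * t \<le> l2 * \<rho>0" using t0 pos by (intro mult_left_mono) auto
        then have l2t: "0 < l2 * t" "l2 * t \<le> l" using pos t \<rho>0 by (simp, linarith)
        have "osc UNIV (ext f) x t \<le> ennreal (\<omega> * t ^ ?d) * ennreal ?V + osc UNIV (ext f) \<xi> (t + dist x \<xi>)"
          by (rule osc_ext_near_large[OF fm x(1) Dl \<xi>(1) t(1)])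
        also have "\<dots> \<le> ennreal (k3 * ?V * dd x powr - s) * ennreal (scale_model s rdim (dd x) t)
            + ennreal k1 * osc \<Omega> f \<xi> (l1 * l2 * t)"
        proof (intro add_mono)
          have "1 \<le> \<kappa> * (M + 5) * min (t / dd x) 1"
          proof -
            have "1 / (5 * \<kappa>) \<le> min (t / dd x) 1" using tD D k by (simp add: field_simps)
            then have "\<kappa> * 5 * (1 / (5 * \<kappa>)) \<le> \<kappa> * (M + 5) * min (t / dd x) 1"
              using k M_nonneg by (intro mult_mono) auto
            then show ?thesis using k by simp
          qed
          then have "1 * ?V \<le> \<kappa> * (M + 5) * min (t / dd x) 1 * ?V" using V by (intro mult_right_mono)
          then have "ennreal (\<omega> * t ^ ?d * ?V) \<le> ennreal (\<omega> * t ^ ?d * (\<kappa> * (M + 5) * min (t / dd x) 1 * ?V))"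
            using omega_pos t by (intro ennreal_leI mult_left_mono) auto
          then show "ennreal (\<omega> * t ^ ?d) * ennreal ?V
             \<le> ennreal (k3 * ?V * dd x powr - s) * ennreal (scale_model s rdim (dd x) t)"
            unfolding conv[symmetric] using omega_pos t V by (simp add: ennreal_mult)
          have "osc UNIV (ext f) \<xi> (t + dist x \<xi>) \<le> osc UNIV (ext f) \<xi> (l2 * t)"
            using le2 by (rule osc_mono)
          also have "\<dots> \<le> ennreal k1 * osc \<Omega> f \<xi> (l1 * l2 * t)"
            using osc_ext_inside[OF f \<xi>(1) l2t] by (simp add: k1_def l1_def mult.assoc)
          finally show "osc UNIV (ext f) \<xi> (t + dist x \<xi>) \<le> ennreal k1 * osc \<Omega> f \<xi> (l1 * l2 * t)" .
        qed
        finally show ?thesis using t0 by (simp add: add_increasing2 add.assoc[symmetric])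
      qed
    next
      case False
      then show ?thesis using crude[OF f, of \<rho>0 t x] \<rho>0 t by (simp add: e0_def add_increasing)
    qed
  qed (use meas f in auto)
  \<comment> \<open>Its factors are \<open>k3\<close>, the constant of
    \<open>avg_diff_sum_le\<close>, the change of weight from dd x to C' * dd x, and the loss in
    \<open>scale_norm_ge_point\<close>.\<close>
  define K4 where "K4 = (k3 * (real N * \<kappa> ^ ?d) * C' powr (s + rdim)) powr p * 2 powr ((s + rdim + 1) * p)"
  have V_le: "epowr (ennreal (k3 * avg_diff_sum f x (f \<xi>) * dd x powr - s)) p
      \<le> ennreal K4 * dom_norm s p q R f \<xi>"
    if f: "admissible f" and x: "x \<in> G" "dd x < \<rho>1" and \<xi>: "\<xi> \<in> \<Omega>" "dist x \<xi> \<le> (2 * rdim + L) * dd x"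
    for f x \<xi>
  proof -
    have D: "0 < dd x" by (rule dd_pos[OF x(1)])
    have Dl: "dd x \<le> l" using x \<rho>1 by simp
    let ?V = "avg_diff_sum f x (f \<xi>)" and ?O = "osc \<Omega> f \<xi> (C' * dd x)"
    have V: "0 \<le> ?V" by (rule avg_diff_sum_nonneg)
    \<comment> \<open>The factor dd x^d is the volume that \<open>avg_diff_sum_le\<close> carries;
      what remains is the weight s + d of the inner norm at a radius comparable to dd x.\<close>
    have "dd x powr - s = dd x ^ ?d * dd x powr (- s - rdim)"
      using D by (simp add: rdim_def powr_diff powr_realpow)
    then have "ennreal (k3 * ?V * dd x powr - s)
        = ennreal k3 * ennreal (dd x powr (- s - rdim)) * (ennreal ?V * ennreal (dd x ^ ?d))"
      using k3 V D by (simp add: mult_ac flip: ennreal_mult)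
    also have "\<dots> \<le> ennreal k3 * ennreal (dd x powr (- s - rdim)) * (ennreal (real N * \<kappa> ^ ?d) * ?O)"
      using avg_diff_sum_le[OF f x(1) Dl \<xi>] by (intro mult_left_mono) (auto simp: C'_def)
    also have "\<dots> = ennreal (k3 * (real N * \<kappa> ^ ?d) * C' powr (s + rdim)) * (ennreal ((C' * dd x) powr (- s - rdim)) * ?O)"
    proof -
      have "C' powr (s + rdim) * C' powr (- s - rdim) = 1" using pos by (simp flip: powr_add)
      then have "dd x powr (- s - rdim) = C' powr (s + rdim) * (C' * dd x) powr (- s - rdim)"
        using pos D by (simp add: powr_mult)
      then show ?thesis
        using k3 k by (simp add: ennreal_mult mult_ac)
    qed
    finally have "epowr (ennreal (k3 * ?V * dd x powr - s)) p
      \<le> epowr (ennreal (k3 * (real N * \<kappa> ^ ?d) * C' powr (s + rdim)) * (ennreal ((C' * dd x) powr (- s - rdim)) * ?O)) p"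
      using p by (intro epowr_mono) auto
    also have "\<dots> = ennreal ((k3 * (real N * \<kappa> ^ ?d) * C' powr (s + rdim)) powr p)
        * epowr (ennreal ((C' * dd x) powr (- s - rdim)) * ?O) p"
      using p k3 k by (subst epowr_mult) (auto simp: epowr_ennreal)
    also have "\<dots> \<le> ennreal ((k3 * (real N * \<kappa> ^ ?d) * C' powr (s + rdim)) powr p)
        * (ennreal (2 powr ((s + rdim + 1) * p)) * dom_norm s p q R f \<xi>)"
    proof (intro mult_left_mono scale_norm_ge_point[OF p q] osc_mono)
      show "0 < C' * dd x" using pos D by simp
      have "C' * dd x \<le> C' * \<rho>1" using x pos by (intro mult_left_mono) auto
      then show "2 * (C' * dd x) \<le> R" using \<rho>1 by linarith
    qed (use s pos in auto)
    finally show ?thesis by (simp add: K4_def ennreal_mult mult.assoc)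
  qed
  define E where "E = max 1 (max (e0 powr p) (e1 powr p))"
  define K where "K = Ka * (E + k2 powr p) + Kb * (K4 + 1 + E)"
  have K4: "0 \<le> K4" by (simp add: K4_def)
  have E: "1 \<le> E" "e0 powr p \<le> E" "e1 powr p \<le> E" by (auto simp: E_def)
  have KE: "Ka * E \<le> K" "Ka * k2 powr p \<le> K" "Kb * (K4 + 1) \<le> K" "Kb * E \<le> K"
  proof -
    have eq: "K = Ka * E + Ka * k2 powr p + Kb * (K4 + 1) + Kb * E"
      by (simp add: K_def algebra_simps)
    have "0 \<le> Ka * E" "0 \<le> Ka * k2 powr p" "0 \<le> Kb * (K4 + 1)" "0 \<le> Kb * E"
      using K4 E Ka(1) Kb(1) by auto
    then show "Ka * E \<le> K" "Ka * k2 powr p \<le> K" "Kb * (K4 + 1) \<le> K" "Kb * E \<le> K"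
      unfolding eq by linarith+
  qed
  have E0: "Ka * e0 powr p \<le> Ka * E" "Ka * e1 powr p \<le> Ka * E" "Kb * e0 powr p \<le> Kb * E" "Ka * 1 \<le> Ka * E"
    using E Ka(1) Kb(1) by (intro mult_left_mono; simp)+
  note simps = epowr_mult epowr_ennreal distrib_left
  show thesis
  proof (rule that)
    have "0 \<le> Ka * E" using E Ka(1) by simp
    then show "0 \<le> K" using KE by linarith
    show "0 < \<rho>1" "\<rho>1 \<le> l" by fact+
  next
    fix f :: "real^'d \<Rightarrow> complex" and x assume f: "admissible f" and x: "x \<in> \<Omega>"
    note inside[OF f x]
    also have "ennreal Ka * (epowr 0 p + dom_norm s p q R f x + epowr (ennreal e0 * unit_mass (ext f) x) p)
        = ennreal Ka * (ennreal 1 * dom_norm s p q R f x) + ennreal Ka * (ennreal (e0 powr p) * mass p f x)"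
      using p e0 by (simp add: simps)
    also have "\<dots> \<le> ennreal K * dom_norm s p q R f x + ennreal K * mass p f x"
      using KE E0 Ka(1) by (intro add_mono ennreal_mult_mult_le) auto
    finally show "ext_norm s p q f x \<le> ennreal K * (dom_norm s p q R f x + mass p f x)"
      by (simp add: distrib_left)
  next
    fix f :: "real^'d \<Rightarrow> complex" and x assume f: "admissible f" and x: "x \<in> G" "\<rho>1 \<le> dd x"
    have z: "scale_norm s rdim R p q (\<lambda>_. 0) = 0"
      by (auto simp: scale_norm_def SUP_constant bot_ennreal)
    note far[OF f x]
    also have "ennreal Ka * (epowr (ennreal k2 * ennreal (avg_sum f x)) p + scale_norm s rdim R p q (\<lambda>_. 0)
           + epowr (ennreal e1 * unit_mass (ext f) x) p)
        = ennreal Ka * (ennreal (k2 powr p) * epowr (ennreal (avg_sum f x)) p) + ennreal Ka * (ennreal (e1 powr p) * mass p f x)"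
      using p k2 by (simp add: z simps e1_def)
    also have "\<dots> \<le> ennreal K * epowr (ennreal (avg_sum f x)) p + ennreal K * mass p f x"
      using KE E0 Ka(1) by (intro add_mono ennreal_mult_mult_le) auto
    finally show "ext_norm s p q f x \<le> ennreal K * (epowr (ennreal (avg_sum f x)) p + mass p f x)"
      by (simp add: distrib_left)
  next
    fix f :: "real^'d \<Rightarrow> complex" and x \<xi> assume f: "admissible f" and x: "x \<in> G" "dd x < \<rho>1"
      and \<xi>: "\<xi> \<in> \<Omega>" "dist x \<xi> \<le> (2 * rdim + L) * dd x"
    note near[OF f x \<xi>]
    also have "ennreal Kb * (epowr (ennreal (k3 * avg_diff_sum f x (f \<xi>) * dd x powr - s)) p
           + dom_norm s p q R f \<xi> + epowr (ennreal e0 * unit_mass (ext f) x) p)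
        \<le> ennreal Kb * (ennreal K4 * dom_norm s p q R f \<xi> + dom_norm s p q R f \<xi> + epowr (ennreal e0 * unit_mass (ext f) x) p)"
      by (intro mult_left_mono add_right_mono V_le f x \<xi>) auto
    also have "\<dots> = ennreal Kb * (ennreal (K4 + 1) * dom_norm s p q R f \<xi>) + ennreal Kb * (ennreal (e0 powr p) * mass p f x)"
      using p e0 K4 by (simp add: simps distrib_right)
    also have "\<dots> \<le> ennreal K * dom_norm s p q R f \<xi> + ennreal K * mass p f x"
      using KE E0 Kb(1) K4 by (intro add_mono ennreal_mult_mult_le) auto
    finally show "ext_norm s p q f x \<le> ennreal K * (dom_norm s p q R f \<xi> + mass p f x)"
      by (simp add: distrib_left)
  qed
qed

end

section \<open>Integration\<close>

context whitney_extension
begin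

text \<open>A sum over the cubes of \<open>near x \<inter> W3\<close>, written with indicators so
  that it can be integrated in x cube by cube.\<close>

definition "avg_power_sum f p x =
  (\<integral>\<^sup>+Q. ennreal (norm (avg f Q) powr p) * indicator (dilate 2 Q) x \<partial>count_space W3)"

lemma avg_power_sum_measurable [measurable]: "avg_power_sum f p \<in> borel_measurable lebesgue"
  unfolding avg_power_sum_def
  by (rule borel_measurable_nn_integral_count_space) (simp, measurable)

lemma avg_sum_power_le:
  assumes p: "1 \<le> p"
  shows "epowr (ennreal (avg_sum f x)) p \<le> ennreal (real N powr p) * avg_power_sum f p x"
proof -
  let ?T = "near x \<inter> W3"
  have "epowr (ennreal (avg_sum f x)) p = epowr (\<Sum>Q\<in>?T. ennreal (norm (avg f Q))) p"
    by (simp add: avg_diff_sum_def)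
  also have "\<dots> \<le> ennreal (real (card ?T) powr p) * (\<Sum>Q\<in>?T. epowr (ennreal (norm (avg f Q))) p)"
    using p by (intro epowr_sum_le) auto
  also have "(\<Sum>Q\<in>?T. epowr (ennreal (norm (avg f Q))) p) = avg_power_sum f p x"
  proof -
    have "y \<notin> dilate 2 Q" if "Q \<in> W3" "Q \<notin> near y \<inter> W3" for Q y
      using that W3_W2 unfolding near_def by blast
    then have "avg_power_sum f p x = (\<Sum>Q\<in>?T. ennreal (norm (avg f Q) powr p) * indicator (dilate 2 Q) x)"
      unfolding avg_power_sum_def by (intro nn_integral_count_space') auto
    also have "\<dots> = (\<Sum>Q\<in>?T. epowr (ennreal (norm (avg f Q))) p)"
      using nearD(2) by (intro sum.cong) (auto simp: epowr_ennreal)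
    finally show ?thesis by simp
  qed
  also have "ennreal (real (card ?T) powr p) * avg_power_sum f p x \<le> ennreal (real N powr p) * avg_power_sum f p x"
  proof (intro mult_right_mono ennreal_leI powr_mono2)
    have "card ?T \<le> card (near x)" by (intro card_mono) auto
    then show "real (card ?T) \<le> real N" using card_near[of x] by linarith
  qed (use p in auto)
  finally show ?thesis .
qed

lemma emeasure_cube_star:
  "Q \<in> W3 \<Longrightarrow> emeasure lebesgue (cube (star Q)) = ennreal (side Q ^ CARD('d))"
  by (simp add: emeasure_cube side_star)

text \<open>By Jensen's inequality |avg|^p times the volume of Q is at most the integral of |f|^p
  over the symmetrized cube, which has the same volume. The double of Q contributes 2^d, bounded
  overlap the rest.\<close>

lemma nn_integral_avg_power_sum_le:
  assumes f: "admissible f" and p: "1 \<le> p"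
  shows "(\<integral>\<^sup>+x. avg_power_sum f p x \<partial>lebesgue)
    \<le> ennreal (2 ^ CARD('d) * real N') * (lp_mass p \<Omega> f)"
proof -
  let ?d = "CARD('d)"
  have [measurable]: "f \<in> borel_measurable lebesgue" using f by (simp add: admissible_def)
  have "(\<integral>\<^sup>+x. avg_power_sum f p x \<partial>lebesgue)
      = (\<integral>\<^sup>+Q. (\<integral>\<^sup>+x. ennreal (norm (avg f Q) powr p) * indicator (dilate 2 Q) x \<partial>lebesgue) \<partial>count_space W3)"
    unfolding avg_power_sum_def by (rule nn_integral_count_space_nn_integral) (simp, measurable)
  also have "\<dots> \<le> (\<integral>\<^sup>+Q. ennreal (2 ^ ?d) * (lp_mass p (cube (star Q)) f) \<partial>count_space W3)"
  proof (intro nn_integral_mono)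
    fix Q assume "Q \<in> space (count_space W3)"
    then have Q: "Q \<in> W3" by simp
    define m where "m = side Q ^ ?d"
    have m: "0 < m" by (simp add: m_def)
    let ?I = "lp_mass p (cube (star Q)) f"
    have "ennreal (norm (avg f Q)) * ennreal m \<le> (\<integral>\<^sup>+y\<in>cube (star Q). ennreal (norm (f y)) \<partial>lebesgue)"
      using avg_diff_le[OF f Q, of 0] by (simp add: m_def)
    then have "epowr (ennreal (norm (avg f Q)) * ennreal m) p \<le> epowr (\<integral>\<^sup>+y\<in>cube (star Q). ennreal (norm (f y)) \<partial>lebesgue) p"
      using p by (intro epowr_mono) auto
    also have "\<dots> \<le> ennreal (m powr (p - 1)) * ?I"
      using p m emeasure_cube_star[OF Q] by (intro epowr_set_nn_integral_le) (auto simp: m_def)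
    finally have le: "ennreal (norm (avg f Q) powr p) * ennreal (m powr p) \<le> ennreal (m powr (p - 1)) * ?I"
      using p m by (simp add: epowr_mult epowr_ennreal)
    have "ennreal (norm (avg f Q) powr p) * ennreal m
        = ennreal (m powr (1 - p)) * (ennreal (norm (avg f Q) powr p) * ennreal (m powr p))"
      using m by (simp add: powr_diff mult_ac flip: ennreal_mult)
    also have "\<dots> \<le> ennreal (m powr (1 - p)) * (ennreal (m powr (p - 1)) * ?I)"
      using le by (intro mult_left_mono) auto
    also have "\<dots> = ?I"
    proof -
      have "m powr (1 - p) * m powr (p - 1) = 1" using m by (simp flip: powr_add)
      then show ?thesis by (simp add: mult.assoc[symmetric] flip: ennreal_mult)
    qed
    finally have "ennreal (norm (avg f Q) powr p) * ennreal m \<le> ?I" .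
    then have "ennreal (2 ^ ?d) * (ennreal (norm (avg f Q) powr p) * ennreal m) \<le> ennreal (2 ^ ?d) * ?I"
      by (intro mult_left_mono) auto
    moreover have "(\<integral>\<^sup>+x. ennreal (norm (avg f Q) powr p) * indicator (dilate 2 Q) x \<partial>lebesgue)
        = ennreal (norm (avg f Q) powr p) * emeasure lebesgue (dilate 2 Q)"
      by (rule nn_integral_cmult_indicator) simp
    moreover have "emeasure lebesgue (dilate 2 Q) = ennreal (2 ^ ?d) * ennreal m"
      by (simp add: emeasure_dilate power_mult_distrib ennreal_mult m_def)
    ultimately show "(\<integral>\<^sup>+x. ennreal (norm (avg f Q) powr p) * indicator (dilate 2 Q) x \<partial>lebesgue) \<le> ennreal (2 ^ ?d) * ?I"
      by (simp add: mult_ac)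
  qed
  also have "\<dots> = ennreal (2 ^ ?d) * (\<integral>\<^sup>+Q. (lp_mass p (cube (star Q)) f) \<partial>count_space W3)"
    by (rule nn_integral_cmult) simp
  also have "\<dots> \<le> ennreal (2 ^ ?d) * (ennreal (real N') * (lp_mass p \<Omega> f))"
  proof (intro mult_left_mono overlap_sum_le)
    show "(\<lambda>y. ennreal (norm (f y) powr p)) \<in> borel_measurable lebesgue" by measurable
  qed (use star_subset in auto)
  finally show ?thesis by (simp add: ennreal_mult mult.assoc)
qed

lemma nn_integral_ext_power_le:
  assumes f: "admissible f" and p: "1 \<le> p"
  shows "(\<integral>\<^sup>+x. ennreal (norm (ext f x) powr p) \<partial>lebesgue)
    \<le> ennreal (1 + real N powr p * (2 ^ CARD('d) * real N')) * (lp_mass p \<Omega> f)"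
proof -
  let ?X = "lp_mass p \<Omega> f"
  have [measurable]: "f \<in> borel_measurable lebesgue" using f by (simp add: admissible_def)
  have "(\<integral>\<^sup>+x. ennreal (norm (ext f x) powr p) \<partial>lebesgue)
     \<le> (\<integral>\<^sup>+x. ennreal (norm (f x) powr p) * indicator \<Omega> x + ennreal (real N powr p) * avg_power_sum f p x \<partial>lebesgue)"
  proof (intro nn_integral_mono_AE, use AE_frontier in eventually_elim)
    fix x assume x: "x \<notin> frontier \<Omega>"
    show "ennreal (norm (ext f x) powr p)
      \<le> ennreal (norm (f x) powr p) * indicator \<Omega> x + ennreal (real N powr p) * avg_power_sum f p x"
    proof (cases "x \<in> \<Omega>")
      case True
      then show ?thesis by (simp add: ext_inside)
    next
      case False
      then have "x \<in> G" using not_frontier_cases[OF x] by blast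
      then have "ennreal (norm (ext f x) powr p) \<le> ennreal (avg_sum f x powr p)"
        using p norm_ext_diff_le[of x 0 f] by (intro ennreal_leI powr_mono2) auto
      also have "\<dots> = epowr (ennreal (avg_sum f x)) p" using avg_diff_sum_nonneg by (simp add: epowr_ennreal)
      also have "\<dots> \<le> ennreal (real N powr p) * avg_power_sum f p x" by (rule avg_sum_power_le[OF p])
      finally show ?thesis by (simp add: add_increasing)
    qed
  qed
  also have "\<dots> = ?X + ennreal (real N powr p) * (\<integral>\<^sup>+x. avg_power_sum f p x \<partial>lebesgue)"
    by (subst nn_integral_add) (auto simp: nn_integral_cmult)
  also have "\<dots> \<le> ?X + ennreal (real N powr p) * (ennreal (2 ^ CARD('d) * real N') * ?X)"
    by (intro add_left_mono mult_left_mono nn_integral_avg_power_sum_le[OF f p]) auto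
  finally show ?thesis by (simp add: ennreal_mult distrib_right mult.assoc)
qed

lemma osc_measurable_dom:
  assumes "admissible f" "0 < s"
  shows "(\<lambda>x. dom_norm s p q R f x) \<in> borel_measurable lebesgue"
  using assms rdim_ge_1 by (intro scale_norm_osc_measurable) (auto simp: admissible_def)

text \<open>Near the frontier the bound at x holds for every \<xi> in the symmetrized cube while its
  left side does not depend on \<xi>, so it may be averaged in \<xi>. The averages, constant on each
  doubled cube, are then integrated in x, where the volumes cancel and bounded overlap
  applies.\<close>

lemma seminorm_integral_bound:
  assumes p: "1 \<le> p" and q: "1 \<le> q" and s: "0 < s" "s < 1" and R: "0 < R"
  shows "\<exists>K::real. \<forall>f. admissible f \<longrightarrow>
    (\<integral>\<^sup>+x. ext_norm s p q f x \<partial>lebesgue)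
    \<le> ennreal K * ((\<integral>\<^sup>+x\<in>\<Omega>. dom_norm s p q R f x \<partial>lebesgue)
        + (lp_mass p \<Omega> f))"
proof -
  let ?d = "CARD('d)"
  obtain K :: real and \<rho>1 :: real where K: "0 \<le> K" and \<rho>1: "0 < \<rho>1" "\<rho>1 \<le> l"
    and inside: "\<And>f x. admissible f \<Longrightarrow> x \<in> \<Omega> \<Longrightarrow> ext_norm s p q f x
       \<le> ennreal K * (dom_norm s p q R f x + mass p f x)"
    and far: "\<And>f x. admissible f \<Longrightarrow> x \<in> G \<Longrightarrow> \<rho>1 \<le> dd x \<Longrightarrow> ext_norm s p q f x
       \<le> ennreal K * (epowr (ennreal (avg_sum f x)) p + mass p f x)"
    and near: "\<And>f x \<xi>. admissible f \<Longrightarrow> x \<in> G \<Longrightarrow> dd x < \<rho>1 \<Longrightarrow> \<xi> \<in> \<Omega> \<Longrightarrow> dist x \<xi> \<le> (2 * rdim + L) * dd x \<Longrightarrow>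
       ext_norm s p q f x
       \<le> ennreal K * (dom_norm s p q R f \<xi> + mass p f x)"
    by (rule pointwise_bounds[OF p q s R]) (rule that; assumption)
  define KN where "KN = real N powr p"
  define KE where "KE = 1 + KN * (2 ^ ?d * real N')"
  define KA where "KA = 2 powr p * (\<omega> powr p + \<omega> powr (p - 1) * \<omega>)"
  define KF where "KF = K * (1 + 2 ^ ?d * real N' + KN * (2 ^ ?d * real N') + KA * KE)"
  have nonneg: "0 \<le> KN" "0 \<le> KE" "0 \<le> KA" using omega_pos by (auto simp: KN_def KE_def KA_def)
  have "(\<integral>\<^sup>+x. ext_norm s p q f x \<partial>lebesgue)
    \<le> ennreal KF * ((\<integral>\<^sup>+x\<in>\<Omega>. dom_norm s p q R f x \<partial>lebesgue)
        + (lp_mass p \<Omega> f))"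
    if f: "admissible f" for f
  proof -
    have [measurable]: "f \<in> borel_measurable lebesgue" using f by (simp add: admissible_def)
    define \<Psi> where "\<Psi> x = dom_norm s p q R f x" for x
    have [measurable]: "\<Psi> \<in> borel_measurable lebesgue"
      unfolding \<Psi>_def by (rule osc_measurable_dom[OF f s(1)])
    define X where "X = (lp_mass p \<Omega> f)"
    define Y where "Y = (\<integral>\<^sup>+x\<in>\<Omega>. \<Psi> x \<partial>lebesgue)"
    define J where "J Q = (\<integral>\<^sup>+\<xi>\<in>cube (star Q). \<Psi> \<xi> \<partial>lebesgue)" for Q
    \<comment> \<open>Summing over all cubes whose double contains x replaces a measurable choice of
      one cube for each x.\<close>
    define Z where "Z x = (\<integral>\<^sup>+Q. ennreal (inverse (side Q ^ ?d)) * J Q * indicator (dilate 2 Q) x \<partial>count_space W3)" for x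
    have Zm [measurable]: "Z \<in> borel_measurable lebesgue"
      unfolding Z_def by (rule borel_measurable_nn_integral_count_space) (simp, measurable)
    \<comment> \<open>A measurable majorant of the mass term, with integral at most a constant times
      that of |ext f|^p.\<close>
    define A where "A x = ennreal (2 powr p) * (ennreal (\<omega> powr p) * ennreal (norm (ext f x) powr p)
      + ennreal (\<omega> powr (p - 1)) * (lp_mass p (ball x 1) (ext f)))" for x
    have gm: "(\<lambda>y. ennreal (norm (ext f y) powr p)) \<in> borel_measurable lebesgue" by measurable
    note [measurable] = nn_integral_ball_average(1)[OF gm]
    have Am [measurable]: "A \<in> borel_measurable lebesgue"
      unfolding A_def by measurable
    have A: "mass p f x \<le> A x" for x
      unfolding A_def \<omega>_def using p by (intro epowr_unit_mass_le) measurable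
    have "(\<integral>\<^sup>+x. ext_norm s p q f x \<partial>lebesgue)
      \<le> (\<integral>\<^sup>+x. ennreal K * (\<Psi> x * indicator \<Omega> x + Z x + ennreal KN * avg_power_sum f p x + A x) \<partial>lebesgue)"
    proof (intro nn_integral_mono_AE, use AE_frontier in eventually_elim)
      fix x assume x: "x \<notin> frontier \<Omega>"
      show "ext_norm s p q f x
        \<le> ennreal K * (\<Psi> x * indicator \<Omega> x + Z x + ennreal KN * avg_power_sum f p x + A x)"
      proof (cases "x \<in> \<Omega>")
        case True
        have "ext_norm s p q f x \<le> ennreal K * (\<Psi> x + mass p f x)"
          unfolding \<Psi>_def by (rule inside[OF f True])
        also have "\<dots> \<le> ennreal K * (\<Psi> x * indicator \<Omega> x + Z x + ennreal KN * avg_power_sum f p x + A x)"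
          using True A[of x] by (intro mult_left_mono add_mono) (auto simp: add.assoc)
        finally show ?thesis .
      next
        case False
        then have xG: "x \<in> G" using not_frontier_cases[OF x] by blast
        show ?thesis
        proof (cases "\<rho>1 \<le> dd x")
          case True
          have "ext_norm s p q f x
              \<le> ennreal K * (epowr (ennreal (avg_sum f x)) p + mass p f x)"
            by (rule far[OF f xG True])
          also have "\<dots> \<le> ennreal K * (ennreal KN * avg_power_sum f p x + A x)"
            unfolding KN_def by (intro mult_left_mono add_mono avg_sum_power_le[OF p] A) auto
          also have "\<dots> \<le> ennreal K * (\<Psi> x * indicator \<Omega> x + Z x + ennreal KN * avg_power_sum f p x + A x)"
            by (intro mult_left_mono add_right_mono) (auto simp: add_increasing)
          finally show ?thesis .
        next
          case False
          then have Dx: "dd x < \<rho>1" by simp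
          obtain Q where "Q \<in> W2" "x \<in> closure (cube Q)" using xG whitney_const_D(3)[OF W2] by blast
          then have Qn: "Q \<in> near x" using closure_cube_subset[of 2 Q] by (auto simp: near_def)
          have Q3: "Q \<in> W3" using near_W3[OF xG] Dx \<rho>1 Qn by auto
          define m where "m = side Q ^ ?d"
          have m: "0 < m" by (simp add: m_def)
          let ?S = "ext_norm s p q f x"
          \<comment> \<open>The left side is constant in \<xi>; integrating over the symmetrized
            cube only multiplies it by the volume m.\<close>
          have "?S * ennreal m = (\<integral>\<^sup>+\<xi>\<in>cube (star Q). ?S \<partial>lebesgue)"
            using emeasure_cube_star[OF Q3] by (subst nn_integral_cmult_indicator) (auto simp: m_def)
          also have "\<dots> \<le> (\<integral>\<^sup>+\<xi>. ennreal K * (\<Psi> \<xi> * indicator (cube (star Q)) \<xi> + A x * indicator (cube (star Q)) \<xi>) \<partial>lebesgue)"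
          proof (intro nn_integral_mono)
            fix \<xi>
            show "?S * indicator (cube (star Q)) \<xi>
              \<le> ennreal K * (\<Psi> \<xi> * indicator (cube (star Q)) \<xi> + A x * indicator (cube (star Q)) \<xi>)"
            proof (cases "\<xi> \<in> cube (star Q)")
              case True
              have "dist x \<xi> \<le> (2 * rdim + L) * side Q" by (rule star_dist[OF Q3 nearD(2)[OF Qn] True])
              also have "\<dots> \<le> (2 * rdim + L) * dd x"
                using nearD(5)[OF Qn] rdim_ge_1 L_nonneg by (intro mult_left_mono) auto
              finally have "?S \<le> ennreal K * (\<Psi> \<xi> + mass p f x)"
                unfolding \<Psi>_def using star_subset[OF Q3] True by (intro near[OF f xG Dx]) auto
              also have "\<dots> \<le> ennreal K * (\<Psi> \<xi> + A x)" by (intro mult_left_mono add_left_mono A) auto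
              finally show ?thesis using True by simp
            qed simp
          qed
          also have "\<dots> = ennreal K * (J Q + A x * ennreal m)"
            using emeasure_cube_star[OF Q3]
            by (simp add: J_def m_def nn_integral_cmult nn_integral_add nn_integral_cmult_indicator)
          finally have "?S * ennreal m * ennreal (inverse m) \<le> ennreal K * (J Q + A x * ennreal m) * ennreal (inverse m)"
            by (rule mult_right_mono) simp
          moreover have "y * ennreal m * ennreal (inverse m) = y" for y
            using m by (simp add: mult.assoc flip: ennreal_mult)
          ultimately have "?S \<le> ennreal K * (ennreal (inverse m) * J Q + A x)"
            by (simp add: mult.assoc distrib_right mult.commute[of "J Q"])
          also have "ennreal (inverse m) * J Q \<le> Z x"
          proof -
            have "ennreal (inverse m) * J Q = ennreal (inverse (side Q ^ ?d)) * J Q * indicator (dilate 2 Q) x"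
              using nearD(2)[OF Qn] by (simp add: m_def)
            also have "\<dots> \<le> Z x" unfolding Z_def by (rule nn_integral_ge_point[OF Q3])
            finally show ?thesis .
          qed
          also have "ennreal K * (Z x + A x) \<le> ennreal K * (\<Psi> x * indicator \<Omega> x + Z x + ennreal KN * avg_power_sum f p x + A x)"
            by (intro mult_left_mono add_right_mono) (auto simp: add_increasing add_increasing2)
          finally show ?thesis by (simp add: mult_left_mono add_right_mono)
        qed
      qed
    qed
    also have "\<dots> = ennreal K * (Y + (\<integral>\<^sup>+x. Z x \<partial>lebesgue)
        + ennreal KN * (\<integral>\<^sup>+x. avg_power_sum f p x \<partial>lebesgue) + (\<integral>\<^sup>+x. A x \<partial>lebesgue))"
      by (simp add: Y_def nn_integral_cmult nn_integral_add)
    also have "\<dots> \<le> ennreal K * (Y + ennreal (2 ^ ?d * real N') * Y + ennreal KN * (ennreal (2 ^ ?d * real N') * X) + ennreal KA * (ennreal KE * X))"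
    proof (intro add_mono mult_left_mono order_refl)
      have "(\<integral>\<^sup>+x. Z x \<partial>lebesgue)
          = (\<integral>\<^sup>+Q. (\<integral>\<^sup>+x. ennreal (inverse (side Q ^ ?d)) * J Q * indicator (dilate 2 Q) x \<partial>lebesgue) \<partial>count_space W3)"
        unfolding Z_def by (rule nn_integral_count_space_nn_integral) (simp, measurable)
      also have "\<dots> = (\<integral>\<^sup>+Q. ennreal (2 ^ ?d) * J Q \<partial>count_space W3)"
      proof (intro nn_integral_cong)
        fix Q :: "'d dyadic"
        have "(\<integral>\<^sup>+x. ennreal (inverse (side Q ^ ?d)) * J Q * indicator (dilate 2 Q) x \<partial>lebesgue)
            = ennreal (inverse (side Q ^ ?d)) * J Q * emeasure lebesgue (dilate 2 Q)"
          by (rule nn_integral_cmult_indicator) simp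
        also have "emeasure lebesgue (dilate 2 Q) = ennreal ((2 * side Q) ^ ?d)"
          by (simp add: emeasure_dilate)
        also have "ennreal (inverse (side Q ^ ?d)) * J Q * \<dots> = ennreal (inverse (side Q ^ ?d) * (2 * side Q) ^ ?d) * J Q"
          by (simp add: ennreal_mult mult_ac)
        also have "inverse (side Q ^ ?d) * (2 * side Q) ^ ?d = 2 ^ ?d"
          by (simp add: power_mult_distrib)
        finally show "(\<integral>\<^sup>+x. ennreal (inverse (side Q ^ ?d)) * J Q * indicator (dilate 2 Q) x \<partial>lebesgue) = ennreal (2 ^ ?d) * J Q" .
      qed
      also have "\<dots> = ennreal (2 ^ ?d) * (\<integral>\<^sup>+Q. J Q \<partial>count_space W3)"
        by (rule nn_integral_cmult) simp
      also have "\<dots> \<le> ennreal (2 ^ ?d) * (ennreal (real N') * Y)"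
        unfolding J_def Y_def using star_subset by (intro mult_left_mono overlap_sum_le) auto
      finally show "(\<integral>\<^sup>+x. Z x \<partial>lebesgue) \<le> ennreal (2 ^ ?d * real N') * Y"
        by (simp add: ennreal_mult mult.assoc)
      show "(\<integral>\<^sup>+x. avg_power_sum f p x \<partial>lebesgue) \<le> ennreal (2 ^ ?d * real N') * X"
        unfolding X_def by (rule nn_integral_avg_power_sum_le[OF f p])
      let ?G = "\<integral>\<^sup>+x. ennreal (norm (ext f x) powr p) \<partial>lebesgue"
      have "(\<integral>\<^sup>+x. A x \<partial>lebesgue)
          = ennreal (2 powr p) * (ennreal (\<omega> powr p) * ?G + ennreal (\<omega> powr (p - 1)) * (ennreal \<omega> * ?G))"
        unfolding A_def using nn_integral_ball_average(2)[OF gm]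
        by (simp add: nn_integral_cmult nn_integral_add \<omega>_def)
      also have "\<dots> = ennreal KA * ?G"
        using omega_pos by (simp add: KA_def ennreal_mult distrib_left distrib_right mult.assoc)
      also have "\<dots> \<le> ennreal KA * (ennreal KE * X)"
        unfolding X_def KE_def KN_def by (intro mult_left_mono nn_integral_ext_power_le[OF f p]) simp
      finally show "(\<integral>\<^sup>+x. A x \<partial>lebesgue) \<le> ennreal KA * (ennreal KE * X)" .
    qed auto
    also have "\<dots> \<le> ennreal KF * (Y + X)"
    proof -
      define u where "u = 1 + 2 ^ ?d * real N' + KN * (2 ^ ?d * real N') + KA * KE"
      have u: "1 + 2 ^ ?d * real N' \<le> u" "KN * (2 ^ ?d * real N') + KA * KE \<le> u" "0 \<le> u"
        using nonneg by (auto simp: u_def intro!: add_nonneg_nonneg mult_nonneg_nonneg)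
      have "Y + ennreal (2 ^ ?d * real N') * Y + ennreal KN * (ennreal (2 ^ ?d * real N') * X) + ennreal KA * (ennreal KE * X)
         = ennreal (1 + 2 ^ ?d * real N') * Y + ennreal (KN * (2 ^ ?d * real N') + KA * KE) * X"
        using nonneg by (simp add: ennreal_mult distrib_right mult.assoc add.assoc)
      also have "\<dots> \<le> ennreal u * Y + ennreal u * X"
        using u by (intro add_mono mult_right_mono ennreal_leI) auto
      finally have "ennreal K * (Y + ennreal (2 ^ ?d * real N') * Y + ennreal KN * (ennreal (2 ^ ?d * real N') * X) + ennreal KA * (ennreal KE * X))
        \<le> ennreal K * (ennreal u * (Y + X))"
        by (intro mult_left_mono) (auto simp: distrib_left)
      also have "\<dots> = ennreal KF * (Y + X)"
        using K u by (simp add: KF_def u_def[symmetric] ennreal_mult mult.assoc)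
      finally show ?thesis .
    qed
    finally show ?thesis by (simp add: X_def Y_def \<Psi>_def mult_left_mono)
  qed
  then show ?thesis by blast
qed

text \<open>R may be any positive number: it enters K through the thresholds \<rho>0 and \<rho>1 of
  the pointwise bounds.\<close>

lemma ext_bounded:
  assumes p: "1 \<le> p" and q: "1 \<le> q" and s: "0 < s" "s < 1" and R: "0 < R"
  shows "\<exists>K::real. \<forall>f. admissible f \<longrightarrow> F_norm s 1 p q UNIV (ext f) \<le> ennreal K * F_norm s R p q \<Omega> f"
proof -
  obtain K0 where K0: "\<And>f. admissible f \<Longrightarrow>
    (\<integral>\<^sup>+x. ext_norm s p q f x \<partial>lebesgue)
    \<le> ennreal K0 * ((\<integral>\<^sup>+x\<in>\<Omega>. dom_norm s p q R f x \<partial>lebesgue)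
        + (lp_mass p \<Omega> f))"
    using seminorm_integral_bound[OF p q s R] by blast
  define K1 where "K1 = 1 + real N powr p * (2 ^ CARD('d) * real N')"
  define K2 where "K2 = max 0 K0"
  define K where "K = K1 powr (1 / p) + K2 powr (1 / p) * 2 powr (1 / p)"
  have K12: "0 \<le> K1" "0 \<le> K2" by (auto simp: K1_def K2_def)
  have p0: "0 < 1 / p" using p by simp
  have "F_norm s 1 p q UNIV (ext f) \<le> ennreal K * F_norm s R p q \<Omega> f" if f: "admissible f" for f
  proof -
    define X where "X = (lp_mass p \<Omega> f)"
    define Y where "Y = (\<integral>\<^sup>+x\<in>\<Omega>. dom_norm s p q R f x \<partial>lebesgue)"
    have norm_f: "F_norm s R p q \<Omega> f = epowr X (1 / p) + epowr Y (1 / p)"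
      by (simp add: F_norm_def Lp_norm_def F_seminorm_scale_norm X_def Y_def rdim_def)
    have "Lp_norm p UNIV (ext f) = epowr (\<integral>\<^sup>+x. ennreal (norm (ext f x) powr p) \<partial>lebesgue) (1 / p)"
      by (simp add: Lp_norm_def)
    also have "\<dots> \<le> epowr (ennreal K1 * X) (1 / p)"
      unfolding K1_def X_def using p0 by (intro epowr_mono nn_integral_ext_power_le f p) auto
    also have "\<dots> = ennreal (K1 powr (1 / p)) * epowr X (1 / p)"
      using p0 K12 by (simp add: epowr_mult epowr_ennreal)
    finally have 1: "Lp_norm p UNIV (ext f) \<le> ennreal (K1 powr (1 / p)) * epowr X (1 / p)" .
    have "F_seminorm s 1 p q UNIV (ext f)
        = epowr (\<integral>\<^sup>+x. ext_norm s p q f x \<partial>lebesgue) (1 / p)"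
      by (simp add: F_seminorm_scale_norm rdim_def)
    also have "\<dots> \<le> epowr (ennreal K2 * (Y + X)) (1 / p)"
    proof (rule epowr_mono)
      show "(\<integral>\<^sup>+x. ext_norm s p q f x \<partial>lebesgue) \<le> ennreal K2 * (Y + X)"
        unfolding K2_def ennreal_max_0 X_def Y_def by (rule K0[OF f])
    qed (use p0 in simp)
    also have "\<dots> = ennreal (K2 powr (1 / p)) * epowr (Y + X) (1 / p)"
      using p0 K12 by (simp add: epowr_mult epowr_ennreal)
    also have "\<dots> \<le> ennreal (K2 powr (1 / p)) * (ennreal (2 powr (1 / p)) * (epowr Y (1 / p) + epowr X (1 / p)))"
      using p0 by (intro mult_left_mono epowr_add_le) auto
    finally have 2: "F_seminorm s 1 p q UNIV (ext f)
        \<le> ennreal (K2 powr (1 / p) * 2 powr (1 / p)) * (epowr X (1 / p) + epowr Y (1 / p))"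
      by (simp add: ennreal_mult mult.assoc add.commute)
    have "F_norm s 1 p q UNIV (ext f) \<le> ennreal (K1 powr (1 / p)) * (epowr X (1 / p) + epowr Y (1 / p))
        + ennreal (K2 powr (1 / p) * 2 powr (1 / p)) * (epowr X (1 / p) + epowr Y (1 / p))"
      unfolding F_norm_def
      by (intro add_mono 2 order_trans[OF 1] mult_left_mono) auto
    also have "\<dots> = ennreal K * F_norm s R p q \<Omega> f"
      unfolding norm_f K_def using K12 by (simp add: distrib_right)
    finally show ?thesis .
  qed
  then show ?thesis by blast
qed

text \<open>Symmetrized cubes have finite measure, so Jensen's inequality turns the finite L^p norm
  into integrability on each of them.\<close>

lemma F_space_admissible:
  assumes f: "f \<in> borel_measurable lebesgue" and p: "1 \<le> p" and fin: "F_norm s R p q \<Omega> f < \<infinity>"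
  shows "admissible f"
proof -
  note [measurable] = f
  have "set_integrable lebesgue (cube (star Q)) f" if Q: "Q \<in> W3" for Q
  proof -
    let ?S = "cube (star Q)"
    have "Lp_norm p \<Omega> f < top" using fin by (simp add: F_norm_def)
    then have X: "(lp_mass p \<Omega> f) < top"
      unfolding Lp_norm_def by (simp add: less_top[symmetric])
    have "epowr (\<integral>\<^sup>+y\<in>?S. ennreal (norm (f y)) \<partial>lebesgue) p
        \<le> ennreal ((side Q ^ CARD('d)) powr (p - 1)) * (lp_mass p ?S f)"
      using p emeasure_cube_star[OF Q] by (intro epowr_set_nn_integral_le) auto
    also have "\<dots> \<le> ennreal ((side Q ^ CARD('d)) powr (p - 1)) * (lp_mass p \<Omega> f)"
      using star_subset[OF Q] by (intro mult_left_mono nn_integral_mono) (auto simp: indicator_def)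
    also have "\<dots> < top" using X by (simp add: ennreal_mult_less_top)
    finally have "(\<integral>\<^sup>+y\<in>?S. ennreal (norm (f y)) \<partial>lebesgue) < top"
      by (simp add: less_top[symmetric])
    moreover have "(\<integral>\<^sup>+y. ennreal (norm (indicator ?S y *\<^sub>R f y)) \<partial>lebesgue) = (\<integral>\<^sup>+y\<in>?S. ennreal (norm (f y)) \<partial>lebesgue)"
      by (intro nn_integral_cong) (auto simp: indicator_def)
    moreover have "(\<lambda>y. indicator ?S y *\<^sub>R f y) \<in> borel_measurable lebesgue"
      using f by (intro borel_measurable_scaleR borel_measurable_indicator) auto
    ultimately show ?thesis
      unfolding set_integrable_def by (intro integrableI_bounded) (simp_all only: infinity_ennreal_def)
  qed
  then show ?thesis using f by (simp add: admissible_def)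
qed

end

section \<open>Extension by zero, admissible scales and conclusion\<close>

lemma osc_cong:
  fixes U :: "(real^'d) set"
  assumes "x \<in> U" "\<And>y. y \<in> U \<Longrightarrow> f y = g y"
  shows "osc U f x = osc U g x"
  unfolding osc_def fun_eq_iff using assms
  by (intro allI nn_integral_cong) (auto simp: indicator_def)

lemma F_norm_cong:
  fixes U :: "(real^'d) set"
  assumes "\<And>y. y \<in> U \<Longrightarrow> f y = g y"
  shows "F_norm s \<rho> p q U f = F_norm s \<rho> p q U g"
proof -
  have "Lp_norm p U f = Lp_norm p U g"
    unfolding Lp_norm_def using assms
    by (intro arg_cong2[of _ _ _ _ epowr] nn_integral_cong) (auto simp: indicator_def)
  moreover have "F_seminorm s \<rho> p q U f = F_seminorm s \<rho> p q U g"
    unfolding F_seminorm_scale_norm using osc_cong[OF _ assms, where U=U]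
    by (intro arg_cong2[of _ _ _ _ epowr] nn_integral_cong) (auto simp: indicator_def)
  ultimately show ?thesis by (simp add: F_norm_def)
qed

text \<open>Only values in \<Omega> enter, so f may be replaced by its extension by zero, which is
  measurable on the whole space.\<close>

lemma Lambda0_cong:
  assumes "\<And>y. y \<in> \<Omega> \<Longrightarrow> f y = g y" and sub: "\<And>Q. Q \<in> W \<Longrightarrow> cube (star Q) \<subseteq> \<Omega>"
  shows "Lambda0 \<Omega> W \<psi> star f = Lambda0 \<Omega> W \<psi> star g"
proof
  fix x
  have "mean f (cube (star Q)) = mean g (cube (star Q))" if "Q \<in> W" for Q
    unfolding mean_def using assms(1) sub[OF that]
    by (auto intro!: arg_cong[where f = "(*\<^sub>R) _"] set_lebesgue_integral_cong simp: subset_iff)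
  then have "(\<Sum>\<^sub>\<infinity>Q\<in>W. \<psi> Q x *\<^sub>R mean f (cube (star Q))) = (\<Sum>\<^sub>\<infinity>Q\<in>W. \<psi> Q x *\<^sub>R mean g (cube (star Q)))"
    by (intro infsum_cong) simp
  moreover have "indicator \<Omega> x *\<^sub>R f x = indicator \<Omega> x *\<^sub>R g x"
    using assms(1)[of x] by (auto simp: indicator_def)
  ultimately show "Lambda0 \<Omega> W \<psi> star f x = Lambda0 \<Omega> W \<psi> star g x"
    by (simp add: Lambda0_def)
qed

lemma gderiv_bounded_imp_lipschitz:
  fixes f :: "'a::real_inner \<Rightarrow> real"
  assumes "\<And>x. \<exists>g. (GDERIV f x :> g) \<and> norm g \<le> B"
  shows "\<bar>f x - f y\<bar> \<le> B * dist x y"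
proof -
  obtain g where g: "\<And>x. GDERIV f x :> g x" "\<And>x. norm (g x) \<le> B" using assms by metis
  have "norm (f x - f y) \<le> B * norm (x - y)"
  proof (rule differentiable_bound[of UNIV f "\<lambda>x h. h \<bullet> g x"])
    show "(f has_derivative (\<lambda>h. h \<bullet> g z)) (at z within UNIV)" for z
      using g(1)[of z] by (simp add: gderiv_def)
    show "onorm (\<lambda>h. h \<bullet> g z) \<le> B" for z
    proof (rule onorm_bound)
      show "0 \<le> B" using g(2)[of z] norm_ge_zero order_trans by blast
    next
      fix h
      have "norm (h \<bullet> g z) \<le> norm h * norm (g z)" by (simp add: Cauchy_Schwarz_ineq2)
      also have "\<dots> \<le> norm h * B" using g(2) by (intro mult_left_mono) auto
      finally show "norm (h \<bullet> g z) \<le> B * norm h" by (simp add: mult.commute)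
    qed
  qed auto
  then show ?thesis by (simp add: dist_norm)
qed

text \<open>For finite \<delta>, r < 10 l \<le> c l \<le> \<eta> \<delta> \<le> \<epsilon> \<delta>;
  with r the side of a small exterior cube, the radius side / \<epsilon> is allowed in the corkscrew
  condition.\<close>

lemma admissible_scaleD:
  assumes "admissible_scale \<eta> c \<delta> \<Omega> l" "0 < \<eta>" "0 < c" "0 < \<delta>"
  shows "0 < l" "10 \<le> c \<Longrightarrow> \<eta> \<le> \<epsilon> \<Longrightarrow> 0 < \<epsilon> \<Longrightarrow> r < 10 * l \<Longrightarrow> ereal (r / \<epsilon>) \<le> \<delta>"
proof -
  show l: "0 < l" using assms by (auto simp: admissible_scale_def split: if_splits)
  assume c: "10 \<le> c" and \<epsilon>: "\<eta> \<le> \<epsilon>" "0 < \<epsilon>" and r: "r < 10 * l"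
  show "ereal (r / \<epsilon>) \<le> \<delta>"
  proof (cases \<delta>)
    case (real \<delta>')
    have "0 < \<delta>'" using assms(4) real by simp
    have "ereal (c * l) \<le> ereal \<eta> * min \<delta> 1"
      using assms(1) real by (auto simp: admissible_scale_def)
    also have "\<dots> \<le> ereal \<eta> * \<delta>" using assms(2) by (intro ereal_mult_left_mono) auto
    finally have "c * l \<le> \<eta> * \<delta>'" using real by simp
    moreover have "10 * l \<le> c * l" using c l by (intro mult_right_mono) auto
    moreover have "\<eta> * \<delta>' \<le> \<epsilon> * \<delta>'" using \<epsilon> \<open>0 < \<delta>'\<close> by (intro mult_right_mono) auto
    ultimately have "r \<le> \<delta>' * \<epsilon>" using r by (simp add: mult.commute)
    then show ?thesis using \<epsilon> real by (simp add: pos_divide_le_eq)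
  qed (use assms in auto)
qed

text \<open>The exterior covering constant is fixed along with \<epsilon> because the distance from
  a cube Q to the frontier enters the least admissible C.\<close>

theorem theorem4p3:
  fixes \<epsilon> C\<^sub>2 :: real
  assumes "0 < \<epsilon>" and "0 < C\<^sub>2"
  shows "\<exists>C\<^sub>m\<^sub>i\<^sub>n>0. \<exists>c\<^sub>m\<^sub>i\<^sub>n>0. \<exists>\<eta>>0. \<forall>C\<ge>C\<^sub>m\<^sub>i\<^sub>n. \<forall>c\<^sub>0\<ge>c\<^sub>m\<^sub>i\<^sub>n.
    \<forall>(\<Omega> :: (real^'d) set) (\<delta> :: ereal) (l\<^sub>0 :: real) W\<^sub>0 W\<^sub>1 W\<^sub>2 W\<^sub>3 \<psi>.
      0 < \<delta> \<and> interior_corkscrew_domain \<epsilon> \<delta> \<Omega> \<and>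
      corkscrew_covering \<epsilon> \<delta> \<Omega> W\<^sub>0 \<and>
      whitney_covering_const C\<^sub>2 (- closure \<Omega>) W\<^sub>2 \<and>
      whitney_partition (- closure \<Omega>) W\<^sub>2 \<psi> \<and>
      admissible_scale \<eta> c\<^sub>0 \<delta> \<Omega> l\<^sub>0 \<and>
      W\<^sub>1 = small_cubes (c\<^sub>0 * l\<^sub>0) W\<^sub>0 \<and>
      W\<^sub>3 = small_cubes (10 * l\<^sub>0) W\<^sub>2
      \<longrightarrow>
      (\<forall>Q\<in>W\<^sub>3. \<exists>S\<in>W\<^sub>1. symmetrized C Q S) \<and>
      (\<forall>star (p :: real) (q :: ennreal) (s :: real).
         (\<forall>Q\<in>W\<^sub>3. star Q \<in> W\<^sub>1 \<and> symmetrized C Q (star Q)) \<and>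
         1 \<le> p \<and> 1 \<le> q \<and> 0 < s \<and> s < 1
         \<longrightarrow>
         (\<exists>K::real. \<forall>f \<in> F_space s (C * l\<^sub>0) p q \<Omega>.
            Lambda0 \<Omega> W\<^sub>3 \<psi> star f \<in> F_space s 1 p q UNIV \<and>
            F_norm s 1 p q UNIV (Lambda0 \<Omega> W\<^sub>3 \<psi> star f)
              \<le> ennreal K * F_norm s (C * l\<^sub>0) p q \<Omega> f))"
proof -
  \<comment> \<open>The total length found in \<open>exists_symmetrized_cube\<close>. Below,
    \<open>c\<^sub>0 \<ge> 10\<close> ensures that a cube with the side of some Q in
    \<open>W\<^sub>3\<close> passes the size bound of \<open>W\<^sub>1\<close>.\<close>
  define C\<^sub>m where "C\<^sub>m = 2 * real CARD('d) + 4 * C\<^sub>2 + 2 + 1 / \<epsilon>"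
  have C\<^sub>m: "0 < C\<^sub>m" using assms by (simp add: C\<^sub>m_def add_pos_pos add_nonneg_pos)
  show ?thesis
  proof (rule exI[of _ C\<^sub>m], rule conjI[OF C\<^sub>m], rule exI[of _ 10], rule conjI, simp,
      rule exI[of _ \<epsilon>], rule conjI[OF assms(1)], intro allI impI, elim conjE)
    fix C c\<^sub>0 :: real and \<Omega> :: "(real^'d) set" and \<delta> :: ereal and l\<^sub>0 :: real
      and W\<^sub>0 W\<^sub>1 W\<^sub>2 W\<^sub>3 :: "'d dyadic set" and \<psi> :: "'d dyadic \<Rightarrow> real^'d \<Rightarrow> real"
    assume C: "C\<^sub>m \<le> C" and c0: "10 \<le> c\<^sub>0" and \<delta>: "0 < \<delta>"
      and dom: "interior_corkscrew_domain \<epsilon> \<delta> \<Omega>" and cork: "corkscrew_covering \<epsilon> \<delta> \<Omega> W\<^sub>0"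
      and W2: "whitney_covering_const C\<^sub>2 (- closure \<Omega>) W\<^sub>2"
      and part: "whitney_partition (- closure \<Omega>) W\<^sub>2 \<psi>"
      and scale: "admissible_scale \<epsilon> c\<^sub>0 \<delta> \<Omega> l\<^sub>0"
      and W1: "W\<^sub>1 = small_cubes (c\<^sub>0 * l\<^sub>0) W\<^sub>0" and W3: "W\<^sub>3 = small_cubes (10 * l\<^sub>0) W\<^sub>2"
    have op: "open \<Omega>" using dom by (simp add: interior_corkscrew_domain_def)
    have c0pos: "0 < c\<^sub>0" using c0 by simp
    have l0: "0 < l\<^sub>0" using admissible_scaleD(1)[OF scale assms(1) c0pos \<delta>] .
    have "\<forall>Q\<in>W\<^sub>3. \<exists>S\<in>W\<^sub>1. symmetrized C Q S"
    proof
      fix Q assume "Q \<in> W\<^sub>3"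
      then have Q: "Q \<in> W\<^sub>2" "side Q < 10 * l\<^sub>0" by (auto simp: W3 small_cubes_def)
      have "ereal (side Q / \<epsilon>) \<le> \<delta>"
        using admissible_scaleD(2)[OF scale assms(1) c0pos \<delta> c0 order_refl assms(1) Q(2)] .
      then obtain S where S: "S \<in> W\<^sub>0" "symmetrized C Q S"
        using exists_symmetrized_cube[OF assms(1) op cork W2 Q(1)] C unfolding C\<^sub>m_def by blast
      have "10 * l\<^sub>0 \<le> c\<^sub>0 * l\<^sub>0" using c0 l0 by (intro mult_right_mono) auto
      then have "side S < c\<^sub>0 * l\<^sub>0" using S Q by (simp add: symmetrized_def)
      then show "\<exists>S\<in>W\<^sub>1. symmetrized C Q S" using S unfolding W1 small_cubes_def by blast
    qed
    moreover have "\<exists>K::real. \<forall>f \<in> F_space s (C * l\<^sub>0) p q \<Omega>.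
            Lambda0 \<Omega> W\<^sub>3 \<psi> star f \<in> F_space s 1 p q UNIV \<and>
            F_norm s 1 p q UNIV (Lambda0 \<Omega> W\<^sub>3 \<psi> star f)
              \<le> ennreal K * F_norm s (C * l\<^sub>0) p q \<Omega> f"
      if star: "\<forall>Q\<in>W\<^sub>3. star Q \<in> W\<^sub>1 \<and> symmetrized C Q (star Q)"
        and p: "1 \<le> p" and q: "1 \<le> q" and s: "0 < s" "s < 1"
      for star and p :: real and q :: ennreal and s :: real
    proof -
      obtain C0 where W0: "whitney_covering_const C0 \<Omega> W\<^sub>0"
        using cork by (auto simp: corkscrew_covering_def whitney_covering_def)
      obtain N where N: "\<And>x. finite {Q \<in> W\<^sub>2. x \<in> dilate 50 Q}" "\<And>x. card {Q \<in> W\<^sub>2. x \<in> dilate 50 Q} \<le> N"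
        using whitney_const_D(6)[OF W2] by blast
      obtain M where M: "\<And>Q x. Q \<in> W\<^sub>2 \<Longrightarrow> \<exists>g. (GDERIV (\<psi> Q) x :> g) \<and> norm g \<le> M / side Q"
        using part unfolding whitney_partition_def by blast
      \<comment> \<open>A negative M can occur when \<open>W\<^sub>2\<close> is empty; the maximum
        with 0 covers this case.\<close>
      have lip: "\<bar>\<psi> Q x - \<psi> Q y\<bar> \<le> max 0 M / side Q * dist x y" if "Q \<in> W\<^sub>2" for Q x y
      proof (rule gderiv_bounded_imp_lipschitz)
        fix x
        have "M / side Q \<le> max 0 M / side Q" by (intro divide_right_mono) auto
        then show "\<exists>g. (GDERIV (\<psi> Q) x :> g) \<and> norm g \<le> max 0 M / side Q"
          using M[OF that, of x] order_trans by blast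
      qed
      interpret whitney_extension \<Omega> W\<^sub>0 W\<^sub>2 W\<^sub>3 \<psi> star C\<^sub>2 "10 * l\<^sub>0" C "max 0 M" N
      proof
        show "negligible (frontier \<Omega>)" by (rule corkscrew_frontier_negligible[OF assms(1) \<delta> op cork])
        show "cube Q \<subseteq> \<Omega>" if "Q \<in> W\<^sub>0" for Q using whitney_const_D(3)[OF W0] that closure_subset by blast
        show "disjoint_family_on cube W\<^sub>0" by (rule whitney_const_D(2)[OF W0])
        show "W\<^sub>3 = {Q \<in> W\<^sub>2. side Q < 10 * l\<^sub>0}" by (simp add: W3 small_cubes_def)
        show "star Q \<in> W\<^sub>0" "symmetrized C Q (star Q)" if "Q \<in> W\<^sub>3" for Q
          using star that by (auto simp: W1 small_cubes_def)
      qed (use op W2 N lip part l0 C C\<^sub>m in \<open>auto simp: whitney_partition_def\<close>)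
      have R: "0 < C * l\<^sub>0" using C C\<^sub>m l0 by simp
      obtain K :: real where K: "\<And>f. admissible f \<Longrightarrow> F_norm s 1 p q UNIV (ext f) \<le> ennreal K * F_norm s (C * l\<^sub>0) p q \<Omega> f"
        using ext_bounded[OF p q s R] by blast
      have "Lambda0 \<Omega> W\<^sub>3 \<psi> star f \<in> F_space s 1 p q UNIV \<and>
            F_norm s 1 p q UNIV (Lambda0 \<Omega> W\<^sub>3 \<psi> star f) \<le> ennreal K * F_norm s (C * l\<^sub>0) p q \<Omega> f"
        if f: "f \<in> F_space s (C * l\<^sub>0) p q \<Omega>" for f
      proof -
        \<comment> \<open>f is measurable only relative to \<Omega>, whereas the estimates concern
          functions measurable on the whole space.\<close>
        define F where "F x = (if x \<in> \<Omega> then f x else 0)" for x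
        have F: "F y = f y" if "y \<in> \<Omega>" for y using that by (simp add: F_def)
        have "\<Omega> \<in> sets lebesgue" by simp
        moreover have "f \<in> borel_measurable (lebesgue_on \<Omega>)" using f by (simp add: F_space_def)
        ultimately have Fm: "F \<in> borel_measurable lebesgue"
          unfolding F_def by (simp add: borel_measurable_if)
        have norm_eq: "F_norm s (C * l\<^sub>0) p q \<Omega> F = F_norm s (C * l\<^sub>0) p q \<Omega> f" by (rule F_norm_cong) (rule F)
        have ext_eq: "ext F = Lambda0 \<Omega> W\<^sub>3 \<psi> star f"
          unfolding ext_def by (rule Lambda0_cong[OF F star_subset])
        have fin: "F_norm s (C * l\<^sub>0) p q \<Omega> f < \<infinity>" using f by (simp add: F_space_def)
        have "admissible F"
          using fin by (intro F_space_admissible[OF Fm p, of s "C * l\<^sub>0" q]) (simp add: norm_eq)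
        from K[OF this] have le: "F_norm s 1 p q UNIV (Lambda0 \<Omega> W\<^sub>3 \<psi> star f) \<le> ennreal K * F_norm s (C * l\<^sub>0) p q \<Omega> f"
          by (simp add: ext_eq norm_eq)
        also have "\<dots> < \<infinity>" using fin by (simp add: ennreal_mult_less_top)
        finally have "F_norm s 1 p q UNIV (Lambda0 \<Omega> W\<^sub>3 \<psi> star f) < \<infinity>" .
        moreover have "Lambda0 \<Omega> W\<^sub>3 \<psi> star f \<in> borel_measurable lebesgue"
          using ext_measurable[OF Fm] by (simp add: ext_eq)
        ultimately show ?thesis using le by (simp add: F_space_def lebesgue_on_UNIV_eq)
      qed
      then show ?thesis by blast
    qed
    ultimately show "(\<forall>Q\<in>W\<^sub>3. \<exists>S\<in>W\<^sub>1. symmetrized C Q S) \<and>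
      (\<forall>star (p :: real) (q :: ennreal) (s :: real).
         (\<forall>Q\<in>W\<^sub>3. star Q \<in> W\<^sub>1 \<and> symmetrized C Q (star Q)) \<and>
         1 \<le> p \<and> 1 \<le> q \<and> 0 < s \<and> s < 1
         \<longrightarrow>
         (\<exists>K::real. \<forall>f \<in> F_space s (C * l\<^sub>0) p q \<Omega>.
            Lambda0 \<Omega> W\<^sub>3 \<psi> star f \<in> F_space s 1 p q UNIV \<and>
            F_norm s 1 p q UNIV (Lambda0 \<Omega> W\<^sub>3 \<psi> star f)
              \<le> ennreal K * F_norm s (C * l\<^sub>0) p q \<Omega> f))"
      by blast
  qed
qed

end
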